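(* Let $P$ be a primitive stochastic $N\times N$ matrix and $A=(A_i)_{i\in X}$, $X=\{1,\dots,N\}$, a family of matrices in $\mathrm{GL}(2,\mathbb R)$. Suppose that $\lambda_+(A,P)=\lambda_-(A,P)=:\lambda_0$. Then there are $C>0$ and $\delta_0\in(0,1)$ such that $$|\lambda_+(B,Q)-\lambda_0|\le C\left(\log\frac1{\Delta((A,P),(B,Q))}\right)^{-1/2}\quad\text{and}\quad |\lambda_-(B,Q)-\lambda_0|\le C\left(\log\frac1{\Delta((A,P),(B,Q))}\right)^{-1/2}$$ for every $B=(B_i)_{i\in X}$ in $\mathrm{GL}(2,\mathbb R)$ and every stochastic matrix $Q$ with the same transition graph as $P$ such that $0<\Delta((A,P),(B,Q))<\delta_0$. If moreover $(A,P)$ is in the compact normal form case, then the power $-1/2$ may be replaced by $-1$ in both inequalities.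
   Context: A stochastic matrix $P$ is primitive if some power $P^{m_0}$ has all entries positive; it then has a unique stationary probability row vector $p(P)$, $p(P)P=p(P)$, with positive entries. Let $(X_k)_{k\ge0}$ be the stationary Markov chain on $X$ with transition matrix $P$ and initial law $p(P)$, and set $A^{(n)}=A_{X_{n-1}}\cdots A_{X_1}A_{X_0}$. The extremal Lyapunov exponents are the almost sure constants $$\lambda_+(A,P)=\lim_n\tfrac1n\log\|A^{(n)}\|,\qquad \lambda_-(A,P)=-\lim_n\tfrac1n\log\|(A^{(n)})^{-1}\|,$$ with $\|\cdot\|$ a fixed operator norm on $2\times2$ real matrices. Two stochastic matrices $P,Q$ have the same transition graph if $P_{ij}>0\iff Q_{ij}>0$ for all $i,j$. The distance is $$\Delta((A,P),(B,Q))=\max_i\bigl(\|A_i-B_i\|+\|A_i^{-1}-B_i^{-1}\|\bigr)+\max_i\sum_j|P_{ij}-Q_{ij}|.$$ Determinant normalization: $\widehat A_i=|\det A_i|^{-1/2}A_i$. The pair $(A,P)$ is in the compact normal form (conformal) case if there are matrices $C_i\in\mathrm{GL}(2,\mathbb R)$, $i\in X$, and a compact subgroup of $\mathrm{GL}(2,\mathbb R)$ containing all the matrices $T_{ij}=C_j^{-1}\widehat A_iC_i$ with $P_{ij}>0$. *)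

theory Defs
  imports "HOL-Probability.Probability"
begin

text \<open>
  The finite index set is the universe of a type of class \<open>finite\<close>. Transition matrices have type
  \<open>real ^ 'n ^ 'n\<close>, the entry in row \<open>i\<close> and column \<open>j\<close> being \<open>P $ i $ j\<close>; probability row vectors
  act from the left by \<^term>\<open>p v* P\<close>.
\<close>

section \<open>Stochastic matrices\<close>

definition prob_vector :: "real ^ 'n::finite \<Rightarrow> bool" where
  "prob_vector p \<longleftrightarrow> (\<forall>i. 0 \<le> p $ i) \<and> (\<Sum>i\<in>UNIV. p $ i) = 1"

definition stochastic :: "real ^ 'n::finite ^ 'n \<Rightarrow> bool" where
  "stochastic P \<longleftrightarrow> (\<forall>i. prob_vector (P $ i))"

(* The power operation on square matrices; HOL-Analysis does not provide one. *)
definition mat_power :: "real ^ 'n::finite ^ 'n \<Rightarrow> nat \<Rightarrow> real ^ 'n ^ 'n" where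
  "mat_power P m = (((**) P) ^^ m) (mat 1)"

definition primitive :: "real ^ 'n::finite ^ 'n \<Rightarrow> bool" where
  "primitive P \<longleftrightarrow> stochastic P \<and> (\<exists>m>0. \<forall>i j. 0 < mat_power P m $ i $ j)"

definition stationary_vector :: "real ^ 'n::finite ^ 'n \<Rightarrow> real ^ 'n" where
  "stationary_vector P = (THE p. prob_vector p \<and> p v* P = p)"

definition same_transition_graph ::
    "real ^ 'n::finite ^ 'n \<Rightarrow> real ^ 'n ^ 'n \<Rightarrow> bool" where
  "same_transition_graph P Q \<longleftrightarrow> (\<forall>i j. 0 < P $ i $ j \<longleftrightarrow> 0 < Q $ i $ j)"


section \<open>The law of a Markov chain on the space of trajectories\<close>

definition vector_measure :: "real ^ 'n::finite \<Rightarrow> 'n measure" where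
  "vector_measure p = point_measure UNIV (\<lambda>i. ennreal (p $ i))"

(* The conditional law of the k-th state, given the states 0, ..., k - 1. *)
definition markov_kernel ::
    "real ^ 'n::finite ^ 'n \<Rightarrow> real ^ 'n \<Rightarrow> nat \<Rightarrow> (nat \<Rightarrow> 'n) \<Rightarrow> 'n measure" where
  "markov_kernel P p k \<omega> =
     (case k of 0 \<Rightarrow> vector_measure p | Suc m \<Rightarrow> vector_measure (P $ \<omega> m))"

(* Inside the locale Ionescu_Tulcea this is the measure PF.lim; the k-th state of the chain is the
   coordinate function (\<lambda>\<omega>. \<omega> k). The lemma emeasure_markov_measure_cylinder below gives the
   finite-dimensional distributions. *)
definition markov_measure ::
    "real ^ 'n::finite ^ 'n \<Rightarrow> real ^ 'n \<Rightarrow> (nat \<Rightarrow> 'n) measure" where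
  "markov_measure P p =
     projective_family.lim UNIV
       (Ionescu_Tulcea.CI (markov_kernel P p) (\<lambda>_. count_space UNIV)) (\<lambda>_. count_space UNIV)"

definition stationary_chain :: "real ^ 'n::finite ^ 'n \<Rightarrow> (nat \<Rightarrow> 'n) measure" where
  "stationary_chain P = markov_measure P (stationary_vector P)"


section \<open>Operator norms, cocycles and Lyapunov exponents\<close>

definition is_norm :: "('v::real_vector \<Rightarrow> real) \<Rightarrow> bool" where
  "is_norm \<nu> \<longleftrightarrow>
     (\<forall>v. 0 \<le> \<nu> v) \<and> (\<forall>v. \<nu> v = 0 \<longleftrightarrow> v = 0) \<and>
     (\<forall>c v. \<nu> (c *\<^sub>R v) = \<bar>c\<bar> * \<nu> v) \<and> (\<forall>v w. \<nu> (v + w) \<le> \<nu> v + \<nu> w)"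

(* The operator norm induced by an arbitrary vector norm, defined like onorm: the division by zero
   at v = 0 contributes the harmless value 0. *)
definition op_norm :: "(real ^ 2 \<Rightarrow> real) \<Rightarrow> real ^ 2 ^ 2 \<Rightarrow> real" where
  "op_norm \<nu> M = (SUP v. \<nu> (M *v v) / \<nu> v)"

primrec cocycle :: "('n \<Rightarrow> real ^ 2 ^ 2) \<Rightarrow> (nat \<Rightarrow> 'n) \<Rightarrow> nat \<Rightarrow> real ^ 2 ^ 2" where
  "cocycle A \<omega> 0 = mat 1"
| "cocycle A \<omega> (Suc n) = A (\<omega> n) ** cocycle A \<omega> n"

definition lyapunov_plus ::
    "(real ^ 2 \<Rightarrow> real) \<Rightarrow> ('n::finite \<Rightarrow> real ^ 2 ^ 2) \<Rightarrow> real ^ 'n ^ 'n \<Rightarrow> real" where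
  "lyapunov_plus \<nu> A P =
     (THE l. AE \<omega> in stationary_chain P.
        (\<lambda>n. 1 / real n * ln (op_norm \<nu> (cocycle A \<omega> n))) \<longlonglongrightarrow> l)"

definition lyapunov_minus ::
    "(real ^ 2 \<Rightarrow> real) \<Rightarrow> ('n::finite \<Rightarrow> real ^ 2 ^ 2) \<Rightarrow> real ^ 'n ^ 'n \<Rightarrow> real" where
  "lyapunov_minus \<nu> A P =
     (THE l. AE \<omega> in stationary_chain P.
        (\<lambda>n. - (1 / real n * ln (op_norm \<nu> (matrix_inv (cocycle A \<omega> n))))) \<longlonglongrightarrow> l)"

definition pair_dist ::
    "(real ^ 2 \<Rightarrow> real) \<Rightarrow> ('n::finite \<Rightarrow> real ^ 2 ^ 2) \<Rightarrow> real ^ 'n ^ 'n \<Rightarrow>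
     ('n \<Rightarrow> real ^ 2 ^ 2) \<Rightarrow> real ^ 'n ^ 'n \<Rightarrow> real" where
  "pair_dist \<nu> A P B Q =
     (MAX i. op_norm \<nu> (A i - B i) + op_norm \<nu> (matrix_inv (A i) - matrix_inv (B i))) +
     (MAX i. \<Sum>j\<in>UNIV. \<bar>P $ i $ j - Q $ i $ j\<bar>)"


section \<open>The compact normal form case\<close>

definition det_normalized :: "real ^ 2 ^ 2 \<Rightarrow> real ^ 2 ^ 2" where
  "det_normalized M = (\<bar>det M\<bar> powr (-1/2)) *\<^sub>R M"

definition GL2_subgroup :: "(real ^ 2 ^ 2) set \<Rightarrow> bool" where
  "GL2_subgroup K \<longleftrightarrow>
     (\<forall>M\<in>K. invertible M) \<and> mat 1 \<in> K \<and>
     (\<forall>M\<in>K. \<forall>M'\<in>K. M ** M' \<in> K) \<and> (\<forall>M\<in>K. matrix_inv M \<in> K)"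

definition compact_normal_form ::
    "('n::finite \<Rightarrow> real ^ 2 ^ 2) \<Rightarrow> real ^ 'n ^ 'n \<Rightarrow> bool" where
  "compact_normal_form A P \<longleftrightarrow>
     (\<exists>C K. (\<forall>i. invertible (C i)) \<and> GL2_subgroup K \<and> compact K \<and>
        (\<forall>i j. 0 < P $ i $ j \<longrightarrow> matrix_inv (C j) ** det_normalized (A i) ** C i \<in> K))"


section \<open>Finite-dimensional distributions of the Markov chain\<close>

lemma prob_space_vector_measure:
  assumes "prob_vector p" shows "prob_space (vector_measure p)"
proof
  have "emeasure (vector_measure p) (space (vector_measure p)) = (\<Sum>i\<in>UNIV. ennreal (p $ i))"
    unfolding vector_measure_def
    by (subst emeasure_point_measure_finite) (auto simp: space_point_measure)
  also have "\<dots> = ennreal (\<Sum>i\<in>UNIV. p $ i)"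
    using assms by (subst sum_ennreal) (auto simp: prob_vector_def)
  finally show "emeasure (vector_measure p) (space (vector_measure p)) = 1"
    using assms by (simp add: prob_vector_def)
qed

lemma sets_vector_measure: "sets (vector_measure p) = UNIV"
  by (simp add: vector_measure_def sets_point_measure)

lemma vector_measure_in_subprob:
  assumes "prob_vector p"
  shows "vector_measure p \<in> space (subprob_algebra (count_space UNIV))"
  using prob_space_vector_measure[OF assms]
  by (auto simp: space_subprob_algebra sets_vector_measure prob_space_imp_subprob_space)

lemma Ionescu_Tulcea_markov:
  fixes P :: "real ^ 'n::finite ^ 'n"
  assumes P: "stochastic P" and p: "prob_vector p"
  shows "Ionescu_Tulcea (markov_kernel P p) (\<lambda>_. count_space UNIV)"
proof (rule Ionescu_Tulcea.intro)
  have row: "prob_vector (P $ i)" for i using P by (simp add: stochastic_def)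
  show "markov_kernel P p k \<in>
      PiM {0..<k} (\<lambda>_. count_space UNIV) \<rightarrow>\<^sub>M subprob_algebra (count_space UNIV)" for k
  proof (cases k)
    case 0
    then show ?thesis using vector_measure_in_subprob[OF p]
      by (simp add: markov_kernel_def[abs_def])
  next
    case (Suc m)
    have 1: "(\<lambda>\<omega>. \<omega> m) \<in> PiM {0..<k} (\<lambda>_. count_space UNIV) \<rightarrow>\<^sub>M count_space (UNIV::'n set)"
      using Suc by (intro measurable_component_singleton) auto
    have 2: "(\<lambda>i. vector_measure (P $ i)) \<in>
        count_space UNIV \<rightarrow>\<^sub>M subprob_algebra (count_space (UNIV::'n set))"
      using vector_measure_in_subprob[OF row] by simp
    show ?thesis using measurable_compose[OF 1 2] unfolding Suc
      by (simp add: markov_kernel_def[abs_def])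
  qed
  show "prob_space (markov_kernel P p k \<omega>)" for k \<omega>
    using prob_space_vector_measure[OF p] prob_space_vector_measure[OF row]
    by (auto simp: markov_kernel_def split: nat.split)
qed

lemma
  fixes P :: "real ^ 'n::finite ^ 'n"
  assumes P: "stochastic P" and p: "prob_vector p"
  shows prob_space_markov_measure: "prob_space (markov_measure P p)"
    and sets_markov_measure:
      "sets (markov_measure P p) = sets (PiM UNIV (\<lambda>_. count_space UNIV))"
    and emeasure_markov_measure_cylinder:
      "emeasure (markov_measure P p) {\<omega>. \<forall>k\<le>n. \<omega> k = x k} =
        ennreal (p $ x 0 * (\<Prod>k<n. P $ x k $ x (Suc k)))"
proof -
  let ?M = "\<lambda>_::nat. count_space (UNIV::'n set)"
  interpret IT: Ionescu_Tulcea "markov_kernel P p" ?M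
    by (rule Ionescu_Tulcea_markov[OF P p])
  have eq: "markov_measure P p = IT.PF.lim" by (simp add: markov_measure_def)
  show sts: "sets (markov_measure P p) = sets (PiM UNIV ?M)" by (simp add: eq)
  have "emeasure IT.PF.lim (IT.PF.emb UNIV {} (space (PiM {} ?M))) =
      emeasure (IT.CI {}) (space (PiM {} ?M))"
    by (rule IT.lim) auto
  moreover have "emeasure (IT.CI {}) (space (PiM {} ?M)) = 1"
    using prob_space.emeasure_space_1[OF IT.PF.prob_space_P[of "{}"]] by (simp add: IT.PF.space_P)
  moreover have "IT.PF.emb UNIV {} (space (PiM {} ?M)) = UNIV"
    by (auto simp: prod_emb_def space_PiM)
  ultimately show "prob_space (markov_measure P p)"
    by (intro prob_spaceI) (simp add: eq IT.PF.space_lim space_PiM)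
  define y where "y m = restrict x {0..<m}" for m
  have pt: "{y m} \<in> sets (PiM {0..<m} ?M)" for m
  proof -
    have "{y m} = PiE {0..<m} (\<lambda>k. {x k})"
    proof -
      have "PiE {0..<m} (\<lambda>k. {x k}) = PiE {0..<m} (\<lambda>k. {y m k})"
        by (intro PiE_cong) (auto simp: y_def)
      then show ?thesis
        using PiE_singleton[of "y m" "{0..<m}"] by (simp add: y_def)
    qed
    then show ?thesis by (simp add: sets_PiM_I_finite)
  qed
  have ysp: "y m \<in> space (PiM {0..<m} ?M)" for m by (simp add: y_def space_PiM)
  have vm: "emeasure (vector_measure q) {i} = ennreal (q $ i)" for q :: "real ^ 'n" and i
    unfolding vector_measure_def by (subst emeasure_point_measure_finite) auto
  have step: "emeasure (IT.eP m \<omega>) {y (Suc m)} =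
      indicator {y m} \<omega> * emeasure (markov_kernel P p m \<omega>) {x m}"
    if \<omega>: "\<omega> \<in> space (PiM {0..<m} ?M)" for m \<omega>
  proof -
    have iff: "fun_upd \<omega> m z = y (Suc m) \<longleftrightarrow> \<omega> = y m \<and> z = x m" for z
    proof
      assume *: "fun_upd \<omega> m z = y (Suc m)"
      have "\<omega> k = y m k" for k
        using fun_cong[OF *, of k] \<omega>
        by (cases "k = m"; cases "k < m") (auto simp: y_def space_PiM PiE_def extensional_def)
      moreover have "z = x m" using fun_cong[OF *, of m] by (simp add: y_def)
      ultimately show "\<omega> = y m \<and> z = x m" by auto
    next
      assume "\<omega> = y m \<and> z = x m"
      then show "fun_upd \<omega> m z = y (Suc m)" by (auto simp: y_def fun_eq_iff)
    qed
    have "(\<lambda>z. fun_upd \<omega> m z) -` {y (Suc m)} \<inter> space (?M m) = (if \<omega> = y m then {x m} else {})"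
      using iff by auto
    then show ?thesis by (subst IT.emeasure_eP[OF \<omega> pt]) auto
  qed
  have Ceq: "emeasure (IT.C 0 (Suc m) (\<lambda>_. undefined)) {y (Suc m)} =
      emeasure (IT.C 0 m (\<lambda>_. undefined)) {y m} * emeasure (markov_kernel P p m (y m)) {x m}" for m
  proof -
    let ?C = "IT.C 0 m (\<lambda>_. undefined)"
    have u: "(\<lambda>_. undefined) \<in> space (PiM {0..<0} ?M)" by (simp add: space_PiM)
    have sC: "sets ?C = sets (PiM {0..<m} ?M)" using IT.sets_C[OF u, of m] by simp
    have spC: "space ?C = space (PiM {0..<m} ?M)" using sets_eq_imp_space_eq[OF sC] .
    have "emeasure (IT.C 0 (Suc m) (\<lambda>_. undefined)) {y (Suc m)} =
        (\<integral>\<^sup>+\<omega>. emeasure (IT.eP m \<omega>) {y (Suc m)} \<partial>?C)"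
      using IT.measurable_eP[of m] pt[of "Suc m"] ysp[of m]
      by (subst IT.C.simps, simp, subst emeasure_bind[where N = "PiM {0..<Suc m} ?M"])
        (auto simp: spC measurable_cong_sets[OF sC refl])
    also have "\<dots> = (\<integral>\<^sup>+\<omega>. emeasure (markov_kernel P p m (y m)) {x m} * indicator {y m} \<omega> \<partial>?C)"
      by (intro nn_integral_cong) (auto simp: spC step indicator_def)
    also have "\<dots> = emeasure (markov_kernel P p m (y m)) {x m} * emeasure ?C {y m}"
      using pt[of m] sC by (intro nn_integral_cmult_indicator) simp
    finally show ?thesis by (simp add: mult.commute)
  qed
  have C0: "emeasure (IT.C 0 0 (\<lambda>_. undefined)) {y 0} = 1"
    using pt[of 0] by (simp add: y_def restrict_def)
  have nonneg: "0 \<le> p $ i" "0 \<le> P $ i $ j" for i j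
    using P p by (auto simp: stochastic_def prob_vector_def)
  have C: "emeasure (IT.C 0 (Suc m) (\<lambda>_. undefined)) {y (Suc m)} =
      ennreal (p $ x 0 * (\<Prod>k<m. P $ x k $ x (Suc k)))" for m
  proof (induction m)
    case 0
    then show ?case by (subst Ceq, subst C0) (simp add: markov_kernel_def vm)
  next
    case (Suc m)
    have "emeasure (markov_kernel P p (Suc m) (y (Suc m))) {x (Suc m)} =
        ennreal (P $ x m $ x (Suc m))"
      by (simp add: markov_kernel_def vm y_def)
    then show ?case
      using nonneg
      by (subst Ceq, subst Suc) (simp add: prod_nonneg mult.assoc flip: ennreal_mult)
  qed
  have "{\<omega>. \<forall>k\<le>n. \<omega> k = x k} = IT.PF.emb UNIV {0..<Suc n} {y (Suc n)}"
    by (auto simp: prod_emb_def y_def fun_eq_iff restrict_def space_PiM less_Suc_eq_le) metis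
  then have "emeasure (markov_measure P p) {\<omega>. \<forall>k\<le>n. \<omega> k = x k} =
      emeasure (IT.CI {0..<Suc n}) {y (Suc n)}"
    using IT.lim[OF _ pt[of "Suc n"]] eq by simp
  also have "\<dots> = emeasure (IT.C 0 (Suc n) (\<lambda>_. undefined)) (IT.PF.emb {0..<Suc n} {0..<Suc n} {y (Suc n)})"
    by (rule IT.emeasure_CI[OF _ pt]) simp
  also have "IT.PF.emb {0..<Suc n} {0..<Suc n} {y (Suc n)} = {y (Suc n)}"
    using pt[of "Suc n"] by (intro prod_emb_id) (auto simp: y_def PiE_def)
  finally show "emeasure (markov_measure P p) {\<omega>. \<forall>k\<le>n. \<omega> k = x k} =
        ennreal (p $ x 0 * (\<Prod>k<n. P $ x k $ x (Suc k)))"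
    by (simp only: C)
qed

end

theory Submission
  imports Defs
begin

text \<open>
  Normalizing determinants reduces the claim to an upper bound for the growth rate \<open>L(B, Q)\<close> of a
  unimodular pair near \<open>(A, P)\<close> with \<open>L(A, P) = 0\<close>, because \<open>\<lambda>\<^sub>+ + \<lambda>\<^sub>-\<close> is Lipschitz. For every \<open>n\<close>, \<open>L(B, Q)\<close> is
  at most \<open>1 / n\<close> times the mean logarithm of the norm of the \<open>n\<close>-step product; the latter changes by a bounded
  amount between \<open>(B, Q)\<close> and \<open>(A, P)\<close> if \<open>n\<close> is a small multiple of \<open>ln (1 / \<Delta>)\<close>. It remains to see that
  for \<open>(A, P)\<close> it is \<open>O(sqrt n)\<close> in suitable norms.

  If \<open>L(A, P) = 0\<close>, then the isometries \<open>f \<mapsto> f \<circ> A\<^sub>i\<close> of \<open>L\<^sup>2(\<real>\<^sup>2)\<close>, averaged with the weights \<open>P\<close>, have almost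
  invariant vectors, whose squares converge to a family of finitely additive probability measures \<open>m\<^sub>i\<close> with
  \<open>(A\<^sub>i)\<^sub>* m\<^sub>i = m\<^sub>j\<close> whenever \<open>P\<^sub>i\<^sub>j > 0\<close>. If the products of the \<open>A\<^sub>i\<close> are unbounded, this forces atoms of mass
  at least \<open>2 / 5\<close> in the space of directions, hence invariant families of one or two lines. The logarithmic
  growth along these lines is a signed additive functional of the chain, which is a martingale up to a bounded
  error by the Poisson equation, and therefore has size \<open>O(sqrt n)\<close>.
\<close>

section \<open>Trajectories of a Markov chain\<close>

text \<open>Almost invariance comes from the indicator of the unit disc, to which the averaged
  isometries are applied n times. If E is the mean logarithm of the norm of the n-step product,
  Markov's inequality keeps the result at least 1/2, on average over the states, on the disc of
  radius exp(-2E - 1). Its squared L2 norm is therefore at least a constant times exp(-4E), and zero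
  growth means that E = o(n). The norm lost in one step is a conditional variance, and the
  logarithms of the relative losses telescope, so they are small on average. Cesaro means of the
  normalized squares are then almost invariant along every single edge. The plane with Lebesgue
  measure makes the operators isometric; cones then play the role of arcs of directions. Two lines
  may be exchanged along edges, and this is where the signs come from. Either a relabelling removes
  the signs, which leaves a single invariant line, or the twisted Poisson equation is solvable for
  every right-hand side. With a single line the functional must be centred, and zero growth is used
  a second time to see that it is.\<close>

abbreviation traj :: "(nat \<Rightarrow> 'n) measure" where
  "traj \<equiv> PiM UNIV (\<lambda>_. count_space UNIV)"

text \<open>Over a finite alphabet a function of the first \<open>n\<close> coordinates takes
  finitely many values, so measurability, boundedness and integrability come for free. Integrands
  are brought to this form wherever possible.\<close>

definition fdep :: "nat \<Rightarrow> ((nat \<Rightarrow> 'n) \<Rightarrow> 'b) \<Rightarrow> bool" where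
  "fdep n F \<longleftrightarrow> (\<forall>\<omega> \<omega>'. (\<forall>k<n. \<omega> k = \<omega>' k) \<longrightarrow> F \<omega> = F \<omega>')"

lemma fdepI: "(\<And>\<omega> \<omega>'. (\<And>k. k < n \<Longrightarrow> \<omega> k = \<omega>' k) \<Longrightarrow> F \<omega> = F \<omega>') \<Longrightarrow> fdep n F"
  unfolding fdep_def by blast

lemma fdepD: "fdep n F \<Longrightarrow> (\<And>k. k < n \<Longrightarrow> \<omega> k = \<omega>' k) \<Longrightarrow> F \<omega> = F \<omega>'"
  unfolding fdep_def by blast

lemma fdep_mono: "fdep m F \<Longrightarrow> m \<le> n \<Longrightarrow> fdep n F"
  unfolding fdep_def by auto

lemma fdep_comp2:
  assumes "fdep n F" "fdep n G" shows "fdep n (\<lambda>\<omega>. h (F \<omega>) (G \<omega>))"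
  using assms unfolding fdep_def by metis

lemma fdep_comp: "fdep n F \<Longrightarrow> fdep n (\<lambda>\<omega>. h (F \<omega>))"
  unfolding fdep_def by metis

lemma space_traj: "space traj = UNIV"
  by (simp add: space_PiM)

text \<open>Words over a finite alphabet form a countable set, so it suffices that each single word
  has a measurable preimage; for a word of the wrong length the preimage is empty.\<close>

lemma measurable_map_traj:
  "(\<lambda>\<omega>. map \<omega> [0..<n]) \<in> (traj :: (nat \<Rightarrow> 'n::finite) measure) \<rightarrow>\<^sub>M count_space UNIV"
proof -
  have "(\<lambda>\<omega>. map \<omega> [0..<n]) -` {xs} \<inter> space traj \<in> sets traj" for xs :: "'n list"
  proof (cases "length xs = n")
    case True
    have "map \<omega> [0..<n] = xs \<longleftrightarrow> (\<forall>k\<in>{..<n}. \<omega> k = xs ! k)" for \<omega> :: "nat \<Rightarrow> 'n"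
      unfolding list_eq_iff_nth_eq[of "map \<omega> [0..<n]"] using True by (simp add: Ball_def)
    then have "(\<lambda>\<omega>. map \<omega> [0..<n]) -` {xs} \<inter> space traj
        = {\<omega>\<in>space traj. \<forall>k\<in>{..<n}. \<omega> k = xs ! k}"
      by blast
    also have "\<dots> \<in> sets traj" by measurable
    finally show ?thesis .
  next
    case False
    then have "(\<lambda>\<omega>. map \<omega> [0..<n]) -` {xs} \<inter> space traj = {}" by auto
    then show ?thesis by (metis sets.empty_sets)
  qed
  then show ?thesis
    by (subst measurable_count_space_eq2_countable) auto
qed

text \<open>The list lookup is unspecified from index \<open>n\<close> on, which is harmless because
  \<open>F\<close> does not look there. The factorization turns \<open>F\<close> into a function of
  a word of length \<open>n\<close>.\<close>

lemma fdep_factor: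
  assumes "fdep n F"
  shows "F \<omega> = F (\<lambda>k. map \<omega> [0..<n] ! k)"
  by (rule fdepD[OF assms]) simp

lemma fdep_measurable:
  fixes F :: "(nat \<Rightarrow> 'n::finite) \<Rightarrow> 'b"
  assumes "fdep n F" and "range F \<subseteq> space N"
  shows "F \<in> traj \<rightarrow>\<^sub>M N"
proof -
  have "(\<lambda>xs. F (\<lambda>k. xs ! k)) \<in> count_space UNIV \<rightarrow>\<^sub>M N"
    using assms(2) by auto
  from measurable_compose[OF measurable_map_traj[of n] this]
  have "(\<lambda>\<omega>. F (\<lambda>k. map \<omega> [0..<n] ! k)) \<in> traj \<rightarrow>\<^sub>M N" .
  then show ?thesis using fdep_factor[OF assms(1)] by (metis (no_types, lifting) measurable_cong)
qed

lemma fdep_borel: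
  fixes F :: "(nat \<Rightarrow> 'n::finite) \<Rightarrow> real"
  shows "fdep n F \<Longrightarrow> F \<in> borel_measurable traj"
  by (rule fdep_measurable) auto

lemma fdep_bounded:
  fixes F :: "(nat \<Rightarrow> 'n::finite) \<Rightarrow> real"
  assumes "fdep n F"
  obtains B where "\<And>\<omega>. \<bar>F \<omega>\<bar> \<le> B"
proof -
  have "finite {xs :: 'n list. length xs = n}"
    using finite_lists_length_eq[of "UNIV :: 'n set" n] by simp
  then have "finite ((\<lambda>xs. \<bar>F (\<lambda>k. xs ! k)\<bar>) ` {xs. length xs = n})" by simp
  then have "\<exists>B. \<forall>y\<in>(\<lambda>xs. \<bar>F (\<lambda>k. xs ! k)\<bar>) ` {xs. length xs = n}. y \<le> B"
    by (meson bdd_above_finite bdd_above.E)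
  then obtain B where B: "\<And>xs. length xs = n \<Longrightarrow> \<bar>F (\<lambda>k. xs ! k)\<bar> \<le> B" by auto
  have "\<bar>F \<omega>\<bar> \<le> B" for \<omega>
    by (subst fdep_factor[OF assms]) (rule B, simp)
  then show ?thesis using that by blast
qed

lemma fdep_sets:
  fixes E :: "(nat \<Rightarrow> 'n::finite) set"
  assumes "fdep n (\<lambda>\<omega>. \<omega> \<in> E)" shows "E \<in> sets traj"
proof -
  have "(\<lambda>\<omega>. \<omega> \<in> E) \<in> traj \<rightarrow>\<^sub>M count_space UNIV"
    using assms by (rule fdep_measurable) auto
  then have "{\<omega>\<in>space traj. \<omega> \<in> E} \<in> sets traj" by (rule predE)
  then show ?thesis by (simp add: space_traj)
qed

lemma sets_traj_generated:
  "sets (traj :: (nat \<Rightarrow> 'n::finite) measure) = sigma_sets UNIV {E. \<exists>n. fdep n (\<lambda>\<omega>. \<omega> \<in> E)}"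
proof
  have 1: "{{f \<in> UNIV. f i \<in> A} |i A. i \<in> UNIV} \<subseteq> {E :: (nat \<Rightarrow> 'n) set. \<exists>n. fdep n (\<lambda>\<omega>. \<omega> \<in> E)}"
  proof safe
    fix i :: nat and A :: "'n set"
    have "fdep (Suc i) (\<lambda>\<omega>. \<omega> \<in> {f \<in> UNIV. f i \<in> A})" by (auto simp: fdep_def)
    then show "\<exists>n. fdep n (\<lambda>\<omega>. \<omega> \<in> {f \<in> UNIV. f i \<in> A})" by blast
  qed
  show "sets (traj :: (nat \<Rightarrow> 'n::finite) measure) \<subseteq> sigma_sets UNIV {E. \<exists>n. fdep n (\<lambda>\<omega>. \<omega> \<in> E)}"
    unfolding sets_PiM_single using sigma_sets_mono'[OF 1] by simp
  have "sigma_algebra (UNIV :: (nat \<Rightarrow> 'n) set) (sets traj)"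
    by (metis sets.sigma_algebra_axioms space_traj)
  then show "sigma_sets UNIV {E. \<exists>n. fdep n (\<lambda>\<omega>. \<omega> \<in> E)} \<subseteq> sets (traj :: (nat \<Rightarrow> 'n) measure)"
    using fdep_sets by (intro sigma_algebra.sigma_sets_subset) blast+
qed

text \<open>The pi-lambda theorem: finite-horizon events are stable under intersection, since two of
  them can be read at the larger horizon, and they generate the product sigma-algebra.\<close>

lemma traj_measure_eqI:
  fixes M N :: "(nat \<Rightarrow> 'n::finite) measure"
  assumes sM: "sets M = sets traj" and sN: "sets N = sets traj" and fin: "finite_measure M"
    and eq: "\<And>E n. fdep n (\<lambda>\<omega>. \<omega> \<in> E) \<Longrightarrow> emeasure M E = emeasure N E"
  shows "M = N"
proof (rule measure_eqI_generator_eq[where \<Omega> = UNIV and E = "{E. \<exists>n. fdep n (\<lambda>\<omega>. \<omega> \<in> E)}"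
      and A = "\<lambda>_. UNIV"])
  show "Int_stable {E :: (nat \<Rightarrow> 'n) set. \<exists>n. fdep n (\<lambda>\<omega>. \<omega> \<in> E)}"
  proof (rule Int_stableI)
    fix a b :: "(nat \<Rightarrow> 'n) set"
    assume "a \<in> {E. \<exists>n. fdep n (\<lambda>\<omega>. \<omega> \<in> E)}" "b \<in> {E. \<exists>n. fdep n (\<lambda>\<omega>. \<omega> \<in> E)}"
    then obtain n m where "fdep n (\<lambda>\<omega>. \<omega> \<in> a)" "fdep m (\<lambda>\<omega>. \<omega> \<in> b)" by blast
    then have "fdep (max n m) (\<lambda>\<omega>. \<omega> \<in> a)" "fdep (max n m) (\<lambda>\<omega>. \<omega> \<in> b)"
      using fdep_mono by (metis max.cobounded1, metis max.cobounded2)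
    from fdep_comp2[OF this, where h = "(\<and>)"]
    show "a \<inter> b \<in> {E. \<exists>n. fdep n (\<lambda>\<omega>. \<omega> \<in> E)}" by auto
  qed
  show "range (\<lambda>_. UNIV) \<subseteq> {E :: (nat \<Rightarrow> 'n) set. \<exists>n. fdep n (\<lambda>\<omega>. \<omega> \<in> E)}"
    by (auto simp: fdep_def)
  show "emeasure M UNIV \<noteq> \<infinity>" using finite_measure.emeasure_finite[OF fin] by simp
qed (use assms sets_traj_generated in auto)

lemma traj_measure_eqI_cylinder:
  fixes M N :: "(nat \<Rightarrow> 'n::finite) measure"
  assumes sM: "sets M = sets traj" and sN: "sets N = sets traj" and fin: "finite_measure M"
    and eq: "\<And>n x. emeasure M {\<omega>. \<forall>k\<le>n. \<omega> k = x k} = emeasure N {\<omega>. \<forall>k\<le>n. \<omega> k = x k}"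
  shows "M = N"
proof (rule traj_measure_eqI[OF sM sN fin])
  fix E :: "(nat \<Rightarrow> 'n) set" and n assume "fdep n (\<lambda>\<omega>. \<omega> \<in> E)"
  \<comment> \<open>A cylinder fixing the coordinates up to and including \<open>n\<close> has
    horizon \<open>Suc n\<close>, so the horizon of \<open>E\<close> is raised to match.\<close>
  then have fd: "fdep (Suc n) (\<lambda>\<omega>. \<omega> \<in> E)" by (rule fdep_mono) simp
  define X where "X = {xs :: 'n list. length xs = Suc n \<and> (\<lambda>k. xs ! k) \<in> E}"
  define c where "c xs = {\<omega> :: nat \<Rightarrow> 'n. \<forall>k\<le>n. \<omega> k = xs ! k}" for xs
  have fX: "finite X"
    using finite_lists_length_eq[of "UNIV :: 'n set" "Suc n"] unfolding X_def
    by (rule rev_finite_subset) auto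
  have "E = (\<Union>xs\<in>X. c xs)"
  proof (intro set_eqI iffI)
    fix \<omega> assume "\<omega> \<in> E"
    then have "map \<omega> [0..<Suc n] \<in> X" "\<omega> \<in> c (map \<omega> [0..<Suc n])"
      using fdep_factor[OF fd, of \<omega>] by (auto simp: X_def c_def simp del: upt_Suc)
    then show "\<omega> \<in> (\<Union>xs\<in>X. c xs)" by blast
  next
    fix \<omega> assume "\<omega> \<in> (\<Union>xs\<in>X. c xs)"
    then obtain xs where "xs \<in> X" "\<omega> \<in> c xs" by blast
    then show "\<omega> \<in> E" using fdepD[OF fd, of \<omega> "\<lambda>k. xs ! k"] by (auto simp: X_def c_def)
  qed
  moreover have "disjoint_family_on c X"
    unfolding disjoint_family_on_def
  proof (intro ballI impI)
    fix xs ys assume *: "xs \<in> X" "ys \<in> X" "xs \<noteq> ys"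
    have "xs = ys" if "\<omega> \<in> c xs" "\<omega> \<in> c ys" for \<omega>
      using that *(1,2) by (intro nth_equalityI) (auto simp: X_def c_def less_Suc_eq_le)
    then show "c xs \<inter> c ys = {}" using * by blast
  qed
  moreover have "c xs \<in> sets traj" for xs
    by (rule fdep_sets[where n = "Suc n"]) (auto simp: fdep_def c_def less_Suc_eq_le)
  ultimately have "emeasure M E = (\<Sum>xs\<in>X. emeasure M (c xs))" "emeasure N E = (\<Sum>xs\<in>X. emeasure N (c xs))"
    using fX sM sN by (auto intro!: sum_emeasure[symmetric])
  then show "emeasure M E = emeasure N E" using eq by (simp add: c_def)
qed

section \<open>Disintegration over the initial state and first-step analysis\<close>

lemma vector_measure_kernel:
  fixes K :: "'n::finite \<Rightarrow> 'a measure"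
  assumes "\<And>i. prob_space (K i)" "\<And>i. sets (K i) = sets N"
  shows "K \<in> vector_measure p \<rightarrow>\<^sub>M subprob_algebra N"
proof -
  have "K \<in> count_space UNIV \<rightarrow>\<^sub>M subprob_algebra N"
    using assms by (auto simp: space_subprob_algebra prob_space_imp_subprob_space)
  then show ?thesis
    by (simp add: measurable_def vector_measure_def space_point_measure sets_point_measure)
qed

lemma nn_integral_vector_measure:
  fixes f :: "'n::finite \<Rightarrow> ennreal"
  shows "(\<integral>\<^sup>+x. f x \<partial>vector_measure p) = (\<Sum>i\<in>UNIV. f i * ennreal (p $ i))"
  unfolding vector_measure_def by (simp add: nn_integral_point_measure_finite mult.commute)

lemma integral_vector_measure:
  fixes f :: "'n::finite \<Rightarrow> real"
  assumes "prob_vector p"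
  shows "(\<integral>x. f x \<partial>vector_measure p) = (\<Sum>i\<in>UNIV. p $ i * f i)"
  unfolding vector_measure_def using assms
  by (subst lebesgue_integral_point_measure_finite) (auto simp: prob_vector_def)

lemma stochasticD: "stochastic P \<Longrightarrow> prob_vector (P $ i)"
  by (simp add: stochastic_def)

lemma stochastic_nonneg: "stochastic P \<Longrightarrow> 0 \<le> P $ i $ j"
  by (simp add: stochastic_def prob_vector_def)

lemma stochastic_sum: "stochastic P \<Longrightarrow> (\<Sum>j\<in>UNIV. P $ i $ j) = 1"
  by (simp add: stochastic_def prob_vector_def)

lemma space_markov_measure:
  "stochastic P \<Longrightarrow> prob_vector p \<Longrightarrow> space (markov_measure P p) = UNIV"
  using sets_eq_imp_space_eq[OF sets_markov_measure] by (simp add: space_traj)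

lemma measurable_markov_measure:
  assumes "stochastic P" "prob_vector p"
  shows "measurable (markov_measure P p) N = measurable traj N"
  by (rule measurable_cong_sets[OF sets_markov_measure[OF assms] refl])

lemma measurable_prepend: "case_nat i \<in> (traj \<rightarrow>\<^sub>M traj)"
  by measurable

lemma measurable_prepend_markov_measure:
  "stochastic P \<Longrightarrow> prob_vector p \<Longrightarrow> case_nat i \<in> markov_measure P p \<rightarrow>\<^sub>M traj"
  by (simp only: measurable_markov_measure measurable_prepend)

definition shift :: "(nat \<Rightarrow> 'n) \<Rightarrow> nat \<Rightarrow> 'n" where
  "shift \<omega> = (\<lambda>k. \<omega> (Suc k))"

lemma measurable_shift: "shift \<in> traj \<rightarrow>\<^sub>M traj"
  unfolding shift_def[abs_def] by (rule measurable_PiM_single') (auto simp: space_PiM)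

lemma shift_prepend [simp]: "shift (case_nat i \<omega>) = \<omega>"
  by (simp add: shift_def)

text \<open>The chain started at \<open>i\<close>, encoded by prepending \<open>i\<close> to a chain
  whose initial law is row \<open>i\<close>. The Markov property at time one is built in, and no
  conditioning on an event is involved.\<close>

definition started :: "real ^ 'n::finite ^ 'n \<Rightarrow> 'n \<Rightarrow> (nat \<Rightarrow> 'n) measure" where
  "started P i = distr (markov_measure P (P $ i)) traj (case_nat i)"

lemma sets_started: "sets (started P i) = sets traj"
  by (simp add: started_def)

lemma prob_space_started:
  assumes "stochastic P" shows "prob_space (started P i)"
  unfolding started_def
  by (intro prob_space.prob_space_distr prob_space_markov_measure
      measurable_prepend_markov_measure assms stochasticD)

text \<open>Both sides are compared on cylinders. The explicit cylinder probabilities enter here;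
  later computations with the chain rest on the recursion \<open>expect_step\<close>.\<close>

lemma markov_measure_bind:
  fixes P :: "real ^ 'n::finite ^ 'n"
  assumes P: "stochastic P" and p: "prob_vector p"
  shows "markov_measure P p = vector_measure p \<bind> started P"
proof -
  have K: "started P \<in> vector_measure p \<rightarrow>\<^sub>M subprob_algebra traj"
    by (rule vector_measure_kernel) (use prob_space_started[OF P] sets_started in auto)
  have ne: "space (vector_measure p) \<noteq> {}" by (simp add: vector_measure_def space_point_measure)
  have sb: "sets (vector_measure p \<bind> started P) = sets traj"
    by (rule sets_bind_measurable[OF K ne])
  interpret p: prob_space "markov_measure P p" by (rule prob_space_markov_measure[OF P p])
  show ?thesis
  proof (rule traj_measure_eqI_cylinder[OF sets_markov_measure[OF P p] sb])
    show "finite_measure (markov_measure P p)" by unfold_locales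
    fix n :: nat and x :: "nat \<Rightarrow> 'n"
    let ?C = "{\<omega>. \<forall>k\<le>n. \<omega> k = x k}"
    have C: "?C \<in> sets traj" by (rule fdep_sets[where n = "Suc n"]) (auto simp: fdep_def less_Suc_eq_le)
    have row: "emeasure (started P i) ?C
        = (if i = x 0 then ennreal (\<Prod>k<n. P $ x k $ x (Suc k)) else 0)" for i
    proof -
      have 1: "emeasure (started P i) ?C = emeasure (markov_measure P (P $ i)) (case_nat i -` ?C)"
        unfolding started_def
        by (subst emeasure_distr[OF measurable_prepend_markov_measure[OF P stochasticD[OF P]] C])
          (simp add: space_markov_measure[OF P stochasticD[OF P]])
      show ?thesis
      proof (cases n)
        case 0
        then have "case_nat i -` ?C = (if i = x 0 then UNIV else {})" by auto
        then show ?thesis unfolding 1 using 0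
            prob_space.emeasure_space_1[OF prob_space_markov_measure[OF P stochasticD[OF P, of i]]]
          by (auto simp: space_markov_measure[OF P stochasticD[OF P]])
      next
        case (Suc m)
        then have "case_nat i -` ?C = (if i = x 0 then {\<omega>. \<forall>k\<le>m. \<omega> k = x (Suc k)} else {})"
          by (auto simp: all_simps split: nat.splits)
        then have "emeasure (markov_measure P (P $ i)) (case_nat i -` ?C)
          = (if i = x 0 then ennreal (P $ i $ x (Suc 0) * (\<Prod>k<m. P $ x (Suc k) $ x (Suc (Suc k)))) else 0)"
          using emeasure_markov_measure_cylinder[OF P stochasticD[OF P, of i], of m "\<lambda>k. x (Suc k)"]
          by auto
        moreover have "(\<Prod>k<n. P $ x k $ x (Suc k))
            = P $ x 0 $ x (Suc 0) * (\<Prod>k<m. P $ x (Suc k) $ x (Suc (Suc k)))"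
          unfolding Suc by (rule prod.lessThan_Suc_shift)
        ultimately show ?thesis unfolding 1 by (cases "i = x 0") (simp_all only: if_True if_False)
      qed
    qed
    have "emeasure (vector_measure p \<bind> started P) ?C = (\<integral>\<^sup>+i. emeasure (started P i) ?C \<partial>vector_measure p)"
      by (rule emeasure_bind[OF ne K C])
    also have "\<dots> = (\<Sum>i\<in>UNIV. emeasure (started P i) ?C * ennreal (p $ i))"
      by (rule nn_integral_vector_measure)
    also have "\<dots> = (\<Sum>i\<in>UNIV. if i = x 0 then ennreal (\<Prod>k<n. P $ x k $ x (Suc k)) * ennreal (p $ x 0) else 0)"
      by (rule sum.cong) (auto simp: row)
    also have "\<dots> = ennreal (p $ x 0 * (\<Prod>k<n. P $ x k $ x (Suc k)))"
      using p stochastic_nonneg[OF P] by (simp add: prob_vector_def prod_nonneg mult.commute flip: ennreal_mult)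
    finally show "emeasure (markov_measure P p) ?C = emeasure (vector_measure p \<bind> started P) ?C"
      by (simp only: emeasure_markov_measure_cylinder[OF P p])
  qed
qed

definition expect :: "real ^ 'n::finite ^ 'n \<Rightarrow> 'n \<Rightarrow> ((nat \<Rightarrow> 'n) \<Rightarrow> real) \<Rightarrow> real" where
  "expect P i F = (\<integral>\<omega>. F \<omega> \<partial>started P i)"

lemma integral_markov_measure_start:
  assumes P: "stochastic P" and p: "prob_vector p"
    and F: "F \<in> borel_measurable traj" and B: "\<And>\<omega>. \<bar>F \<omega>\<bar> \<le> B"
  shows "(\<integral>\<omega>. F \<omega> \<partial>markov_measure P p) = (\<Sum>i\<in>UNIV. p $ i * expect P i F)"
proof -
  have K: "started P \<in> vector_measure p \<rightarrow>\<^sub>M subprob_algebra traj"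
    by (rule vector_measure_kernel) (use prob_space_started[OF P] sets_started in auto)
  interpret p: prob_space "vector_measure p" by (rule prob_space_vector_measure[OF p])
  have "(\<integral>\<omega>. F \<omega> \<partial>markov_measure P p) = (\<integral>i. expect P i F \<partial>vector_measure p)"
    unfolding markov_measure_bind[OF P p] expect_def
    by (rule integral_bind[where B' = 1, OF F B K])
      (auto intro!: AE_I2 simp: prob_space.emeasure_space_1[OF prob_space_started[OF P]] p.finite_measure_axioms)
  then show ?thesis by (simp add: integral_vector_measure[OF p])
qed

text \<open>First-step analysis. Statements about the first \<open>n\<close> states can thus be
  proved by induction on \<open>n\<close>, the starting state being arbitrary.\<close>

lemma expect_step:
  assumes P: "stochastic P" and F: "F \<in> borel_measurable traj" and B: "\<And>\<omega>. \<bar>F \<omega>\<bar> \<le> B"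
  shows "expect P i F = (\<Sum>j\<in>UNIV. P $ i $ j * expect P j (\<lambda>\<omega>. F (case_nat i \<omega>)))"
proof -
  have "expect P i F = (\<integral>\<omega>. F (case_nat i \<omega>) \<partial>markov_measure P (P $ i))"
    unfolding expect_def started_def
    by (rule integral_distr[OF measurable_prepend_markov_measure[OF P stochasticD[OF P]] F])
  also have "\<dots> = (\<Sum>j\<in>UNIV. P $ i $ j * expect P j (\<lambda>\<omega>. F (case_nat i \<omega>)))"
    by (rule integral_markov_measure_start[OF P stochasticD[OF P]])
      (use measurable_compose[OF measurable_prepend F] B in auto)
  finally show ?thesis .
qed

section \<open>Irreducible stochastic matrices\<close>

text \<open>Phrased with closed sets of states, irreducibility visibly depends on the graph only and
  so passes from \<open>P\<close> to \<open>Q\<close>. It also acts as a proof rule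
  (\<open>irreducible_closed\<close>): what holds at one state and is propagated along edges holds
  everywhere.\<close>

definition irreducible_chain :: "real ^ 'n::finite ^ 'n \<Rightarrow> bool" where
  "irreducible_chain P \<longleftrightarrow>
     (\<forall>R. R \<noteq> {} \<longrightarrow> (\<forall>i\<in>R. \<forall>j. 0 < P $ i $ j \<longrightarrow> j \<in> R) \<longrightarrow> R = UNIV)"

lemma irreducible_closed:
  assumes "irreducible_chain P" "i0 \<in> R" "\<And>i j. i \<in> R \<Longrightarrow> 0 < P $ i $ j \<Longrightarrow> j \<in> R"
  shows "i \<in> R"
  using assms unfolding irreducible_chain_def by blast

lemma primitive_irreducible:
  fixes P :: "real ^ 'n::finite ^ 'n"
  assumes "primitive P" shows "irreducible_chain P"
  unfolding irreducible_chain_def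
proof (intro allI impI)
  fix R :: "'n set"
  assume "R \<noteq> {}" and closed: "\<forall>i\<in>R. \<forall>j. 0 < P $ i $ j \<longrightarrow> j \<in> R"
  have P: "stochastic P" using assms by (simp add: primitive_def)
  have step: "\<forall>i\<in>R. \<forall>j. 0 < mat_power P m $ i $ j \<longrightarrow> j \<in> R" for m
  proof (induction m)
    case 0
    then show ?case by (auto simp: mat_power_def mat_def split: if_splits)
  next
    case (Suc m)
    show ?case
    proof (intro ballI allI impI)
      fix i j assume i: "i \<in> R" and "0 < mat_power P (Suc m) $ i $ j"
      then have "0 < (\<Sum>k\<in>UNIV. P $ i $ k * mat_power P m $ k $ j)"
        by (simp add: mat_power_def matrix_matrix_mult_def)
      then obtain k where k: "0 < P $ i $ k * mat_power P m $ k $ j"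
        by (meson not_less sum_nonpos)
      then have "0 < P $ i $ k" "0 < mat_power P m $ k $ j"
        using stochastic_nonneg[OF P, of i k] by (auto simp: zero_less_mult_iff)
      then show "j \<in> R" using closed Suc i by blast
    qed
  qed
  obtain m where "\<forall>i j. 0 < mat_power P m $ i $ j" using assms by (auto simp: primitive_def)
  then show "R = UNIV" using step[of m] \<open>R \<noteq> {}\<close> by blast
qed

lemma irreducible_same_graph:
  "irreducible_chain P \<Longrightarrow> same_transition_graph P Q \<Longrightarrow> irreducible_chain Q"
  by (simp add: irreducible_chain_def same_transition_graph_def)

text \<open>Maximum principle: where \<open>h\<close> attains its maximum, the weighted deficits
  \<open>m - h j\<close> are nonnegative with sum at most 0, so the maximum is attained at every
  successor too.\<close>

lemma subharmonic_constant:
  fixes P :: "real ^ 'n::finite ^ 'n" and h :: "'n \<Rightarrow> real"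
  assumes P: "stochastic P" and irr: "irreducible_chain P"
    and h: "\<And>i. h i \<le> (\<Sum>j\<in>UNIV. P $ i $ j * h j)"
  shows "h i = h j"
proof -
  define m where "m = Max (range h)"
  have le: "h i \<le> m" for i unfolding m_def by (rule Max_ge) auto
  have "m \<in> range h" unfolding m_def by (rule Max_in) auto
  then obtain i0 where i0: "h i0 = m" by auto
  have "i \<in> {i. h i = m}" for i
  proof (rule irreducible_closed[OF irr])
    show "i0 \<in> {i. h i = m}" using i0 by simp
    fix i j assume i: "i \<in> {i. h i = m}" and ij: "0 < P $ i $ j"
    have "(\<Sum>j\<in>UNIV. P $ i $ j * (m - h j)) = m - (\<Sum>j\<in>UNIV. P $ i $ j * h j)"
      by (simp add: right_diff_distrib sum_subtractf stochastic_sum[OF P] flip: sum_distrib_right)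
    also have "\<dots> \<le> 0" using h[of i] i by simp
    finally have "(\<Sum>j\<in>UNIV. P $ i $ j * (m - h j)) \<le> 0" .
    moreover have nn: "0 \<le> P $ i $ j * (m - h j)" for j
      using le stochastic_nonneg[OF P] by simp
    ultimately have "(\<Sum>j\<in>UNIV. P $ i $ j * (m - h j)) = 0"
      by (meson order_antisym sum_nonneg)
    then have "P $ i $ j * (m - h j) = 0"
      using sum_nonneg_eq_0_iff[of UNIV "\<lambda>j. P $ i $ j * (m - h j)"] nn by simp
    then show "j \<in> {i. h i = m}" using ij by simp
  qed
  then show ?thesis by simp
qed

section \<open>The Poisson equation and the stationary vector\<close>

lemma stationary_sum:
  fixes p :: "real ^ 'n::finite"
  assumes "p v* P = p"
  shows "(\<Sum>i\<in>UNIV. p $ i * (\<Sum>j\<in>UNIV. P $ i $ j * h j)) = (\<Sum>j\<in>UNIV. p $ j * h j)"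
proof -
  have "p $ j = (\<Sum>i\<in>UNIV. P $ i $ j * p $ i)" for j
    by (subst assms[symmetric]) (simp add: vector_matrix_mult_def mult.commute)
  then have "p $ j * h j = (\<Sum>i\<in>UNIV. P $ i $ j * p $ i * h j)" for j
    by (metis sum_distrib_right)
  then have "(\<Sum>j\<in>UNIV. p $ j * h j) = (\<Sum>j\<in>UNIV. \<Sum>i\<in>UNIV. P $ i $ j * p $ i * h j)"
    by (rule sum.cong[OF refl])
  also have "\<dots> = (\<Sum>i\<in>UNIV. \<Sum>j\<in>UNIV. P $ i $ j * p $ i * h j)" by (rule sum.swap)
  finally show ?thesis by (simp add: sum_distrib_left mult_ac)
qed

text \<open>Injective linear maps of a finite-dimensional space are onto. The detour through
  \<open>real ^ 'n\<close> lets the operator be written on plain functions; it serves to solve the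
  Poisson equation and its twisted version.\<close>

lemma finite_linear_surj:
  fixes F :: "('n::finite \<Rightarrow> real) \<Rightarrow> 'n \<Rightarrow> real"
  assumes add: "\<And>g h i. F (\<lambda>k. g k + h k) i = F g i + F h i"
    and scale: "\<And>c g i. F (\<lambda>k. c * g k) i = c * F g i"
    and inj: "\<And>g i. (\<And>i. F g i = 0) \<Longrightarrow> g i = 0"
  obtains g where "\<And>i. F g i = f i"
proof -
  let ?G = "\<lambda>v :: real ^ 'n. \<chi> i. F (\<lambda>k. v $ k) i"
  have lin: "linear ?G"
    by (rule linearI) (simp_all add: vec_eq_iff add scale)
  have "inj ?G"
    unfolding linear_injective_0[OF lin]
  proof (intro allI impI)
    fix v assume "?G v = 0"
    then have "F (\<lambda>k. v $ k) i = 0" for i by (simp add: vec_eq_iff)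
    then have "v $ i = 0" for i by (rule inj)
    then show "v = 0" by (simp add: vec_eq_iff)
  qed
  then have "surj ?G" by (rule linear_injective_imp_surjective[OF lin _ refl])
  from surjD[OF this, of "\<chi> i. f i"] obtain v where "(\<chi> i. f i) = ?G v" by blast
  then have "F (\<lambda>k. v $ k) i = f i" for i by (simp add: vec_eq_iff)
  then show ?thesis by (rule that)
qed

text \<open>Adding the rank one term \<open>p g\<close> makes the operator injective: averaging
  \<open>F g = 0\<close> against \<open>p\<close> gives \<open>p g = 0\<close>, so \<open>g\<close>
  is harmonic, hence constant, hence 0. Its inverse is the fundamental matrix of the chain.\<close>

lemma poisson_shifted:
  fixes P :: "real ^ 'n::finite ^ 'n" and f :: "'n \<Rightarrow> real"
  assumes P: "stochastic P" and irr: "irreducible_chain P"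
    and p: "prob_vector p" and st: "p v* P = p"
  obtains g where "\<And>i. f i = g i - (\<Sum>j\<in>UNIV. P $ i $ j * g j) + (\<Sum>k\<in>UNIV. p $ k * g k)"
proof -
  let ?F = "\<lambda>g i. g i - (\<Sum>j\<in>UNIV. P $ i $ j * g j) + (\<Sum>k\<in>UNIV. p $ k * g k)"
  have p1: "(\<Sum>k\<in>UNIV. p $ k) = 1" using p by (simp add: prob_vector_def)
  obtain g where "\<And>i. ?F g i = f i"
  proof (rule finite_linear_surj[of ?F f])
    fix g :: "'n \<Rightarrow> real" and i
    assume 0: "\<And>i. ?F g i = 0"
    define s where "s = (\<Sum>k\<in>UNIV. p $ k * g k)"
    have "0 = (\<Sum>i\<in>UNIV. p $ i * ?F g i)" using 0 by simp
    also have "\<dots> = s - s + s"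
      by (simp add: s_def distrib_left right_diff_distrib sum.distrib sum_subtractf stationary_sum[OF st]
          p1 flip: sum_distrib_right)
    finally have s: "s = 0" by simp
    have harm: "g i = (\<Sum>j\<in>UNIV. P $ i $ j * g j)" for i using 0[of i] s by (simp add: s_def)
    have "g j = g i" for j by (rule subharmonic_constant[OF P irr]) (simp add: harm[symmetric])
    then have "g = (\<lambda>_. g i)" by auto
    then have "s = (\<Sum>k\<in>UNIV. p $ k * g i)" unfolding s_def by metis
    then have "s = g i" by (simp add: p1 flip: sum_distrib_right)
    then show "g i = 0" using s by simp
  qed (auto simp: distrib_left sum.distrib sum_distrib_left right_diff_distrib algebra_simps)
  then show ?thesis using that by metis
qed

text \<open>Averaging the shifted equation against \<open>p\<close> leaves \<open>p f = p g\<close>,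
  so the extra term vanishes when \<open>f\<close> is centred.\<close>

lemma poisson:
  fixes P :: "real ^ 'n::finite ^ 'n" and f :: "'n \<Rightarrow> real"
  assumes P: "stochastic P" and irr: "irreducible_chain P"
    and p: "prob_vector p" and st: "p v* P = p" and f: "(\<Sum>i\<in>UNIV. p $ i * f i) = 0"
  obtains g where "\<And>i. f i = g i - (\<Sum>j\<in>UNIV. P $ i $ j * g j)"
proof -
  obtain g where g: "\<And>i. f i = g i - (\<Sum>j\<in>UNIV. P $ i $ j * g j) + (\<Sum>k\<in>UNIV. p $ k * g k)"
    using poisson_shifted[OF P irr p st] by metis
  have p1: "(\<Sum>k\<in>UNIV. p $ k) = 1" using p by (simp add: prob_vector_def)
  have "0 = (\<Sum>i\<in>UNIV. p $ i * (g i - (\<Sum>j\<in>UNIV. P $ i $ j * g j) + (\<Sum>k\<in>UNIV. p $ k * g k)))"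
    using f by (simp add: g)
  also have "\<dots> = (\<Sum>k\<in>UNIV. p $ k * g k)"
    by (simp add: distrib_left right_diff_distrib sum.distrib sum_subtractf stationary_sum[OF st]
        p1 flip: sum_distrib_right)
  finally show ?thesis using g that by simp
qed

lemma stationary_exists:
  fixes P :: "real ^ 'n::finite ^ 'n"
  assumes P: "stochastic P"
  obtains p where "prob_vector p" "p v* P = p"
proof -
  let ?S = "{p :: real ^ 'n. prob_vector p}"
  have S: "?S = (\<Inter>i. {p. 0 \<le> p $ i}) \<inter> {p. (\<Sum>i\<in>UNIV. p $ i) = 1}"
    by (auto simp: prob_vector_def)
  have "closed ?S"
    unfolding S
    by (intro closed_Int closed_INT ballI closed_Collect_le closed_Collect_eq continuous_intros)
  moreover have "bounded ?S"
  proof (rule boundedI)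
    fix p :: "real ^ 'n" assume "p \<in> ?S"
    then have "(\<Sum>i\<in>UNIV. \<bar>p $ i\<bar>) = 1" by (simp add: prob_vector_def)
    then show "norm p \<le> 1" using norm_le_l1_cart[of p] by linarith
  qed
  ultimately have "compact ?S" by (simp add: compact_eq_bounded_closed)
  moreover have "convex ?S"
    unfolding convex_def prob_vector_def
    by (auto simp: sum.distrib simp flip: sum_distrib_left)
  moreover have "prob_vector (axis undefined 1 :: real ^ 'n)"
    by (auto simp: prob_vector_def axis_def)
  then have "?S \<noteq> {}" by blast
  moreover have "continuous_on ?S (\<lambda>p. p v* P)"
    unfolding vector_matrix_mult_def by (intro continuous_intros)
  moreover have "(\<lambda>p. p v* P) \<in> ?S \<rightarrow> ?S"
  proof
    fix p assume "p \<in> ?S"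
    then have p: "0 \<le> p $ i" "(\<Sum>i\<in>UNIV. p $ i) = 1" for i by (auto simp: prob_vector_def)
    have "(\<Sum>j\<in>UNIV. \<Sum>i\<in>UNIV. P $ i $ j * p $ i) = (\<Sum>i\<in>UNIV. \<Sum>j\<in>UNIV. P $ i $ j * p $ i)"
      by (rule sum.swap)
    also have "\<dots> = 1" using p by (simp add: stochastic_sum[OF P] flip: sum_distrib_right)
    finally show "p v* P \<in> ?S"
      using p stochastic_nonneg[OF P]
      by (auto simp: prob_vector_def vector_matrix_mult_def mult.commute intro!: sum_nonneg)
  qed
  ultimately obtain p where "p \<in> ?S" "p v* P = p" by (rule brouwer)
  then show ?thesis using that by blast
qed

text \<open>Solve the shifted equation, built with \<open>p\<close>, for the indicator
  \<open>f\<close> of a state \<open>a\<close>. Integrating against any stationary \<open>r\<close>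
  gives \<open>r $ a = p g\<close>, a value independent of \<open>r\<close>.\<close>

lemma stationary_unique:
  fixes P :: "real ^ 'n::finite ^ 'n"
  assumes P: "stochastic P" and irr: "irreducible_chain P"
    and p: "prob_vector p" "p v* P = p" and q: "prob_vector q" "q v* P = q"
  shows "p = q"
proof -
  have "p $ a = q $ a" for a
  proof -
    define f where "f i = (if i = a then 1 else 0 :: real)" for i
    obtain g where g: "\<And>i. f i = g i - (\<Sum>j\<in>UNIV. P $ i $ j * g j) + (\<Sum>k\<in>UNIV. p $ k * g k)"
      using poisson_shifted[OF P irr p] by metis
    have *: "(\<Sum>i\<in>UNIV. r $ i * f i) = (\<Sum>k\<in>UNIV. p $ k * g k)"
      if "prob_vector r" "r v* P = r" for r
    proof -
      have "(\<Sum>k\<in>UNIV. r $ k) = 1" using that by (simp add: prob_vector_def)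
      then show ?thesis unfolding g
        by (simp add: distrib_left right_diff_distrib sum.distrib sum_subtractf stationary_sum[OF that(2)]
          flip: sum_distrib_right)
    qed
    have "(\<Sum>i\<in>UNIV. r $ i * f i) = r $ a" for r :: "real ^ 'n"
      by (simp add: f_def if_distrib cong: if_cong)
    then show ?thesis using *[OF p] *[OF q] by simp
  qed
  then show ?thesis by (simp add: vec_eq_iff)
qed

lemma
  fixes P :: "real ^ 'n::finite ^ 'n"
  assumes P: "stochastic P" and irr: "irreducible_chain P"
  shows prob_vector_stationary: "prob_vector (stationary_vector P)"
    and stationary_vector_fixed: "stationary_vector P v* P = stationary_vector P"
proof -
  obtain p where p: "prob_vector p" "p v* P = p" by (rule stationary_exists[OF P])
  have "prob_vector (stationary_vector P) \<and> stationary_vector P v* P = stationary_vector P"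
    unfolding stationary_vector_def
    by (rule theI[of _ p]) (use p stationary_unique[OF P irr] in blast)+
  then show "prob_vector (stationary_vector P)" "stationary_vector P v* P = stationary_vector P"
    by auto
qed

text \<open>The support of a stationary vector is nonempty and closed under transitions.\<close>

lemma stationary_positive:
  fixes P :: "real ^ 'n::finite ^ 'n"
  assumes P: "stochastic P" and irr: "irreducible_chain P" and p: "prob_vector p" "p v* P = p"
  shows "0 < p $ i"
proof -
  have nn: "0 \<le> p $ i" for i using p by (simp add: prob_vector_def)
  have "\<exists>i. p $ i \<noteq> 0"
  proof (rule ccontr)
    assume "\<not> ?thesis" then have "(\<Sum>i\<in>UNIV. p $ i) = 0" by simp
    then show False using p by (simp add: prob_vector_def)
  qed
  then obtain i0 where i0: "0 < p $ i0" using nn by (metis less_eq_real_def)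
  have "i \<in> {i. 0 < p $ i}"
  proof (rule irreducible_closed[OF irr])
    show "i0 \<in> {i. 0 < p $ i}" using i0 by simp
    fix i j assume "i \<in> {i. 0 < p $ i}" and ij: "0 < P $ i $ j"
    then have "0 < P $ i $ j * p $ i" by simp
    also have "\<dots> \<le> (\<Sum>i\<in>UNIV. P $ i $ j * p $ i)"
      using nn stochastic_nonneg[OF P] by (intro member_le_sum) auto
    also have "\<dots> = p $ j" by (subst (2) p(2)[symmetric]) (simp add: vector_matrix_mult_def mult.commute)
    finally show "j \<in> {i. 0 < p $ i}" by simp
  qed
  then show ?thesis by simp
qed

section \<open>Stationarity and ergodicity\<close>

lemma measure_markov_measure_start:
  assumes P: "stochastic P" and p: "prob_vector p" and E: "E \<in> sets traj"
  shows "measure (markov_measure P p) E = (\<Sum>i\<in>UNIV. p $ i * expect P i (indicator E))"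
proof -
  have "measure (markov_measure P p) E = (\<integral>\<omega>. indicator E \<omega> \<partial>markov_measure P p)"
    using space_markov_measure[OF P p] by simp
  also have "\<dots> = (\<Sum>i\<in>UNIV. p $ i * expect P i (indicator E))"
    by (rule integral_markov_measure_start[OF P p, where B = 1]) (use E in \<open>auto simp: indicator_def\<close>)
  finally show ?thesis .
qed

text \<open>The first-step decomposition of a shifted event, averaged against \<open>p\<close>,
  returns the average of the event itself by \<open>stationary_sum\<close>.\<close>

lemma stationary_shift:
  fixes P :: "real ^ 'n::finite ^ 'n"
  assumes P: "stochastic P" and p: "prob_vector p" and st: "p v* P = p"
  shows "distr (markov_measure P p) (markov_measure P p) shift = markov_measure P p" (is "?D = ?M")
proof (rule measure_eqI)
  show "sets ?D = sets ?M" by simp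
  interpret M: prob_space ?M by (rule prob_space_markov_measure[OF P p])
  have ms: "shift \<in> ?M \<rightarrow>\<^sub>M ?M"
    using measurable_shift measurable_cong_sets[OF sets_markov_measure[OF P p] sets_markov_measure[OF P p]]
    by blast
  fix E assume "E \<in> sets ?D"
  then have E: "E \<in> sets traj" by (simp add: sets_markov_measure[OF P p])
  have sE: "shift -` E \<in> sets traj"
    using measurable_sets[OF measurable_shift E] by (simp add: space_traj)
  have ind: "expect P i (indicator (shift -` E)) = (\<Sum>j\<in>UNIV. P $ i $ j * expect P j (indicator E))" for i
  proof -
    have "expect P i (indicator (shift -` E)) =
        (\<Sum>j\<in>UNIV. P $ i $ j * expect P j (\<lambda>\<omega>. indicator (shift -` E) (case_nat i \<omega>)))"
      by (rule expect_step[OF P, where B = 1]) (use sE in \<open>auto simp: indicator_def\<close>)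
    moreover have "(\<lambda>\<omega>. indicator (shift -` E) (case_nat i \<omega>)) = (indicator E :: _ \<Rightarrow> real)"
      by (auto simp: indicator_def)
    ultimately show ?thesis by simp
  qed
  have "measure ?M (shift -` E) = measure ?M E"
    by (simp add: measure_markov_measure_start[OF P p] sE E ind stationary_sum[OF st])
  then show "emeasure ?D E = emeasure ?M E"
    using E sets_markov_measure[OF P p] ms space_markov_measure[OF P p]
    by (simp add: emeasure_distr M.emeasure_eq_measure)
qed

lemma space_started: "space (started P i) = UNIV"
  using sets_eq_imp_space_eq[OF sets_started] by (simp add: space_traj)

lemma invariant_set_prepend:
  assumes "shift -` E = E" shows "case_nat i \<omega> \<in> E \<longleftrightarrow> \<omega> \<in> E"
  by (subst (1) assms[symmetric]) simp

text \<open>Prepending a state does not affect membership in an invariant set, so its probability is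
  a harmonic function of the starting state.\<close>

lemma invariant_set_constant:
  fixes P :: "real ^ 'n::finite ^ 'n"
  assumes P: "stochastic P" and irr: "irreducible_chain P"
    and E: "E \<in> sets traj" and inv: "shift -` E = E"
  shows "expect P i (indicator E) = expect P j (indicator E)"
proof (rule subharmonic_constant[OF P irr])
  fix i
  have "expect P i (indicator E) = (\<Sum>j\<in>UNIV. P $ i $ j * expect P j (\<lambda>\<omega>. indicator E (case_nat i \<omega>)))"
    by (rule expect_step[OF P, where B = 1]) (use E in \<open>auto simp: indicator_def\<close>)
  moreover have "(\<lambda>\<omega>. indicator E (case_nat i \<omega>)) = (indicator E :: _ \<Rightarrow> real)"
    by (simp add: indicator_def fun_eq_iff invariant_set_prepend[OF inv])
  ultimately show "expect P i (indicator E) \<le> (\<Sum>j\<in>UNIV. P $ i $ j * expect P j (indicator E))" by simp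
qed

text \<open>Induction on the horizon of \<open>F\<close>: after one step \<open>E\<close> is
  unchanged and \<open>F\<close> has become an event of smaller horizon.\<close>

lemma invariant_set_independent:
  fixes P :: "real ^ 'n::finite ^ 'n"
  assumes P: "stochastic P" and irr: "irreducible_chain P"
    and E: "E \<in> sets traj" and inv: "shift -` E = E"
    and F: "fdep n (\<lambda>\<omega>. \<omega> \<in> F)"
  shows "expect P i (indicator (E \<inter> F)) = expect P i0 (indicator E) * expect P i (indicator F)"
  using F
proof (induction n arbitrary: F i)
  case 0
  then have "F = {} \<or> F = UNIV" unfolding fdep_def by auto
  moreover have "expect P i (\<lambda>x. 1) = 1"
    unfolding expect_def using prob_space.prob_space[OF prob_space_started[OF P, of i]] by simp
  ultimately show ?case
    using invariant_set_constant[OF P irr E inv, of i i0] by (auto simp: expect_def)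
next
  case (Suc n)
  define G where "G = case_nat i -` F"
  have G: "fdep n (\<lambda>\<omega>. \<omega> \<in> G)"
  proof (rule fdepI)
    fix \<omega> \<omega>' :: "nat \<Rightarrow> 'n" assume "\<And>k. k < n \<Longrightarrow> \<omega> k = \<omega>' k"
    then show "(\<omega> \<in> G) = (\<omega>' \<in> G)"
      unfolding G_def vimage_eq by (intro fdepD[OF Suc.prems]) (auto split: nat.split)
  qed
  have F: "F \<in> sets traj" by (rule fdep_sets[OF Suc.prems])
  have 1: "(\<lambda>\<omega>. indicator (E \<inter> F) (case_nat i \<omega>)) = (indicator (E \<inter> G) :: _ \<Rightarrow> real)"
    by (simp add: indicator_def fun_eq_iff invariant_set_prepend[OF inv] G_def)
  have 2: "(\<lambda>\<omega>. indicator F (case_nat i \<omega>)) = (indicator G :: _ \<Rightarrow> real)"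
    by (auto simp: indicator_def fun_eq_iff G_def)
  have "expect P i (indicator (E \<inter> F)) = (\<Sum>j\<in>UNIV. P $ i $ j * expect P j (indicator (E \<inter> G)))"
    unfolding 1[symmetric]
    by (rule expect_step[OF P, where B = 1]) (use E F in \<open>auto simp: indicator_def\<close>)
  also have "\<dots> = expect P i0 (indicator E) * (\<Sum>j\<in>UNIV. P $ i $ j * expect P j (indicator G))"
    by (simp add: Suc.IH[OF G] sum_distrib_left mult_ac)
  also have "(\<Sum>j\<in>UNIV. P $ i $ j * expect P j (indicator G)) = expect P i (indicator F)"
    unfolding 2[symmetric]
    by (rule expect_step[OF P, where B = 1, symmetric]) (use F in \<open>auto simp: indicator_def\<close>)
  finally show ?case .
qed

text \<open>An invariant event is independent of all finite-horizon events, hence, by equality of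
  two measures, of every event and in particular of itself. Its probability \<open>c\<close>
  therefore satisfies \<open>c * c = c\<close>.\<close>

lemma ergodic_markov_measure:
  fixes P :: "real ^ 'n::finite ^ 'n"
  assumes P: "stochastic P" and irr: "irreducible_chain P" and p: "prob_vector p"
    and E: "E \<in> sets traj" and inv: "shift -` E = E"
  shows "measure (markov_measure P p) E = 0 \<or> measure (markov_measure P p) E = 1"
proof -
  fix i0 :: 'n
  define c where "c = expect P i0 (indicator E)"
  have c: "expect P i (indicator E) = c" for i
    unfolding c_def by (rule invariant_set_constant[OF P irr E inv])
  have cm: "c = measure (started P i) E" for i
  proof -
    have "expect P i (indicator E) = measure (started P i) (E \<inter> space (started P i))"
      unfolding expect_def by simp
    then show ?thesis by (simp add: c space_started)
  qed
  have c0: "0 \<le> c" by (simp add: cm[of i0])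
  have "c * c = c"
  proof -
    let ?M = "started P i0"
    interpret M: prob_space ?M by (rule prob_space_started[OF P])
    have exm: "expect P i0 (indicator A) = measure ?M A" for A
      unfolding expect_def by (simp add: space_started)
    have "density ?M (indicator E) = scale_measure (ennreal c) ?M"
    proof (rule traj_measure_eqI)
      show "finite_measure (density ?M (indicator E))"
      proof (rule finite_measureI)
        have "emeasure (density ?M (indicator E)) UNIV = emeasure ?M (E \<inter> UNIV)"
          by (rule emeasure_restricted) (use E sets_started space_started[of P i0] sets.top[of ?M] in auto)
        then show "emeasure (density ?M (indicator E)) (space (density ?M (indicator E))) \<noteq> \<infinity>"
          by (simp add: space_started)
      qed
      fix F :: "(nat \<Rightarrow> 'n) set" and n assume F: "fdep n (\<lambda>\<omega>. \<omega> \<in> F)"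
      have sF: "F \<in> sets traj" by (rule fdep_sets[OF F])
      have "emeasure (density ?M (indicator E)) F = emeasure ?M (E \<inter> F)"
        using E sF sets_started by (intro emeasure_restricted) auto
      also have "\<dots> = ennreal (c * measure ?M F)"
        using invariant_set_independent[OF P irr E inv F, of i0 i0]
        by (simp add: M.emeasure_eq_measure exm c_def)
      finally show "emeasure (density ?M (indicator E)) F = emeasure (scale_measure (ennreal c) ?M) F"
        using c0 by (simp add: M.emeasure_eq_measure ennreal_mult)
    qed (use sets_started in auto)
    moreover have "emeasure (density ?M (indicator E)) E = emeasure ?M (E \<inter> E)"
      by (rule emeasure_restricted) (use E sets_started in auto)
    ultimately have "emeasure ?M (E \<inter> E) = ennreal c * emeasure ?M E" by simp
    then show ?thesis using c0 cm[of i0] by (simp add: M.emeasure_eq_measure flip: ennreal_mult)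
  qed
  then have "c = 0 \<or> c = 1" by auto
  moreover have "measure (markov_measure P p) E = c"
    using p by (simp add: measure_markov_measure_start[OF P p E] c prob_vector_def flip: sum_distrib_right)
  ultimately show ?thesis by simp
qed

section \<open>The subadditive ergodic theorem\<close>

text \<open>Ergodicity is asked for sets that are equal to their preimage, not merely almost equal;
  the processes below must therefore be handled pointwise.\<close>

locale ergodic_system = prob_space M for M :: "'a measure" +
  fixes T :: "'a \<Rightarrow> 'a"
  assumes T_measurable: "T \<in> M \<rightarrow>\<^sub>M M"
    and T_preserves: "distr M M T = M"
    and space_UNIV: "space M = UNIV"
    and ergodic: "\<And>E. E \<in> sets M \<Longrightarrow> T -` E = E \<Longrightarrow> prob E = 0 \<or> prob E = 1"
begin

lemma Tn_measurable: "T ^^ k \<in> M \<rightarrow>\<^sub>M M"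
proof (induction k)
  case (Suc k)
  show ?case using measurable_comp[OF Suc T_measurable] by (simp only: funpow.simps)
qed simp

lemma orbit_sum_split:
  "(\<Sum>k<m + n. f ((T ^^ k) \<omega>)) = (\<Sum>k<m. f ((T ^^ k) \<omega>)) + (\<Sum>k<n. f ((T ^^ k) ((T ^^ m) \<omega>)))"
  for f :: "'a \<Rightarrow> real"
  by (induction n) (simp_all add: funpow_add add.commute[of m])

lemma Tn_preserves: "distr M M (T ^^ k) = M"
proof (induction k)
  case 0
  then show ?case using distr_id[of M] by (simp add: id_def)
next
  case (Suc k)
  have "distr M M (T \<circ> (T ^^ k)) = distr (distr M M (T ^^ k)) M T"
    by (rule distr_distr[OF T_measurable Tn_measurable, symmetric])
  then show ?case by (simp only: Suc T_preserves funpow.simps)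
qed

lemma integral_Tn:
  fixes f :: "'a \<Rightarrow> real"
  assumes "f \<in> borel_measurable M"
  shows "(\<integral>\<omega>. f ((T ^^ k) \<omega>) \<partial>M) = (\<integral>\<omega>. f \<omega> \<partial>M)"
  using integral_distr[OF Tn_measurable assms, of k] by (simp add: Tn_preserves)

lemma integrable_bounded:
  fixes f :: "'a \<Rightarrow> real"
  assumes "f \<in> borel_measurable M" "\<And>\<omega>. \<bar>f \<omega>\<bar> \<le> B"
  shows "integrable M f"
  by (rule integrable_const_bound[where B = B]) (use assms in auto)

end

text \<open>All bounds hold at every point. Subadditivity compares \<open>g (Suc n)\<close> with
  \<open>g n\<close> after one step from one side only; \<open>g_shift\<close> bounds the difference
  from both sides, which makes the lower growth rate strictly \<open>T\<close>-invariant.\<close>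

locale subadditive_process = ergodic_system +
  fixes g :: "nat \<Rightarrow> 'a \<Rightarrow> real" and K :: real
  assumes g_measurable: "\<And>n. g n \<in> borel_measurable M"
    and subadditive: "\<And>m n \<omega>. g (m + n) \<omega> \<le> g m \<omega> + g n ((T ^^ m) \<omega>)"
    and g_bound: "\<And>n \<omega>. \<bar>g n \<omega>\<bar> \<le> K * real n"
    and g_shift: "\<And>n \<omega>. \<bar>g (Suc n) \<omega> - g n (T \<omega>)\<bar> \<le> K"
begin

lemma K_nonneg: "0 \<le> K"
  using g_bound[of 1 undefined] by simp

definition rate :: real where
  "rate = (INF n\<in>{1..}. (\<integral>\<omega>. g n \<omega> \<partial>M) / real n)"

lemma integrable_g: "integrable M (g n)"
  by (rule integrable_bounded[OF g_measurable g_bound])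

lemma integral_g_bound: "\<bar>\<integral>\<omega>. g n \<omega> \<partial>M\<bar> \<le> K * real n"
proof -
  have "\<bar>\<integral>\<omega>. g n \<omega> \<partial>M\<bar> \<le> (\<integral>\<omega>. \<bar>g n \<omega>\<bar> \<partial>M)" by (rule integral_abs_bound)
  also have "\<dots> \<le> (\<integral>\<omega>. K * real n \<partial>M)"
    by (rule integral_mono) (use integrable_g g_bound in auto)
  finally show ?thesis by (simp add: prob_space)
qed

lemma bdd_below_mean: "bdd_below ((\<lambda>n. (\<integral>\<omega>. g n \<omega> \<partial>M) / real n) ` {1..})"
proof -
  have "- K \<le> (\<integral>\<omega>. g m \<omega> \<partial>M) / real m" if "1 \<le> m" for m
    using integral_g_bound[of m] that by (simp add: field_simps abs_le_iff)
  then show ?thesis by (intro bdd_belowI[of _ "- K"]) auto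
qed

lemma rate_le: "1 \<le> n \<Longrightarrow> rate \<le> (\<integral>\<omega>. g n \<omega> \<partial>M) / real n"
  unfolding rate_def by (rule cINF_lower[OF bdd_below_mean]) simp

section \<open>Lower bound for the growth of a subadditive process\<close>

definition bad :: "real \<Rightarrow> nat \<Rightarrow> 'a set" where
  "bad c m = {\<omega>. \<forall>n\<in>{1..m}. c * real n < g n \<omega>}"

lemma bad_sets: "bad c m \<in> sets M"
proof -
  have "{\<omega>\<in>space M. \<forall>n\<in>{1..m}. c * real n < g n \<omega>} \<in> sets M"
    using g_measurable by measurable
  then show ?thesis by (simp add: bad_def space_UNIV)
qed

text \<open>Cut the orbit greedily: a visit outside \<open>bad c m\<close> starts a block of length at most \<open>m\<close> on
  which \<open>g\<close> grows at rate at most \<open>c\<close>, and a visit in \<open>bad c m\<close> is a block of length one.\<close>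

lemma greedy_bound:
  "g n \<omega> \<le> c * real n + (K + \<bar>c\<bar>) * (\<Sum>k<n. indicator (bad c m) ((T ^^ k) \<omega>)) + (K + \<bar>c\<bar>) * real m"
proof (induction n arbitrary: \<omega> rule: less_induct)
  case (less n)
  let ?K = "K + \<bar>c\<bar>"
  have K: "0 \<le> ?K" using K_nonneg by simp
  show ?case
  proof (cases "n \<le> m")
    \<comment> \<open>At most \<open>m\<close> steps remain; the trivial bound is paid for by the
      last term.\<close>
    case True
    have "g n \<omega> \<le> K * real n" using g_bound[of n \<omega>] by simp
    also have "\<dots> = c * real n + (K - c) * real n" by (simp add: algebra_simps)
    also have "(K - c) * real n \<le> ?K * real n" by (intro mult_right_mono) auto
    also have "?K * real n \<le> ?K * real m" using K True by (intro mult_left_mono) auto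
    also have "c * real n + ?K * real m \<le> c * real n
        + ?K * (\<Sum>k<n. indicator (bad c m) ((T ^^ k) \<omega>)) + ?K * real m"
      using K by (simp add: sum_nonneg)
    finally show ?thesis by simp
  next
    case False
    have split: "(\<Sum>k<n. indicator (bad c m) ((T ^^ k) \<omega>) :: real) =
        (\<Sum>k<l. indicator (bad c m) ((T ^^ k) \<omega>)) + (\<Sum>k<n - l. indicator (bad c m) ((T ^^ k) ((T ^^ l) \<omega>)))"
      if "l \<le> n" for l :: nat
      using orbit_sum_split[where m = l and n = "n - l" and f = "indicator (bad c m)"] that by simp
    have step: "g n \<omega> \<le> g l \<omega> + (c * real (n - l)
        + ?K * (\<Sum>k<n - l. indicator (bad c m) ((T ^^ k) ((T ^^ l) \<omega>))) + ?K * real m)"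
      if "1 \<le> l" "l \<le> n" for l
      using subadditive[of l "n - l" \<omega>] less[of "n - l" "(T ^^ l) \<omega>"] that by simp
    show ?thesis
    proof (cases "\<omega> \<in> bad c m")
      case True
      have "g 1 \<omega> \<le> c + ?K" using g_bound[of 1 \<omega>] by simp
      moreover have "(\<Sum>k<1. indicator (bad c m) ((T ^^ k) \<omega>)) = (1 :: real)" using True by simp
      ultimately show ?thesis using step[of 1] split[of 1] False
        by (simp add: of_nat_diff algebra_simps)
    next
      case good: False
      then obtain l where l: "1 \<le> l" "l \<le> m" "g l \<omega> \<le> c * real l"
        by (auto simp: bad_def not_less)
      have "l \<le> n" using l False by simp
      have "0 \<le> ?K * (\<Sum>k<l. indicator (bad c m) ((T ^^ k) \<omega>))" using K by (simp add: sum_nonneg)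
      then show ?thesis using step[OF l(1) \<open>l \<le> n\<close>] split[OF \<open>l \<le> n\<close>] l \<open>l \<le> n\<close>
        by (simp add: of_nat_diff algebra_simps)
    qed
  qed
qed

lemma integral_g_le:
  "(\<integral>\<omega>. g n \<omega> \<partial>M) \<le> c * real n + (K + \<bar>c\<bar>) * (real n * prob (bad c m)) + (K + \<bar>c\<bar>) * real m"
proof -
  let ?I = "\<lambda>k \<omega>. indicator (bad c m) ((T ^^ k) \<omega>) :: real"
  have meas: "?I k \<in> borel_measurable M" for k
    using measurable_compose[OF Tn_measurable borel_measurable_indicator[OF bad_sets]] .
  have int: "integrable M (?I k)" for k
    by (rule integrable_bounded[OF meas, where B = 1]) (simp add: indicator_def)
  have Ek: "(\<integral>\<omega>. ?I k \<omega> \<partial>M) = prob (bad c m)" for k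
    using integral_Tn[OF borel_measurable_indicator[OF bad_sets[of c m]], of k]
    by (simp add: space_UNIV)
  have "(\<integral>\<omega>. g n \<omega> \<partial>M) \<le> (\<integral>\<omega>. c * real n + (K + \<bar>c\<bar>) * (\<Sum>k<n. ?I k \<omega>) + (K + \<bar>c\<bar>) * real m \<partial>M)"
    by (rule integral_mono[OF integrable_g _ greedy_bound]) (use int in simp)
  also have "\<dots> = c * real n + (K + \<bar>c\<bar>) * (\<Sum>k<n. (\<integral>\<omega>. ?I k \<omega> \<partial>M)) + (K + \<bar>c\<bar>) * real m"
    using int by (simp add: prob_space)
  finally show ?thesis by (simp add: Ek)
qed

text \<open>The order of limits matters: for fixed \<open>m\<close> the boundary term disappears as
  the orbit gets longer, and only afterwards does \<open>m\<close> grow, with the probability of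
  \<open>bad c m\<close> decreasing to 0.\<close>

lemma rate_le_if_reached:
  assumes "AE \<omega> in M. \<exists>n\<ge>1. g n \<omega> \<le> c * real n"
  shows "rate \<le> c"
proof -
  let ?K = "K + \<bar>c\<bar>"
  have lim: "(\<lambda>m. prob (bad c m)) \<longlonglongrightarrow> prob (\<Inter>m. bad c m)"
  proof (rule finite_Lim_measure_decseq)
    show "range (bad c) \<subseteq> sets M" using bad_sets by auto
    show "decseq (bad c)" by (auto simp: decseq_def bad_def)
  qed
  have "AE \<omega> in M. \<omega> \<notin> (\<Inter>m. bad c m)"
    using assms
  proof eventually_elim
    case (elim \<omega>)
    then obtain n where "n \<ge> 1" "g n \<omega> \<le> c * real n" by blast
    then have "\<omega> \<notin> bad c n" by (auto simp: bad_def not_less)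
    then show ?case by blast
  qed
  then have "prob (\<Inter>m. bad c m) = 0"
    using prob_eq_0[of "\<Inter>m. bad c m"] bad_sets by (auto intro: sets.countable_INT)
  then have lim0: "(\<lambda>m. prob (bad c m)) \<longlonglongrightarrow> 0" using lim by simp
  have fixed: "rate \<le> c + ?K * prob (bad c m)" for m
  proof (rule LIMSEQ_le_const)
    show "(\<lambda>n. c + ?K * prob (bad c m) + ?K * real m * inverse (real (Suc n))) \<longlonglongrightarrow> c + ?K * prob (bad c m)"
      using tendsto_add[OF tendsto_const tendsto_mult[OF tendsto_const LIMSEQ_inverse_real_of_nat]] by fastforce
    have "rate \<le> c + ?K * prob (bad c m) + ?K * real m * inverse (real (Suc n))" for n
    proof -
      have "rate \<le> (\<integral>\<omega>. g (Suc n) \<omega> \<partial>M) / real (Suc n)" by (rule rate_le) simp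
      also have "\<dots> \<le> (c * real (Suc n) + ?K * (real (Suc n) * prob (bad c m)) + ?K * real m) / real (Suc n)"
        by (intro divide_right_mono integral_g_le) simp
      also have "\<dots> = c + ?K * prob (bad c m) + ?K * real m * inverse (real (Suc n))"
        by (simp add: field_simps del: of_nat_Suc)
      finally show ?thesis .
    qed
    then show "\<exists>N. \<forall>n\<ge>N. rate \<le> c + ?K * prob (bad c m) + ?K * real m * inverse (real (Suc n))" by blast
  qed
  have "(\<lambda>m. c + ?K * prob (bad c m)) \<longlonglongrightarrow> c + ?K * 0"
    by (intro tendsto_intros lim0)
  then have "rate \<le> c + ?K * 0" by (rule LIMSEQ_le_const) (use fixed in blast)
  then show ?thesis by simp
qed

text \<open>The set \<open>E\<close> where the lower growth rate is at most \<open>c\<close> is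
  invariant, so it has probability 0 or 1. Probability 1 would give \<open>rate \<le> c + e\<close>
  by \<open>rate_le_if_reached\<close>, with a slack \<open>e\<close> of half the gap between
  \<open>c\<close> and \<open>rate\<close>.\<close>

lemma AE_eventually_above:
  assumes c: "c < rate"
  shows "AE \<omega> in M. \<forall>\<^sub>F n in sequentially. c * real n < g n \<omega>"
proof -
  \<comment> \<open>The slack \<open>e\<close> absorbs the bounded error of \<open>g_shift\<close>
    and the shift of the index by one. \<open>E\<close> asks for every slack, and this makes it
    exactly invariant.\<close>
  define hit where "hit e \<omega> \<longleftrightarrow> (\<forall>N. \<exists>n\<ge>N. g n \<omega> \<le> (c + e) * real n)" for e \<omega>
  define E where "E = {\<omega>. \<forall>j. hit (inverse (real (Suc j))) \<omega>}"
  have "{\<omega>\<in>space M. \<forall>j. \<forall>N. \<exists>n\<ge>N. g n \<omega> \<le> (c + inverse (real (Suc j))) * real n} \<in> sets M"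
    using g_measurable by measurable
  then have E: "E \<in> sets M" by (simp add: E_def hit_def space_UNIV)
  have absorb: "\<exists>N. \<forall>n\<ge>N. C \<le> e * real n" if "0 < e" for C e :: real
  proof -
    obtain N :: nat where "C / e \<le> real N" using real_arch_simple by blast
    then have "C \<le> e * real N" using that by (simp add: field_simps)
    then show ?thesis using that by (meson mult_left_mono of_nat_mono less_imp_le order_trans)
  qed
  have hitT: "hit (e + d) (T \<omega>)" if h: "hit e \<omega>" and d: "0 < d" for e d \<omega>
    unfolding hit_def
  proof
    fix N
    obtain N1 where N1: "\<And>n. n \<ge> N1 \<Longrightarrow> K + \<bar>c + e\<bar> \<le> d * real n" using absorb[OF d] by blast
    obtain n where n: "n \<ge> Suc (max N N1)" "g n \<omega> \<le> (c + e) * real n" using h unfolding hit_def by blast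
    then obtain l where l: "n = Suc l" "l \<ge> N" "l \<ge> N1" by (cases n) auto
    have "g l (T \<omega>) \<le> g n \<omega> + K" using g_shift[of l \<omega>] l by simp
    also have "\<dots> \<le> (c + e) * real l + (K + (c + e))" using n l by (simp add: algebra_simps)
    also have "\<dots> \<le> (c + e) * real l + d * real l" using N1[OF l(3)] by simp
    finally show "\<exists>n\<ge>N. g n (T \<omega>) \<le> (c + (e + d)) * real n"
      using l by (auto simp: algebra_simps)
  qed
  have hitT': "hit (e + d) \<omega>" if h: "hit e (T \<omega>)" and d: "0 < d" for e d \<omega>
    unfolding hit_def
  proof
    fix N
    obtain N1 where N1: "\<And>n. n \<ge> N1 \<Longrightarrow> K + \<bar>c + e\<bar> \<le> d * real n" using absorb[OF d] by blast
    obtain l where l: "l \<ge> max N N1" "g l (T \<omega>) \<le> (c + e) * real l" using h unfolding hit_def by blast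
    have "g (Suc l) \<omega> \<le> g l (T \<omega>) + K" using g_shift[of l \<omega>] by simp
    also have "\<dots> \<le> (c + e) * real (Suc l) + (K - (c + e))" using l by (simp add: algebra_simps)
    also have "\<dots> \<le> (c + e) * real (Suc l) + d * real (Suc l)" using N1[of "Suc l"] l by simp
    finally show "\<exists>n\<ge>N. g n \<omega> \<le> (c + (e + d)) * real n"
      using l by (intro exI[of _ "Suc l"]) (simp add: algebra_simps)
  qed
  have small: "\<exists>j. inverse (real (Suc j)) < e" if "0 < e" for e :: real
    using reals_Archimedean[OF that] by simp
  have hit_mono: "hit e' \<omega>" if "hit e \<omega>" "e \<le> e'" for e e' \<omega>
    using that unfolding hit_def by (meson add_left_mono mult_right_mono of_nat_0_le_iff order_trans)
  have E_iff: "\<omega> \<in> E \<longleftrightarrow> (\<forall>e>0. hit e \<omega>)" for \<omega>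
  proof
    assume E: "\<omega> \<in> E"
    show "\<forall>e>0. hit e \<omega>"
    proof (intro allI impI)
      fix e :: real assume "0 < e"
      then obtain j where "inverse (real (Suc j)) < e" using small by blast
      moreover have "hit (inverse (real (Suc j))) \<omega>" using E unfolding E_def by blast
      ultimately show "hit e \<omega>" using hit_mono less_imp_le by blast
    qed
  qed (auto simp: E_def)
  have "T -` E = E"
  proof (intro set_eqI)
    fix \<omega>
    show "\<omega> \<in> T -` E \<longleftrightarrow> \<omega> \<in> E"
      unfolding vimage_eq E_iff using hitT[of "e / 2" \<omega> "e / 2" for e] hitT'[of "e / 2" \<omega> "e / 2" for e]
      by (metis field_sum_of_halves half_gt_zero)
  qed
  from ergodic[OF E this] have "prob E = 0"
  proof
    assume "prob E = 1"
    then have AE: "AE \<omega> in M. \<omega> \<in> E" using prob_eq_1[OF E] by simp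
    define e where "e = (rate - c) / 2"
    have e: "0 < e" using c by (simp add: e_def)
    have "AE \<omega> in M. \<exists>n\<ge>1. g n \<omega> \<le> (c + e) * real n"
      using AE by eventually_elim (use e in \<open>auto simp: E_iff hit_def\<close>)
    then have "rate \<le> c + e" by (rule rate_le_if_reached)
    then show ?thesis using c by (simp add: e_def field_simps)
  qed
  then have "AE \<omega> in M. \<omega> \<notin> E" using prob_eq_0[OF E] by simp
  then show ?thesis
  proof eventually_elim
    case (elim \<omega>)
    then obtain j N where "\<And>n. n \<ge> N \<Longrightarrow> (c + inverse (real (Suc j))) * real n < g n \<omega>"
      unfolding E_def hit_def mem_Collect_eq by (meson not_le)
    moreover have "c * real n \<le> (c + inverse (real (Suc j))) * real n" for n
      by (intro mult_right_mono) auto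
    ultimately show ?case unfolding eventually_sequentially by (meson le_less_trans)
  qed
qed

lemma AE_lower:
  "AE \<omega> in M. \<forall>c<rate. \<forall>\<^sub>F n in sequentially. c < g n \<omega> / real n"
proof -
  have "AE \<omega> in M. \<forall>j. \<forall>\<^sub>F n in sequentially. (rate - inverse (real (Suc j))) * real n < g n \<omega>"
    unfolding AE_all_countable by (intro allI AE_eventually_above) simp
  then show ?thesis
  proof eventually_elim
    case (elim \<omega>)
    show ?case
    proof (intro allI impI)
      fix c assume "c < rate"
      then obtain j where j: "inverse (real (Suc j)) < rate - c"
        using reals_Archimedean[of "rate - c"] by auto
      show "\<forall>\<^sub>F n in sequentially. c < g n \<omega> / real n"
        using elim[rule_format, of j] eventually_gt_at_top[of 0]
      proof eventually_elim
        case (elim n)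
        then have "rate - inverse (real (Suc j)) < g n \<omega> / real n" by (simp add: field_simps)
        then show ?case using j by simp
      qed
    qed
  qed
qed

end

section \<open>Birkhoff's theorem and the upper bound\<close>

context ergodic_system begin

lemma birkhoff_process:
  fixes f :: "'a \<Rightarrow> real"
  assumes f: "f \<in> borel_measurable M" and B: "\<And>\<omega>. \<bar>f \<omega>\<bar> \<le> B"
  shows "subadditive_process M T (\<lambda>n \<omega>. \<Sum>k<n. f ((T ^^ k) \<omega>)) B"
proof (unfold_locales, goal_cases)
  case (1 n)
  then show ?case using measurable_compose[OF Tn_measurable f] by simp
next
  case (2 m n \<omega>)
  show ?case by (simp add: orbit_sum_split)
next
  case (3 n \<omega>)
  have "\<bar>\<Sum>k<n. f ((T ^^ k) \<omega>)\<bar> \<le> (\<Sum>k<n. B)" by (rule sum_abs[THEN order_trans]) (intro sum_mono B)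
  then show ?case by (simp add: mult.commute)
next
  case (4 n \<omega>)
  have "(\<Sum>k<Suc n. f ((T ^^ k) \<omega>)) = f \<omega> + (\<Sum>k<n. f ((T ^^ k) (T \<omega>)))"
    unfolding sum.lessThan_Suc_shift by (simp add: funpow_swap1)
  then show ?case using B by simp
qed

text \<open>Orbit sums of \<open>f\<close> and of \<open>- f\<close> are both subadditive processes,
  with opposite rates; the lower bound \<open>AE_lower\<close> for the two pinches the
  averages.\<close>

theorem birkhoff:
  fixes f :: "'a \<Rightarrow> real"
  assumes f: "f \<in> borel_measurable M" and B: "\<And>\<omega>. \<bar>f \<omega>\<bar> \<le> B"
  shows "AE \<omega> in M. (\<lambda>n. (\<Sum>k<n. f ((T ^^ k) \<omega>)) / real n) \<longlonglongrightarrow> (\<integral>\<omega>. f \<omega> \<partial>M)"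
proof -
  interpret p: subadditive_process M T "\<lambda>n \<omega>. \<Sum>k<n. f ((T ^^ k) \<omega>)" B
    by (rule birkhoff_process[OF f B])
  have f': "(\<lambda>\<omega>. - f \<omega>) \<in> borel_measurable M" and B': "\<And>\<omega>. \<bar>- f \<omega>\<bar> \<le> B" using f B by auto
  interpret m: subadditive_process M T "\<lambda>n \<omega>. \<Sum>k<n. - f ((T ^^ k) \<omega>)" B
    by (rule birkhoff_process[OF f' B'])
  have int: "integrable M (\<lambda>\<omega>. f ((T ^^ k) \<omega>))" for k
    by (rule integrable_bounded[OF measurable_compose[OF Tn_measurable f] B])
  have avg: "(\<integral>\<omega>. (\<Sum>k<n. f ((T ^^ k) \<omega>)) \<partial>M) = real n * (\<integral>\<omega>. f \<omega> \<partial>M)" for n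
    using int by (simp add: integral_Tn[OF f])
  have avg': "(\<integral>\<omega>. (\<Sum>k<n. - f ((T ^^ k) \<omega>)) \<partial>M) = - (real n * (\<integral>\<omega>. f \<omega> \<partial>M))" for n
    using int by (simp add: integral_Tn[OF f] sum_negf)
  have rp: "p.rate = (\<integral>\<omega>. f \<omega> \<partial>M)"
    unfolding p.rate_def by (rule antisym, rule cINF_lower2[where x = 1])
      (auto simp: avg simp del: Bochner_Integration.integral_sum intro!: cINF_greatest bdd_belowI2[where m = "\<integral>\<omega>. f \<omega> \<partial>M"])
  have rm: "m.rate = - (\<integral>\<omega>. f \<omega> \<partial>M)"
    unfolding m.rate_def by (rule antisym, rule cINF_lower2[where x = 1])
      (auto simp: avg' simp del: Bochner_Integration.integral_sum intro!: cINF_greatest bdd_belowI2[where m = "- (\<integral>\<omega>. f \<omega> \<partial>M)"])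
  show ?thesis
    using p.AE_lower m.AE_lower
  proof eventually_elim
    case (elim \<omega>)
    show ?case
    proof (rule order_tendstoI)
      fix a assume "a < (\<integral>\<omega>. f \<omega> \<partial>M)"
      then show "\<forall>\<^sub>F n in sequentially. a < (\<Sum>k<n. f ((T ^^ k) \<omega>)) / real n" using elim(1) rp by simp
    next
      fix a assume "(\<integral>\<omega>. f \<omega> \<partial>M) < a"
      then have "- a < m.rate" using rm by simp
      then have "\<forall>\<^sub>F n in sequentially. - a < (\<Sum>k<n. - f ((T ^^ k) \<omega>)) / real n" using elim(2) by blast
      then show "\<forall>\<^sub>F n in sequentially. (\<Sum>k<n. f ((T ^^ k) \<omega>)) / real n < a"
        by eventually_elim (simp add: sum_negf)
    qed
  qed
qed

end

context subadditive_process begin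

text \<open>Summing the defects of \<open>g (n + m - i) (T ^^ i)\<close>, \<open>i < m\<close>, along the orbit telescopes, since all
  these terms end at the same time.\<close>

lemma block_average_bound:
  assumes "1 \<le> m"
  shows "real m * g (n + m) \<omega> \<le> (\<Sum>k<n. g m ((T ^^ k) \<omega>)) + 2 * K * (real m)\<^sup>2"
proof -
  define V where "V n \<omega> = (\<Sum>i<m. g (n + m - i) ((T ^^ i) \<omega>))" for n \<omega>
  have rec: "V (Suc n) \<omega> - V n (T \<omega>) \<le> g m \<omega>" for n \<omega>
  proof -
    define h where "h i = g (Suc n + m - i) ((T ^^ i) \<omega>)" for i
    have "V (Suc n) \<omega> = (\<Sum>i<m. h i)" by (simp add: V_def h_def)
    moreover have "V n (T \<omega>) = (\<Sum>i<m. h (Suc i))"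
      unfolding V_def h_def by (intro sum.cong refl) (simp add: funpow_swap1)
    ultimately have "V (Suc n) \<omega> - V n (T \<omega>) = h 0 - h m"
      using sum_lessThan_telescope'[of h m] by (simp add: sum_subtractf)
    also have "\<dots> \<le> g m \<omega>" using subadditive[of m "Suc n" \<omega>] by (simp add: h_def add.commute)
    finally show ?thesis .
  qed
  have V: "V n \<omega> \<le> (\<Sum>k<n. g m ((T ^^ k) \<omega>)) + K * (real m)\<^sup>2" for n \<omega>
  proof (induction n arbitrary: \<omega>)
    case 0
    have "V 0 \<omega> \<le> (\<Sum>i<m. K * real m)" unfolding V_def
    proof (rule sum_mono)
      fix i
      have "g (0 + m - i) ((T ^^ i) \<omega>) \<le> K * real (m - i)" using g_bound[of "m - i" "(T ^^ i) \<omega>"] by simp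
      also have "\<dots> \<le> K * real m" using K_nonneg by (intro mult_left_mono) auto
      finally show "g (0 + m - i) ((T ^^ i) \<omega>) \<le> K * real m" .
    qed
    then show ?case by (simp add: power2_eq_square mult_ac)
  next
    case (Suc n)
    have "(\<Sum>k<Suc n. g m ((T ^^ k) \<omega>)) = g m \<omega> + (\<Sum>k<n. g m ((T ^^ k) (T \<omega>)))"
      unfolding sum.lessThan_Suc_shift by (simp add: funpow_swap1)
    then show ?case using rec[of n \<omega>] Suc[of "T \<omega>"] by simp
  qed
  have "(\<Sum>i<m. g (n + m) \<omega> - K * real m) \<le> V n \<omega>" unfolding V_def
  proof (rule sum_mono)
    fix i assume "i \<in> {..<m}"
    then have i: "i < m" by simp
    have "g (i + (n + m - i)) \<omega> \<le> g i \<omega> + g (n + m - i) ((T ^^ i) \<omega>)" by (rule subadditive)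
    moreover have "g i \<omega> \<le> K * real m"
      using g_bound[of i \<omega>] mult_left_mono[OF _ K_nonneg, of "real i" "real m"] i by simp
    ultimately show "g (n + m) \<omega> - K * real m \<le> g (n + m - i) ((T ^^ i) \<omega>)" using i by simp
  qed
  then show ?thesis using V[of n \<omega>] by (simp add: power2_eq_square algebra_simps)
qed

text \<open>In \<open>block_average_bound\<close> the orbit averages of \<open>g m\<close> converge
  by Birkhoff's theorem, and for fixed \<open>m\<close> the error term is negligible after division
  by \<open>n + m\<close>.\<close>

lemma AE_upper_block:
  assumes m: "1 \<le> m" and c: "(\<integral>\<omega>. g m \<omega> \<partial>M) / real m < c"
  shows "AE \<omega> in M. \<forall>\<^sub>F n in sequentially. g n \<omega> / real n < c"
proof -
  have "AE \<omega> in M. (\<lambda>n. (\<Sum>k<n. g m ((T ^^ k) \<omega>)) / real n) \<longlonglongrightarrow> (\<integral>\<omega>. g m \<omega> \<partial>M)"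
    by (rule birkhoff[OF g_measurable g_bound])
  then show ?thesis
  proof eventually_elim
    case (elim \<omega>)
    define u where "u n = ((\<Sum>k<n. g m ((T ^^ k) \<omega>)) / real n + (2 * K * (real m)\<^sup>2) / real n) / real m" for n
    have "u \<longlonglongrightarrow> ((\<integral>\<omega>. g m \<omega> \<partial>M) + 0) / real m"
      unfolding u_def by (intro tendsto_intros elim lim_const_over_n) (use m in auto)
    then have l: "(\<lambda>n. u n * (real n / real (n + m))) \<longlonglongrightarrow> ((\<integral>\<omega>. g m \<omega> \<partial>M) + 0) / real m * 1"
      by (rule tendsto_mult) real_asymp
    then have "\<forall>\<^sub>F n in sequentially. u n * (real n / real (n + m)) < c"
      by (rule order_tendstoD(2)) (use c in simp)
    then have "\<forall>\<^sub>F n in sequentially. g (n + m) \<omega> / real (n + m) < c"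
      using eventually_gt_at_top[of 0]
    proof eventually_elim
      case (elim n)
      have "g (n + m) \<omega> / real (n + m) = (real m * g (n + m) \<omega>) / (real m * real (n + m))"
        using m by simp
      also have "\<dots> \<le> ((\<Sum>k<n. g m ((T ^^ k) \<omega>)) + 2 * K * (real m)\<^sup>2) / (real m * real (n + m))"
        using m by (intro divide_right_mono block_average_bound) auto
      also have "\<dots> = u n * (real n / real (n + m))"
        using elim m by (simp add: u_def add_divide_distrib[symmetric])
      finally show ?case using elim by simp
    qed
    then show ?case
      using eventually_sequentially_seg[of "\<lambda>n. g n \<omega> / real n < c" m] by simp
  qed
qed

text \<open>For the upper bound, \<open>m\<close> is taken with mean rate within
  \<open>inverse (real (Suc j))\<close> of the infimum. Dominated convergence then shows that the
  infimum of the mean rates is also their limit.\<close>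

theorem
  shows AE_rate: "AE \<omega> in M. (\<lambda>n. g n \<omega> / real n) \<longlonglongrightarrow> rate"
    and mean_rate: "(\<lambda>n. (\<integral>\<omega>. g n \<omega> \<partial>M) / real n) \<longlonglongrightarrow> rate"
proof -
  have "AE \<omega> in M. \<forall>j. \<forall>\<^sub>F n in sequentially. g n \<omega> / real n < rate + inverse (real (Suc j))"
    unfolding AE_all_countable
  proof
    fix j
    have "rate < rate + inverse (real (Suc j))" by simp
    then obtain m where "m \<in> {1..}" "(\<integral>\<omega>. g m \<omega> \<partial>M) / real m < rate + inverse (real (Suc j))"
      unfolding rate_def using cINF_less_iff[OF _ bdd_below_mean] by blast
    then show "AE \<omega> in M. \<forall>\<^sub>F n in sequentially. g n \<omega> / real n < rate + inverse (real (Suc j))"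
      by (intro AE_upper_block) auto
  qed
  then show AE: "AE \<omega> in M. (\<lambda>n. g n \<omega> / real n) \<longlonglongrightarrow> rate"
    using AE_lower
  proof eventually_elim
    case (elim \<omega>)
    show ?case
    proof (rule order_tendstoI)
      fix a assume "a < rate" then show "\<forall>\<^sub>F n in sequentially. a < g n \<omega> / real n" using elim by blast
    next
      fix a assume "rate < a"
      then obtain j where "inverse (real (Suc j)) < a - rate" using reals_Archimedean[of "a - rate"] by auto
      then show "\<forall>\<^sub>F n in sequentially. g n \<omega> / real n < a"
        using elim(1)[rule_format, of j] by (auto elim: eventually_mono)
    qed
  qed
  have "(\<lambda>n. \<integral>\<omega>. g n \<omega> / real n \<partial>M) \<longlonglongrightarrow> (\<integral>\<omega>. rate \<partial>M)"
  proof (rule integral_dominated_convergence[where w = "\<lambda>_. K"])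
    fix n
    have "\<bar>g n \<omega> / real n\<bar> \<le> K" for \<omega>
      using g_bound[of n \<omega>] K_nonneg by (cases "n = 0") (simp_all add: field_simps abs_le_iff)
    then show "AE \<omega> in M. norm (g n \<omega> / real n) \<le> K" by simp
  qed (use AE g_measurable in auto)
  then show "(\<lambda>n. (\<integral>\<omega>. g n \<omega> \<partial>M) / real n) \<longlonglongrightarrow> rate" by (simp add: prob_space)
qed

end

section \<open>Two by two matrices\<close>

text \<open>The proof works with the Euclidean operator norm. The norm \<open>\<nu>\<close> of the
  theorem enters through \<open>op_norm_equivalent\<close>, when exponents and distances are
  translated.\<close>

abbreviation mnorm :: "real ^ 2 ^ 2 \<Rightarrow> real" where
  "mnorm M \<equiv> onorm ((*v) M)"

text \<open>The area form. It vanishes exactly on parallel pairs, it is the sine of the angle on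
  unit vectors up to sign, and matrices of determinant 1 or -1 keep its absolute value.\<close>

definition wedge :: "real ^ 2 \<Rightarrow> real ^ 2 \<Rightarrow> real" where
  "wedge u v = u $ 1 * v $ 2 - u $ 2 * v $ 1"

definition perp :: "real ^ 2 \<Rightarrow> real ^ 2" where
  "perp u = vector [- u $ 2, u $ 1]"

lemma perp_simps [simp]: "perp u $ 1 = - u $ 2" "perp u $ 2 = u $ 1"
  by (simp_all add: perp_def)

lemma norm_real2: "(norm (u :: real ^ 2))\<^sup>2 = (u $ 1)\<^sup>2 + (u $ 2)\<^sup>2"
  unfolding power2_norm_eq_inner by (simp add: inner_vec_def sum_2 power2_eq_square)

lemma inner_real2: "(u :: real ^ 2) \<bullet> v = u $ 1 * v $ 1 + u $ 2 * v $ 2"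
  by (simp add: inner_vec_def sum_2)

lemma norm_perp [simp]: "norm (perp u) = norm u"
proof -
  have "(norm (perp u))\<^sup>2 = (norm u)\<^sup>2" by (simp add: norm_real2)
  then show ?thesis by simp
qed

lemma wedge_perp: "wedge u (perp u) = (norm u)\<^sup>2"
  unfolding norm_real2 by (simp add: wedge_def power2_eq_square)

lemma lagrange: "(wedge u v)\<^sup>2 + (u \<bullet> v)\<^sup>2 = (norm u)\<^sup>2 * (norm v)\<^sup>2"
  by (simp add: wedge_def norm_real2 inner_real2) algebra

lemma wedge_le: "\<bar>wedge u v\<bar> \<le> norm u * norm v"
proof (rule power2_le_imp_le)
  show "\<bar>wedge u v\<bar>\<^sup>2 \<le> (norm u * norm v)\<^sup>2"
    using lagrange[of u v] by (simp add: power_mult_distrib) (metis add_increasing2 order_refl zero_le_power2)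
qed simp

lemma wedge_matrix: "wedge (M *v u) (M *v v) = det M * wedge u v"
  by (simp add: wedge_def matrix_vector_mult_def sum_2 det_2) algebra

lemma wedge_linear:
  "wedge u (v + w) = wedge u v + wedge u w" "wedge (u + w) v = wedge u v + wedge w v"
  "wedge u (v - w) = wedge u v - wedge u w" "wedge (u - w) v = wedge u v - wedge w v"
  "wedge (c *\<^sub>R u) v = c * wedge u v" "wedge u (c *\<^sub>R v) = c * wedge u v" "wedge u u = 0"
  by (simp_all add: wedge_def algebra_simps)

lemma wedge_anti: "wedge v u = - wedge u v"
  by (simp add: wedge_def)

lemma bounded_linear_mv: "bounded_linear ((*v) (M :: real ^ 2 ^ 2))"
  by (rule matrix_vector_mul_bounded_linear)

lemma mnorm: "norm (M *v v) \<le> mnorm M * norm v"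
  by (rule onorm[OF bounded_linear_mv])

lemma mnorm_le: "0 \<le> b \<Longrightarrow> (\<And>v. norm (M *v v) \<le> b * norm v) \<Longrightarrow> mnorm M \<le> b"
  by (rule onorm_bound)

lemma mnorm_nonneg: "0 \<le> mnorm M"
  by (rule onorm_pos_le[OF bounded_linear_mv])

lemma mnorm_mult: "mnorm (M ** N) \<le> mnorm M * mnorm N"
proof -
  have "(*v) (M ** N) = (*v) M \<circ> (*v) N" by (auto simp: matrix_vector_mul_assoc)
  then show ?thesis using onorm_compose[OF bounded_linear_mv bounded_linear_mv] by metis
qed

lemma mnorm_one: "mnorm (mat 1) = 1"
proof -
  have "((*v) (mat 1) :: real ^ 2 \<Rightarrow> real ^ 2) = (\<lambda>x. x)" by auto
  then show ?thesis using onorm_id[where 'a = "real ^ 2"] by simp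
qed

lemma mnorm_scaleR: "mnorm (c *\<^sub>R M) = \<bar>c\<bar> * mnorm M"
proof -
  have "(*v) (c *\<^sub>R M) = (\<lambda>v. c *\<^sub>R (M *v v))" by (auto simp: scaleR_matrix_vector_assoc)
  then show ?thesis using onorm_scaleR[OF bounded_linear_mv] by metis
qed

text \<open>Determinant -1 is allowed because normalization keeps the sign of the
  determinant.\<close>

definition unimodular :: "real ^ 2 ^ 2 \<Rightarrow> bool" where
  "unimodular M \<longleftrightarrow> \<bar>det M\<bar> = 1"

lemma unimodular_mult: "unimodular M \<Longrightarrow> unimodular N \<Longrightarrow> unimodular (M ** N)"
  by (simp add: unimodular_def det_mul abs_mult)

lemma unimodular_one: "unimodular (mat 1)"
  by (simp add: unimodular_def)

lemma unimodular_wedge: "unimodular M \<Longrightarrow> \<bar>wedge (M *v u) (M *v v)\<bar> = \<bar>wedge u v\<bar>"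
  by (simp add: wedge_matrix unimodular_def abs_mult)

text \<open>The square on \<open>v\<close> and \<open>perp v\<close> keeps its area, and its second
  side grows by a factor of at most \<open>mnorm M\<close>; the first side cannot shrink by more
  than that. Hence in dimension two the inverse has the same norm as \<open>M\<close>.\<close>

lemma unimodular_lower:
  assumes "unimodular M" shows "norm v \<le> mnorm M * norm (M *v v)"
proof (cases "v = 0")
  case False
  have "norm v * norm v = \<bar>wedge v (perp v)\<bar>" by (simp add: wedge_perp power2_eq_square)
  also have "\<dots> = \<bar>wedge (M *v v) (M *v perp v)\<bar>" using unimodular_wedge[OF assms] by simp
  also have "\<dots> \<le> norm (M *v v) * norm (M *v perp v)" by (rule wedge_le)
  also have "\<dots> \<le> norm (M *v v) * (mnorm M * norm v)"
    using mnorm[of M "perp v"] by (intro mult_left_mono) auto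
  finally have "norm v * norm v \<le> (mnorm M * norm (M *v v)) * norm v" by (simp add: mult_ac)
  then show ?thesis using False by simp
qed simp

lemma unimodular_mnorm_ge:
  assumes "unimodular M" shows "1 \<le> mnorm M"
proof -
  have "1 * norm (axis 1 1 :: real ^ 2) \<le> mnorm M * norm (M *v axis 1 1)"
    using unimodular_lower[OF assms, of "axis 1 1"] by simp
  also have "\<dots> \<le> mnorm M * (mnorm M * norm (axis 1 1 :: real ^ 2))"
    by (intro mult_left_mono mnorm mnorm_nonneg)
  finally have "1\<^sup>2 \<le> (mnorm M)\<^sup>2" by (simp add: norm_axis_1 power2_eq_square)
  then show ?thesis by (rule power2_le_imp_le) (rule mnorm_nonneg)
qed

lemma unimodular_invertible: "unimodular M \<Longrightarrow> invertible M"
  by (auto simp: unimodular_def invertible_det_nz)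

lemma
  assumes "invertible (M :: real ^ 2 ^ 2)"
  shows matrix_inv_right: "M ** matrix_inv M = mat 1" and matrix_inv_left: "matrix_inv M ** M = mat 1"
  using someI_ex[of "\<lambda>A'. M ** A' = mat 1 \<and> A' ** M = mat 1"] assms
  unfolding invertible_def matrix_inv_def by auto

lemma inverse_vector: "invertible (M :: real ^ 2 ^ 2) \<Longrightarrow> M *v (matrix_inv M *v v) = v"
  by (simp add: matrix_vector_mul_assoc matrix_inv_right)

lemma inverse_vector': "invertible (M :: real ^ 2 ^ 2) \<Longrightarrow> matrix_inv M *v (M *v v) = v"
  by (simp add: matrix_vector_mul_assoc matrix_inv_left)

lemma unimodular_matrix_inv:
  assumes "unimodular M" shows "unimodular (matrix_inv M)"
proof -
  have "det M * det (matrix_inv M) = 1"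
    by (metis assms det_I det_mul matrix_inv_right unimodular_invertible)
  then have "\<bar>det M\<bar> * \<bar>det (matrix_inv M)\<bar> = 1" by (metis abs_1 abs_mult)
  then show ?thesis using assms by (simp add: unimodular_def)
qed

lemma unimodular_mnorm_inv_le:
  assumes "unimodular M" shows "mnorm (matrix_inv M) \<le> mnorm M"
proof (rule mnorm_le[OF mnorm_nonneg])
  fix v
  show "norm (matrix_inv M *v v) \<le> mnorm M * norm v"
    using unimodular_lower[OF assms, of "matrix_inv M *v v"]
    by (simp add: inverse_vector[OF unimodular_invertible[OF assms]])
qed

lemma matrix_inv_eqI:
  assumes "M ** N = mat 1" "N ** (M :: real ^ 2 ^ 2) = mat 1" shows "matrix_inv M = N"
proof -
  have "invertible M" using assms by (auto simp: invertible_def)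
  then have "matrix_inv M ** (M ** N) = N"
    by (simp only: matrix_mul_assoc matrix_inv_left matrix_mul_lid)
  then show ?thesis by (simp only: assms matrix_mul_rid)
qed

lemma matrix_inv_matrix_inv:
  assumes "invertible (M :: real ^ 2 ^ 2)" shows "matrix_inv (matrix_inv M) = M"
  by (rule matrix_inv_eqI) (simp_all add: matrix_inv_left matrix_inv_right assms)

lemma unimodular_mnorm_inv:
  assumes "unimodular M" shows "mnorm (matrix_inv M) = mnorm M"
  using unimodular_mnorm_inv_le[OF assms] unimodular_mnorm_inv_le[OF unimodular_matrix_inv[OF assms]]
  by (simp add: matrix_inv_matrix_inv[OF unimodular_invertible[OF assms]])

section \<open>Cocycles\<close>

lemma shift_funpow: "(shift ^^ m) \<omega> k = \<omega> (k + m)"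
  by (induction m arbitrary: k) (simp_all add: shift_def)

lemma cocycle_add:
  "cocycle A \<omega> (m + n) = cocycle A ((shift ^^ m) \<omega>) n ** cocycle A \<omega> m"
  by (induction n) (simp_all add: shift_funpow matrix_mul_assoc add.commute[of m])

lemma cocycle_Suc_shift: "cocycle A \<omega> (Suc n) = cocycle A (shift \<omega>) n ** A (\<omega> 0)"
  using cocycle_add[of A \<omega> 1 n] by simp

lemma cocycle_fdep: "fdep n (\<lambda>\<omega>. cocycle A \<omega> n)"
proof (induction n)
  case (Suc n)
  show ?case
  proof (rule fdepI)
    fix \<omega> \<omega>' :: "nat \<Rightarrow> 'a" assume e: "\<And>k. k < Suc n \<Longrightarrow> \<omega> k = \<omega>' k"
    then have "cocycle A \<omega> n = cocycle A \<omega>' n" using fdepD[OF Suc, of \<omega> \<omega>'] by simp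
    then show "cocycle A \<omega> (Suc n) = cocycle A \<omega>' (Suc n)" using e by simp
  qed
qed (simp add: fdep_def)

lemma cocycle_unimodular: "(\<And>i. unimodular (A i)) \<Longrightarrow> unimodular (cocycle A \<omega> n)"
  by (induction n) (simp_all add: unimodular_mult unimodular_one)

lemma cocycle_mnorm_le:
  assumes "\<And>i. mnorm (A i) \<le> K" "0 \<le> K" shows "mnorm (cocycle A \<omega> n) \<le> K ^ n"
proof (induction n)
  case (Suc n)
  have "mnorm (cocycle A \<omega> (Suc n)) \<le> mnorm (A (\<omega> n)) * mnorm (cocycle A \<omega> n)"
    by (simp add: mnorm_mult)
  also have "\<dots> \<le> K * K ^ n" by (intro mult_mono Suc assms mnorm_nonneg)
  finally show ?case by simp
next
  case 0
  have "mnorm (cocycle A \<omega> 0) = 1" unfolding cocycle.simps by (rule mnorm_one)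
  then show ?case by (simp del: cocycle.simps)
qed

lemma finite_upper:
  fixes f :: "'n::finite \<Rightarrow> real"
  obtains K where "1 \<le> K" "\<And>i. f i \<le> K"
proof -
  have "f i \<le> max 1 (Max (range f))" for i by (auto intro: Max_ge le_max_iff_disj[THEN iffD2])
  then show ?thesis using that[of "max 1 (Max (range f))"] by simp
qed

section \<open>The logarithmic norm of a cocycle as a subadditive process\<close>

lemma chain_ergodic_system:
  fixes P :: "real ^ 'n::finite ^ 'n"
  assumes P: "stochastic P" and irr: "irreducible_chain P"
  shows "ergodic_system (stationary_chain P) shift"
proof -
  let ?p = "stationary_vector P"
  have p: "prob_vector ?p" and st: "?p v* P = ?p"
    using prob_vector_stationary[OF P irr] stationary_vector_fixed[OF P irr] by auto
  interpret prob_space "stationary_chain P"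
    unfolding stationary_chain_def by (rule prob_space_markov_measure[OF P p])
  have sets: "sets (stationary_chain P) = sets traj"
    unfolding stationary_chain_def by (rule sets_markov_measure[OF P p])
  show ?thesis
  proof
    show "shift \<in> stationary_chain P \<rightarrow>\<^sub>M stationary_chain P"
      using measurable_shift measurable_cong_sets[OF sets sets] by blast
    show "distr (stationary_chain P) (stationary_chain P) shift = stationary_chain P"
      unfolding stationary_chain_def by (rule stationary_shift[OF P p st])
    show "space (stationary_chain P) = UNIV"
      unfolding stationary_chain_def by (rule space_markov_measure[OF P p])
    show "prob E = 0 \<or> prob E = 1" if "E \<in> events" "shift -` E = E" for E
      using ergodic_markov_measure[OF P irr p, of E] that by (simp add: sets stationary_chain_def[symmetric])
  qed
qed

lemma measurable_chain:
  fixes P :: "real ^ 'n::finite ^ 'n"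
  assumes P: "stochastic P" and irr: "irreducible_chain P"
  shows "measurable (stationary_chain P) N = measurable traj N"
  unfolding stationary_chain_def
  by (rule measurable_markov_measure[OF P prob_vector_stationary[OF P irr]])

text \<open>Unimodularity makes the logarithms nonnegative and gives the inverse of a factor the
  norm of the factor. Dropping the initial factor therefore changes the logarithm by at most
  \<open>ln K\<close> in either direction, as \<open>g_shift\<close> demands.\<close>

lemma cocycle_process:
  fixes P :: "real ^ 'n::finite ^ 'n"
  assumes P: "stochastic P" and irr: "irreducible_chain P" and uni: "\<And>i. unimodular (A i)"
  shows "\<exists>K. subadditive_process (stationary_chain P) shift (\<lambda>n \<omega>. ln (mnorm (cocycle A \<omega> n))) K"
proof -
  interpret ergodic_system "stationary_chain P" shift by (rule chain_ergodic_system[OF P irr])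
  obtain K where K: "1 \<le> K" "\<And>i. mnorm (A i) \<le> K" using finite_upper[of "\<lambda>i. mnorm (A i)"] by blast
  have ge: "1 \<le> mnorm (cocycle A \<omega> n)" for \<omega> n
    by (rule unimodular_mnorm_ge[OF cocycle_unimodular[OF uni]])
  have pos: "0 < mnorm (cocycle A \<omega> n)" for \<omega> n using ge[of \<omega> n] by simp
  have lnK: "ln (mnorm (A i)) \<le> ln K" for i
    using K(2)[of i] unimodular_mnorm_ge[OF uni, of i] by simp
  have "subadditive_process (stationary_chain P) shift (\<lambda>n \<omega>. ln (mnorm (cocycle A \<omega> n))) (ln K)"
  proof (unfold_locales, goal_cases)
    case (1 n)
    show ?case unfolding measurable_chain[OF P irr]
      by (rule fdep_borel[OF fdep_comp[OF cocycle_fdep]])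
  next
    case (2 m n \<omega>)
    have "ln (mnorm (cocycle A \<omega> (m + n)))
        \<le> ln (mnorm (cocycle A ((shift ^^ m) \<omega>) n) * mnorm (cocycle A \<omega> m))"
      using mnorm_mult[of "cocycle A ((shift ^^ m) \<omega>) n" "cocycle A \<omega> m"] pos[of \<omega> "m + n"]
      by (simp add: cocycle_add)
    then show ?case using pos[of "(shift ^^ m) \<omega>" n] pos[of \<omega> m] by (simp add: ln_mult)
  next
    case (3 n \<omega>)
    have "ln (mnorm (cocycle A \<omega> n)) \<le> ln (K ^ n)"
      using cocycle_mnorm_le[of A K \<omega> n] K pos[of \<omega> n] by simp
    then show ?case using ge[of \<omega> n] K by (simp add: ln_realpow mult.commute)
  next
    case (4 n \<omega>)
    let ?C = "cocycle A (shift \<omega>) n" and ?B = "A (\<omega> 0)"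
    have iB: "invertible ?B" by (rule unimodular_invertible[OF uni])
    have "mnorm (cocycle A \<omega> (Suc n)) \<le> mnorm ?C * K"
      unfolding cocycle_Suc_shift
      using mnorm_mult[of ?C ?B] mult_left_mono[OF K(2)[of "\<omega> 0"] mnorm_nonneg[of ?C]] by simp
    then have "ln (mnorm (cocycle A \<omega> (Suc n))) \<le> ln (mnorm ?C * K)" using pos[of \<omega> "Suc n"] by (simp del: cocycle.simps)
    then have 1: "ln (mnorm (cocycle A \<omega> (Suc n))) \<le> ln (mnorm ?C) + ln K"
      using K pos[of "shift \<omega>" n] by (simp add: ln_mult del: cocycle.simps)
    have "?C = cocycle A \<omega> (Suc n) ** matrix_inv ?B"
      unfolding cocycle_Suc_shift by (simp add: matrix_inv_right[OF iB] flip: matrix_mul_assoc)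
    then have "mnorm ?C \<le> mnorm (cocycle A \<omega> (Suc n)) * mnorm (matrix_inv ?B)" using mnorm_mult by metis
    also have "\<dots> \<le> mnorm (cocycle A \<omega> (Suc n)) * K"
      using K(2) by (intro mult_left_mono) (simp_all add: unimodular_mnorm_inv[OF uni] mnorm_nonneg)
    finally have "ln (mnorm ?C) \<le> ln (mnorm (cocycle A \<omega> (Suc n)) * K)"
      using pos[of "shift \<omega>" n] by (simp del: cocycle.simps)
    then have "ln (mnorm ?C) \<le> ln (mnorm (cocycle A \<omega> (Suc n))) + ln K"
      using K pos[of \<omega> "Suc n"] by (simp add: ln_mult del: cocycle.simps)
    then show ?case using 1 by simp
  qed
  then show ?thesis by blast
qed

text \<open>The upper Lyapunov exponent of a unimodular pair. As a limit of means it is a number at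
  once; that almost every trajectory has the same rate is \<open>growth_AE\<close>.\<close>

definition growth :: "real ^ 'n::finite ^ 'n \<Rightarrow> ('n \<Rightarrow> real ^ 2 ^ 2) \<Rightarrow> real" where
  "growth P A = lim (\<lambda>n. (\<integral>\<omega>. ln (mnorm (cocycle A \<omega> n)) \<partial>stationary_chain P) / real n)"

lemma
  fixes P :: "real ^ 'n::finite ^ 'n"
  assumes P: "stochastic P" and irr: "irreducible_chain P" and uni: "\<And>i. unimodular (A i)"
  shows growth_AE: "AE \<omega> in stationary_chain P. (\<lambda>n. ln (mnorm (cocycle A \<omega> n)) / real n) \<longlonglongrightarrow> growth P A"
    and growth_mean: "(\<lambda>n. (\<integral>\<omega>. ln (mnorm (cocycle A \<omega> n)) \<partial>stationary_chain P) / real n) \<longlonglongrightarrow> growth P A"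
    and growth_nonneg: "0 \<le> growth P A"
proof -
  obtain K where K: "subadditive_process (stationary_chain P) shift (\<lambda>n \<omega>. ln (mnorm (cocycle A \<omega> n))) K"
    using cocycle_process[of P A] assms by blast
  interpret subadditive_process "stationary_chain P" shift "\<lambda>n \<omega>. ln (mnorm (cocycle A \<omega> n))" K by (rule K)
  have eq: "growth P A = rate" unfolding growth_def by (rule limI[OF mean_rate])
  show "AE \<omega> in stationary_chain P. (\<lambda>n. ln (mnorm (cocycle A \<omega> n)) / real n) \<longlonglongrightarrow> growth P A"
    unfolding eq by (rule AE_rate)
  show m: "(\<lambda>n. (\<integral>\<omega>. ln (mnorm (cocycle A \<omega> n)) \<partial>stationary_chain P) / real n) \<longlonglongrightarrow> growth P A"
    unfolding eq by (rule mean_rate)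
  show "0 \<le> growth P A"
  proof (rule LIMSEQ_le_const[OF m], intro exI[of _ 0] allI impI)
    fix n
    have "0 \<le> ln (mnorm (cocycle A \<omega> n))" for \<omega>
      using unimodular_mnorm_ge[OF cocycle_unimodular[of A \<omega> n, OF uni]] by simp
    then show "0 \<le> (\<integral>\<omega>. ln (mnorm (cocycle A \<omega> n)) \<partial>stationary_chain P) / real n"
      by simp
  qed
qed

text \<open>The constant \<open>c\<close> does not appear in the conclusion: along multiples of \<open>n\<close>, gauges are only compared
  with the norm at both ends.\<close>

lemma growth_le_gauge:
  fixes P :: "real ^ 'n::finite ^ 'n" and N :: "'n \<Rightarrow> real ^ 2 ^ 2"
  assumes P: "stochastic P" and irr: "irreducible_chain P" and uni: "\<And>i. unimodular (A i)"
    and n: "1 \<le> n" and h: "fdep k h"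
    and N: "\<And>i v. norm v \<le> c * norm (N i *v v)" "0 < c"
    and AE_step: "AE \<omega> in stationary_chain P. \<forall>v. norm (N (\<omega> n) *v (cocycle A \<omega> n *v v)) \<le> exp (h \<omega>) * norm (N (\<omega> 0) *v v)"
  shows "growth P A \<le> (\<integral>\<omega>. h \<omega> \<partial>stationary_chain P) / real n"
proof -
  interpret ergodic_system "stationary_chain P" shift by (rule chain_ergodic_system[OF P irr])
  let ?M = "stationary_chain P"
  obtain C where C: "1 \<le> C" "\<And>i. mnorm (N i) \<le> C" using finite_upper[of "\<lambda>i. mnorm (N i)"] by blast
  obtain B where B: "\<And>\<omega>. \<bar>h \<omega>\<bar> \<le> B" using fdep_bounded[OF h] by blast
  have hm: "h \<in> borel_measurable ?M" unfolding measurable_chain[OF P irr] by (rule fdep_borel[OF h])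
  have "AE \<omega> in ?M. \<forall>v. norm (N (((shift ^^ l) \<omega>) n) *v (cocycle A ((shift ^^ l) \<omega>) n *v v))
      \<le> exp (h ((shift ^^ l) \<omega>)) * norm (N (((shift ^^ l) \<omega>) 0) *v v)" for l
  proof -
    \<comment> \<open>Invariance of the law moves the estimate for the block starting at time 0 to
      the block starting at time \<open>l\<close>.\<close>
    have "AE \<omega> in distr ?M ?M (shift ^^ l). \<forall>v. norm (N (\<omega> n) *v (cocycle A \<omega> n *v v)) \<le> exp (h \<omega>) * norm (N (\<omega> 0) *v v)"
      using AE_step by (simp only: Tn_preserves)
    then show ?thesis by (rule AE_distrD[OF Tn_measurable])
  qed
  then have AEl: "AE \<omega> in ?M. \<forall>l. \<forall>v. norm (N (((shift ^^ l) \<omega>) n) *v (cocycle A ((shift ^^ l) \<omega>) n *v v))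
      \<le> exp (h ((shift ^^ l) \<omega>)) * norm (N (((shift ^^ l) \<omega>) 0) *v v)"
    by (simp add: AE_all_countable)
  define H where "H q \<omega> = (\<Sum>l<q. h ((shift ^^ (l * n)) \<omega>))" for q \<omega>
  have Hm: "integrable ?M (\<lambda>\<omega>. h ((shift ^^ l) \<omega>))" for l
    by (rule integrable_bounded[OF measurable_compose[OF Tn_measurable hm] B])
  have EH: "(\<integral>\<omega>. H q \<omega> \<partial>?M) = real q * (\<integral>\<omega>. h \<omega> \<partial>?M)" for q
    unfolding H_def using Hm by (simp add: integral_Tn[OF hm])
  have bound: "AE \<omega> in ?M. ln (mnorm (cocycle A \<omega> (q * n))) \<le> ln (c * C) + H q \<omega>" for q
    using AEl
  proof eventually_elim
    case (elim \<omega>)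
    have it: "norm (N (\<omega> (q * n)) *v (cocycle A \<omega> (q * n) *v v)) \<le> exp (H q \<omega>) * norm (N (\<omega> 0) *v v)" for v
    proof (induction q)
      case (Suc q)
      have e: "cocycle A \<omega> (n + q * n) = cocycle A ((shift ^^ (q * n)) \<omega>) n ** cocycle A \<omega> (q * n)"
        using cocycle_add[of A \<omega> "q * n" n] by (simp add: add.commute)
      have "norm (N (\<omega> (Suc q * n)) *v (cocycle A \<omega> (Suc q * n) *v v))
          \<le> exp (h ((shift ^^ (q * n)) \<omega>)) * norm (N (\<omega> (q * n)) *v (cocycle A \<omega> (q * n) *v v))"
        using elim[rule_format, of "q * n" "cocycle A \<omega> (q * n) *v v"]
        by (simp add: e shift_funpow flip: matrix_vector_mul_assoc)
      also have "\<dots> \<le> exp (h ((shift ^^ (q * n)) \<omega>)) * (exp (H q \<omega>) * norm (N (\<omega> 0) *v v))"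
        by (intro mult_left_mono Suc) simp
      finally show ?case by (simp add: H_def exp_add mult_ac)
    qed (simp add: H_def)
    have "mnorm (cocycle A \<omega> (q * n)) \<le> c * C * exp (H q \<omega>)"
    proof (rule mnorm_le)
      show "0 \<le> c * C * exp (H q \<omega>)" using C N by simp
      fix v
      have "norm (cocycle A \<omega> (q * n) *v v) \<le> c * norm (N (\<omega> (q * n)) *v (cocycle A \<omega> (q * n) *v v))" by (rule N)
      also have "\<dots> \<le> c * (exp (H q \<omega>) * norm (N (\<omega> 0) *v v))"
        using it[of v] N by (intro mult_left_mono) auto
      also have "\<dots> \<le> c * (exp (H q \<omega>) * (C * norm v))"
        using N(2) order_trans[OF mnorm mult_right_mono[OF C(2) norm_ge_zero], of "\<omega> 0" v]
        by (intro mult_left_mono) auto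
      finally show "norm (cocycle A \<omega> (q * n) *v v) \<le> c * C * exp (H q \<omega>) * norm v" by (simp add: mult_ac)
    qed
    moreover have "1 \<le> mnorm (cocycle A \<omega> (q * n))"
      by (rule unimodular_mnorm_ge[OF cocycle_unimodular[OF uni]])
    ultimately have "ln (mnorm (cocycle A \<omega> (q * n))) \<le> ln (c * C * exp (H q \<omega>))" by simp
    also have "\<dots> = ln (c * C) + H q \<omega>" using C N by (subst ln_mult) auto
    finally show ?case .
  qed
  have mean: "(\<integral>\<omega>. ln (mnorm (cocycle A \<omega> (q * n))) \<partial>?M) \<le> ln (c * C) + real q * (\<integral>\<omega>. h \<omega> \<partial>?M)" for q
  proof -
    have fd: "fdep (q * n) (\<lambda>\<omega>. ln (mnorm (cocycle A \<omega> (q * n))))" by (rule fdep_comp[OF cocycle_fdep])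
    obtain B' where "\<And>\<omega>. \<bar>ln (mnorm (cocycle A \<omega> (q * n)))\<bar> \<le> B'" using fdep_bounded[OF fd] by blast
    then have i1: "integrable ?M (\<lambda>\<omega>. ln (mnorm (cocycle A \<omega> (q * n))))"
      using fdep_borel[OF fd] by (intro integrable_bounded) (simp_all add: measurable_chain[OF P irr])
    have i2: "integrable ?M (H q)" unfolding H_def[abs_def] using Hm by simp
    have "(\<integral>\<omega>. ln (mnorm (cocycle A \<omega> (q * n))) \<partial>?M) \<le> (\<integral>\<omega>. ln (c * C) + H q \<omega> \<partial>?M)"
      by (rule integral_mono_AE[OF i1 _ bound]) (use i2 in simp)
    also have "\<dots> = ln (c * C) + (\<integral>\<omega>. H q \<omega> \<partial>?M)" using i2 by (simp add: prob_space)
    finally show ?thesis by (simp add: EH)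
  qed
  \<comment> \<open>\<open>Suc q\<close> avoids an empty family of blocks. The boundary cost
    \<open>ln (c * C)\<close> is divided by the number of blocks and disappears.\<close>
  have "strict_mono (\<lambda>q. Suc q * n)" using n by (auto simp: strict_mono_Suc_iff)
  from LIMSEQ_subseq_LIMSEQ[OF growth_mean[OF P irr uni] this]
  have l1: "(\<lambda>q. (\<integral>\<omega>. ln (mnorm (cocycle A \<omega> (Suc q * n))) \<partial>?M) / real (Suc q * n)) \<longlonglongrightarrow> growth P A"
    by (simp add: o_def)
  have l2: "(\<lambda>q. ln (c * C) / real n * inverse (real (Suc q)) + (\<integral>\<omega>. h \<omega> \<partial>?M) / real n) \<longlonglongrightarrow> ln (c * C) / real n * 0 + (\<integral>\<omega>. h \<omega> \<partial>?M) / real n"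
    by (intro tendsto_intros LIMSEQ_inverse_real_of_nat)
  have "growth P A \<le> ln (c * C) / real n * 0 + (\<integral>\<omega>. h \<omega> \<partial>?M) / real n"
  proof (rule LIMSEQ_le[OF l1 l2], intro exI[of _ 0] allI impI)
    fix q
    have "(\<integral>\<omega>. ln (mnorm (cocycle A \<omega> (Suc q * n))) \<partial>?M) / real (Suc q * n)
        \<le> (ln (c * C) + real (Suc q) * (\<integral>\<omega>. h \<omega> \<partial>?M)) / real (Suc q * n)"
      by (intro divide_right_mono mean) simp
    also have "\<dots> = ln (c * C) / real n * inverse (real (Suc q)) + (\<integral>\<omega>. h \<omega> \<partial>?M) / real n"
    proof -
      have "(a + s * b) / (s * d) = a / d * inverse s + b / d" if "s \<noteq> 0" "d \<noteq> 0" for a b s d :: real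
        using that by (simp add: field_simps)
      then show ?thesis unfolding of_nat_mult using n by (simp del: of_nat_Suc)
    qed
    finally show "(\<integral>\<omega>. ln (mnorm (cocycle A \<omega> (Suc q * n))) \<partial>?M) / real (Suc q * n)
        \<le> ln (c * C) / real n * inverse (real (Suc q)) + (\<integral>\<omega>. h \<omega> \<partial>?M) / real n" .
  qed
  then show ?thesis by simp
qed

section \<open>Zero growth yields an invariant family of finitely additive measures\<close>

text \<open>Boxes suffice as test sets, and the preimage of a box is its image under the inverse
  matrix. This is what makes composition with \<open>M\<close> an isometry of L2.\<close>

lemma lborel_unimodular:
  assumes "unimodular M" shows "distr lborel borel ((*v) M) = (lborel :: (real ^ 2) measure)"
proof (rule lborel_eqI[symmetric])
  fix l u :: "real ^ 2"
  assume lu: "\<And>b. b \<in> Basis \<Longrightarrow> l \<bullet> b \<le> u \<bullet> b"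
  have meas: "(*v) M \<in> borel_measurable borel"
    by (intro borel_measurable_continuous_onI linear_continuous_on bounded_linear_mv)
  have inv: "invertible M" by (rule unimodular_invertible[OF assms])
  have img: "(*v) M -` box l u = (*v) (matrix_inv M) ` box l u"
  proof (intro set_eqI iffI)
    fix x assume "x \<in> (*v) M -` box l u"
    then show "x \<in> (*v) (matrix_inv M) ` box l u"
      by (intro image_eqI[of _ _ "M *v x"]) (simp_all add: inverse_vector'[OF inv])
  qed (auto simp: inverse_vector[OF inv])
  have bd: "bounded ((*v) M -` box l u)"
    unfolding img by (rule bounded_linear_image[OF bounded_box bounded_linear_mv])
  have bs: "(*v) M -` box l u \<in> sets borel"
    using measurable_sets[OF meas, of "box l u"] by simp
  have "measure lebesgue ((*v) M -` box l u) = \<bar>det (matrix ((*v) (matrix_inv M)))\<bar> * measure lebesgue (box l u)"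
    unfolding img by (rule measure_lebesgue_linear_transformation) (auto intro: matrix_vector_mul_linear)
  then have "measure lborel ((*v) M -` box l u) = measure lborel (box l u)"
    using unimodular_matrix_inv[OF assms] bs by (simp add: unimodular_def)
  then have "emeasure lborel ((*v) M -` box l u) = emeasure lborel (box l u)"
    using emeasure_bounded_finite[OF bd] emeasure_bounded_finite[OF bounded_box, of l u]
    by (simp add: emeasure_eq_ennreal_measure less_top)
  then show "emeasure (distr lborel borel ((*v) M)) (box l u) = ennreal (\<Prod>b\<in>Basis. (u - l) \<bullet> b)"
    using lu meas by (simp add: emeasure_distr)
qed simp

lemma mv_measurable: "(*v) (M :: real ^ 2 ^ 2) \<in> borel_measurable borel"
  by (intro borel_measurable_continuous_onI linear_continuous_on bounded_linear_mv)

lemma integral_unimodular: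
  fixes f :: "real ^ 2 \<Rightarrow> real"
  assumes "unimodular M" "f \<in> borel_measurable borel"
  shows "(\<integral>v. f (M *v v) \<partial>lborel) = (\<integral>v. f v \<partial>lborel)"
proof -
  have "(\<integral>v. f v \<partial>distr lborel borel ((*v) M)) = (\<integral>v. f (M *v v) \<partial>lborel)"
    by (rule integral_distr) (use assms mv_measurable in auto)
  then show ?thesis by (simp add: lborel_unimodular[OF assms(1)])
qed

text \<open>A concrete class of square integrable functions, stable under sums, products and
  composition with unimodular matrices; it replaces the Hilbert space by integrals of explicit
  functions.\<close>

definition tame_fn :: "(real ^ 2 \<Rightarrow> real) \<Rightarrow> bool" where
  "tame_fn f \<longleftrightarrow> f \<in> borel_measurable borel \<and> (\<exists>B. \<forall>v. \<bar>f v\<bar> \<le> B) \<and> (\<exists>R. \<forall>v. R < norm v \<longrightarrow> f v = 0)"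

lemma tame_fn_integrable:
  assumes "tame_fn f" shows "integrable lborel f"
proof -
  obtain B R where m: "f \<in> borel_measurable borel" and B: "\<And>v. \<bar>f v\<bar> \<le> B"
    and R: "\<And>v. R < norm v \<Longrightarrow> f v = 0"
    using assms unfolding tame_fn_def by blast
  have "integrable lborel (\<lambda>v :: real ^ 2. B * indicator (cball 0 R) v :: real)"
    using emeasure_lborel_cball_finite[of "0 :: real ^ 2" R]
    by (intro integrable_mult_right integrable_real_indicator) auto
  then show ?thesis
  proof (rule Bochner_Integration.integrable_bound)
    show "AE v in lborel. norm (f v) \<le> norm (B * indicator (cball 0 R) v)"
    proof (rule AE_I2)
      fix v
      show "norm (f v) \<le> norm (B * indicator (cball 0 R) v)"
        using B[of v] R[of v] by (auto simp: indicator_def not_le)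
    qed
  qed (use m in simp)
qed

lemma tame_fn_mult_bounded:
  assumes "tame_fn f" "g \<in> borel_measurable borel" "\<And>v. \<bar>g v\<bar> \<le> C"
  shows "tame_fn (\<lambda>v. g v * f v)"
proof -
  obtain B R where m: "f \<in> borel_measurable borel" and B: "\<And>v. \<bar>f v\<bar> \<le> B"
    and R: "\<And>v. R < norm v \<Longrightarrow> f v = 0"
    using assms(1) unfolding tame_fn_def by blast
  have "\<bar>g v * f v\<bar> \<le> C * B" for v
    using assms(3)[of v] B[of v] by (simp add: abs_mult mult_mono')
  then show ?thesis unfolding tame_fn_def using m assms(2) R
    by (intro conjI, simp, blast, intro exI[of _ R], simp)
qed

lemma tame_fn_mult: "tame_fn f \<Longrightarrow> tame_fn g \<Longrightarrow> tame_fn (\<lambda>v. f v * g v)"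
  using tame_fn_mult_bounded[of g f] unfolding tame_fn_def by blast

lemma tame_fn_add:
  assumes "tame_fn f" "tame_fn g" shows "tame_fn (\<lambda>v. f v + g v)"
proof -
  obtain B R where m: "f \<in> borel_measurable borel" and B: "\<And>v. \<bar>f v\<bar> \<le> B"
    and R: "\<And>v. R < norm v \<Longrightarrow> f v = 0"
    using assms(1) unfolding tame_fn_def by blast
  obtain B' R' where m': "g \<in> borel_measurable borel" and B': "\<And>v. \<bar>g v\<bar> \<le> B'"
    and R': "\<And>v. R' < norm v \<Longrightarrow> g v = 0"
    using assms(2) unfolding tame_fn_def by blast
  have "\<bar>f v + g v\<bar> \<le> B + B'" for v using B[of v] B'[of v] by linarith
  moreover have "\<forall>v. max R R' < norm v \<longrightarrow> f v + g v = 0" using R R' by auto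
  ultimately show ?thesis unfolding tame_fn_def using m m' by (intro conjI, simp, blast, blast)
qed

lemma tame_fn_cmult: "tame_fn f \<Longrightarrow> tame_fn (\<lambda>v. c * f v)"
  using tame_fn_mult_bounded[of f "\<lambda>_. c" "\<bar>c\<bar>"] by simp

lemma tame_fn_diff: "tame_fn f \<Longrightarrow> tame_fn g \<Longrightarrow> tame_fn (\<lambda>v. f v - g v)"
  using tame_fn_add[of f "\<lambda>v. - 1 * g v"] tame_fn_cmult[of g "-1"] by simp

lemma tame_fn_zero: "tame_fn (\<lambda>v. 0)"
  unfolding tame_fn_def by auto

lemma tame_fn_sum: "finite I \<Longrightarrow> (\<And>i. i \<in> I \<Longrightarrow> tame_fn (f i)) \<Longrightarrow> tame_fn (\<lambda>v. \<Sum>i\<in>I. f i v)"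
  by (induction I rule: finite_induct) (simp_all add: tame_fn_zero tame_fn_add)

lemma tame_fn_unimodular:
  assumes f: "tame_fn f" and M: "unimodular M" shows "tame_fn (\<lambda>v. f (M *v v))"
proof -
  obtain B R where m: "f \<in> borel_measurable borel" and B: "\<And>v. \<bar>f v\<bar> \<le> B"
    and R: "\<And>v. R < norm v \<Longrightarrow> f v = 0"
    using f unfolding tame_fn_def by blast
  have pos: "0 < mnorm M" using unimodular_mnorm_ge[OF M] by simp
  have "f (M *v v) = 0" if "mnorm M * R < norm v" for v
  proof (rule R)
    have "mnorm M * R < mnorm M * norm (M *v v)" using that unimodular_lower[OF M, of v] by simp
    then show "R < norm (M *v v)" using pos by simp
  qed
  then show ?thesis unfolding tame_fn_def
    using measurable_compose[OF mv_measurable m] B by blast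
qed

text \<open>Iterates of the averaging operator applied to the indicator of the unit disc. By
  \<open>dens_expect\<close> the value at \<open>v\<close> is the probability, starting at
  \<open>i\<close>, that the \<open>k\<close>-step product maps \<open>v\<close> into the
  disc.\<close>

primrec dens :: "real ^ 'n::finite ^ 'n \<Rightarrow> ('n \<Rightarrow> real ^ 2 ^ 2) \<Rightarrow> nat \<Rightarrow> 'n \<Rightarrow> real ^ 2 \<Rightarrow> real" where
  "dens P A 0 = (\<lambda>i v. indicator (ball 0 1) v)"
| "dens P A (Suc k) = (\<lambda>i v. \<Sum>j\<in>UNIV. P $ i $ j * dens P A k j (A i *v v))"

locale zero_growth =
  fixes P :: "real ^ 'n::finite ^ 'n" and A :: "'n \<Rightarrow> real ^ 2 ^ 2"
  assumes P: "stochastic P" and irr: "irreducible_chain P" and uni: "\<And>i. unimodular (A i)"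
    and zero: "growth P A = 0"
begin

abbreviation p :: "real ^ 'n" where "p \<equiv> stationary_vector P"

lemma p: "prob_vector p" and p_fixed: "p v* P = p"
  using prob_vector_stationary[OF P irr] stationary_vector_fixed[OF P irr] .

lemma p_pos: "0 < p $ i"
  by (rule stationary_positive[OF P irr p p_fixed])

lemma p_sum: "(\<Sum>i\<in>UNIV. p $ i) = 1"
  using p by (simp add: prob_vector_def)

lemma tame_dens: "tame_fn (dens P A k i)"
proof (induction k arbitrary: i)
  case 0
  show ?case unfolding tame_fn_def
    by (auto simp: indicator_def intro!: exI[of _ 1])
next
  case (Suc k)
  show ?case unfolding dens.simps
    by (intro tame_fn_sum tame_fn_cmult tame_fn_unimodular Suc uni) simp
qed

lemma dens_expect:
  "dens P A n i v = expect P i (\<lambda>\<omega>. indicator (ball 0 1) (cocycle A \<omega> n *v v))"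
proof (induction n arbitrary: i v)
  case 0
  have "prob_space (started P i)" by (rule prob_space_started[OF P])
  then show ?case by (simp add: expect_def prob_space.prob_space)
next
  case (Suc n)
  let ?F = "\<lambda>\<omega>. indicator (ball 0 1) (cocycle A \<omega> (Suc n) *v v) :: real"
  have "expect P i ?F = (\<Sum>j\<in>UNIV. P $ i $ j * expect P j (\<lambda>\<omega>. ?F (case_nat i \<omega>)))"
    by (rule expect_step[OF P fdep_borel[OF fdep_comp[OF cocycle_fdep]], where B = 1]) (simp add: indicator_def)
  also have "(\<lambda>\<omega>. ?F (case_nat i \<omega>)) = (\<lambda>\<omega>. indicator (ball 0 1) (cocycle A \<omega> n *v (A i *v v)))"
    unfolding cocycle_Suc_shift by (simp flip: matrix_vector_mul_assoc)
  finally show ?case by (simp add: Suc)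
qed

section \<open>Energy of the iterates and its subexponential decay\<close>

definition energy :: "nat \<Rightarrow> real" where
  "energy k = (\<Sum>i\<in>UNIV. p $ i * (\<integral>v. (dens P A k i v)\<^sup>2 \<partial>lborel))"

lemma tame_square: "tame_fn f \<Longrightarrow> tame_fn (\<lambda>v. (f v)\<^sup>2)"
  unfolding power2_eq_square by (rule tame_fn_mult)

text \<open>The step from \<open>dens k\<close> to \<open>dens (Suc k)\<close> is a conditional expectation composed with isometries
  of \<open>L\<^sup>2\<close>, so the energy lost is the mean conditional variance.\<close>

lemma energy_defect:
  "(\<Sum>i\<in>UNIV. p $ i * (\<Sum>j\<in>UNIV. P $ i $ j *
      (\<integral>v. (dens P A k j (A i *v v) - dens P A (Suc k) i v)\<^sup>2 \<partial>lborel))) = energy k - energy (Suc k)"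
proof -
  let ?f = "dens P A k" and ?g = "dens P A (Suc k)"
  have t1: "tame_fn (\<lambda>v. ?f j (A i *v v))" for i j by (rule tame_fn_unimodular[OF tame_dens uni])
  have t2: "integrable lborel (\<lambda>v. (?f j (A i *v v))\<^sup>2)" for i j
    by (rule tame_fn_integrable[OF tame_square[OF t1]])
  have t3: "integrable lborel (\<lambda>v. (?g i v)\<^sup>2)" for i
    by (rule tame_fn_integrable[OF tame_square[OF tame_dens]])
  have t4: "integrable lborel (\<lambda>v. (?f j (A i *v v) - ?g i v)\<^sup>2)" for i j
    by (rule tame_fn_integrable[OF tame_square[OF tame_fn_diff[OF t1 tame_dens]]])
  have pw: "(\<Sum>j\<in>UNIV. P $ i $ j * (?f j (A i *v v) - ?g i v)\<^sup>2)
      = (\<Sum>j\<in>UNIV. P $ i $ j * (?f j (A i *v v))\<^sup>2) - (?g i v)\<^sup>2" for i v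
  proof -
    have g: "?g i v = (\<Sum>j\<in>UNIV. P $ i $ j * ?f j (A i *v v))" by simp
    have "(\<Sum>j\<in>UNIV. P $ i $ j * (?f j (A i *v v) - ?g i v)\<^sup>2)
        = (\<Sum>j\<in>UNIV. P $ i $ j * (?f j (A i *v v))\<^sup>2 - 2 * ?g i v * (P $ i $ j * ?f j (A i *v v)) + P $ i $ j * (?g i v)\<^sup>2)"
      by (intro sum.cong refl) (simp add: power2_eq_square algebra_simps)
    also have "\<dots> = (\<Sum>j\<in>UNIV. P $ i $ j * (?f j (A i *v v))\<^sup>2) - 2 * ?g i v * ?g i v + (?g i v)\<^sup>2"
      unfolding sum.distrib sum_subtractf sum_distrib_left[symmetric] sum_distrib_right[symmetric] g[symmetric]
      by (simp add: stochastic_sum[OF P])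
    finally show ?thesis by (simp add: power2_eq_square)
  qed
  have row: "(\<Sum>j\<in>UNIV. P $ i $ j * (\<integral>v. (?f j (A i *v v) - ?g i v)\<^sup>2 \<partial>lborel))
      = (\<Sum>j\<in>UNIV. P $ i $ j * (\<integral>v. (?f j v)\<^sup>2 \<partial>lborel)) - (\<integral>v. (?g i v)\<^sup>2 \<partial>lborel)" for i
  proof -
    have cv: "(\<integral>v. (?f j (A i *v v))\<^sup>2 \<partial>lborel) = (\<integral>v. (?f j v)\<^sup>2 \<partial>lborel)" for j
      using tame_square[OF tame_dens[of k j]] by (intro integral_unimodular[OF uni]) (simp add: tame_fn_def)
    have "(\<Sum>j\<in>UNIV. P $ i $ j * (\<integral>v. (?f j (A i *v v) - ?g i v)\<^sup>2 \<partial>lborel))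
        = (\<integral>v. (\<Sum>j\<in>UNIV. P $ i $ j * (?f j (A i *v v) - ?g i v)\<^sup>2) \<partial>lborel)"
      using t4 by (simp del: dens.simps)
    also have "\<dots> = (\<integral>v. (\<Sum>j\<in>UNIV. P $ i $ j * (?f j (A i *v v))\<^sup>2) - (?g i v)\<^sup>2 \<partial>lborel)"
      by (simp only: pw)
    also have "\<dots> = (\<Sum>j\<in>UNIV. P $ i $ j * (\<integral>v. (?f j (A i *v v))\<^sup>2 \<partial>lborel)) - (\<integral>v. (?g i v)\<^sup>2 \<partial>lborel)"
      using t2 t3 by (simp del: dens.simps)
    finally show ?thesis by (simp only: cv)
  qed
  show ?thesis
    unfolding row energy_def by (simp add: right_diff_distrib sum_subtractf stationary_sum[OF p_fixed] del: dens.simps)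
qed

lemma energy_decreasing: "energy (Suc k) \<le> energy k"
proof -
  have "0 \<le> energy k - energy (Suc k)"
    unfolding energy_defect[symmetric] using p_pos stochastic_nonneg[OF P]
    by (intro sum_nonneg mult_nonneg_nonneg) (auto simp: less_imp_le)
  then show ?thesis by simp
qed

definition mean_log :: "nat \<Rightarrow> real" where
  "mean_log n = (\<integral>\<omega>. ln (mnorm (cocycle A \<omega> n)) \<partial>stationary_chain P)"

lemma log_nonneg: "0 \<le> ln (mnorm (cocycle A \<omega> n))"
  using unimodular_mnorm_ge[OF cocycle_unimodular[of A \<omega> n, OF uni]] by simp

lemma mean_log_nonneg: "0 \<le> mean_log n"
  unfolding mean_log_def by (simp add: log_nonneg)

lemma mean_log_over_n: "(\<lambda>n. mean_log n / real n) \<longlonglongrightarrow> 0"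
  using growth_mean[of P A, OF P irr uni] unfolding zero mean_log_def by simp

text \<open>Markov's inequality: the log-norm of the product reaches
  \<open>2 * mean_log n + 1\<close> with probability at most 1/2, and otherwise a vector
  \<open>v\<close> this short stays in the disc. The summand 1 keeps the threshold positive.\<close>

lemma dens_average_lower:
  assumes v: "norm v < exp (- (2 * mean_log n + 1))"
  shows "1 / 2 \<le> (\<Sum>i\<in>UNIV. p $ i * dens P A n i v)"
proof -
  interpret prob_space "stationary_chain P"
    unfolding stationary_chain_def by (rule prob_space_markov_measure[OF P p])
  let ?s = "2 * mean_log n + 1"
  have s: "0 < ?s" using mean_log_nonneg[of n] by simp
  let ?I = "\<lambda>\<omega>. indicator (ball 0 1) (cocycle A \<omega> n *v v) :: real"
  have fd: "fdep n ?I" "fdep n (\<lambda>\<omega>. ln (mnorm (cocycle A \<omega> n)))"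
    by (rule fdep_comp[OF cocycle_fdep])+
  obtain B where B: "\<And>\<omega>. \<bar>ln (mnorm (cocycle A \<omega> n))\<bar> \<le> B" using fdep_bounded[OF fd(2)] by blast
  have int2: "integrable (stationary_chain P) (\<lambda>\<omega>. ln (mnorm (cocycle A \<omega> n)))"
    by (rule integrable_const_bound[where B = B])
      (use fdep_borel[OF fd(2)] B in \<open>auto simp: measurable_chain[OF P irr]\<close>)
  have int1: "integrable (stationary_chain P) ?I"
    by (rule integrable_const_bound[where B = 1])
      (use fdep_borel[OF fd(1)] in \<open>auto simp: measurable_chain[OF P irr] indicator_def\<close>)
  have pw: "1 - ln (mnorm (cocycle A \<omega> n)) / ?s \<le> ?I \<omega>" for \<omega>
  proof (cases "norm (cocycle A \<omega> n *v v) < 1")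
    case True
    then show ?thesis using log_nonneg[of \<omega> n] s by (simp add: dist_norm)
  next
    case False
    let ?m = "mnorm (cocycle A \<omega> n)"
    have m: "1 \<le> ?m" by (rule unimodular_mnorm_ge[OF cocycle_unimodular[of A \<omega> n, OF uni]])
    have "1 \<le> ?m * norm v" using False mnorm[of "cocycle A \<omega> n" v] by simp
    also have "\<dots> \<le> ?m * exp (- ?s)" using v m by (intro mult_left_mono) auto
    finally have "1 \<le> ?m * exp (- ?s)" .
    moreover have "exp s \<le> m" if "1 \<le> m * exp (- s)" for s m :: real
      using that by (simp add: exp_minus field_simps)
    ultimately have "exp ?s \<le> ?m" by blast
    then have "?s \<le> ln ?m" using m by (subst ln_ge_iff) auto
    then have "1 \<le> ln ?m / ?s" using s by simp
    then show ?thesis by (auto simp: indicator_def)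
  qed
  have "1 / 2 \<le> 1 - mean_log n / ?s" using s mean_log_nonneg[of n] by (simp add: field_simps)
  also have "\<dots> = (\<integral>\<omega>. 1 - ln (mnorm (cocycle A \<omega> n)) / ?s \<partial>stationary_chain P)"
    using int2 by (simp add: mean_log_def prob_space)
  also have "\<dots> \<le> (\<integral>\<omega>. ?I \<omega> \<partial>stationary_chain P)"
    by (rule integral_mono[OF _ int1 pw]) (use int2 in simp)
  also have "\<dots> = (\<Sum>i\<in>UNIV. p $ i * dens P A n i v)"
    unfolding dens_expect stationary_chain_def
    by (rule integral_markov_measure_start[OF P p fdep_borel[OF fd(1)], where B = 1]) (simp add: indicator_def)
  finally show ?thesis .
qed

text \<open>On a disc of radius \<open>?r\<close> the average density is at least 1/2, so the
  average square is at least 1/4; the area of the disc supplies the remaining factor.\<close>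

lemma energy_lower: "pi / 4 * exp (- (4 * mean_log n + 2)) \<le> energy n"
proof -
  let ?r = "exp (- (2 * mean_log n + 1))"
  have sq: "integrable lborel (\<lambda>v. (dens P A n i v)\<^sup>2)" for i
    by (rule tame_fn_integrable[OF tame_square[OF tame_dens]])
  have pw: "indicator (ball 0 ?r) v / 4 \<le> (\<Sum>i\<in>UNIV. p $ i * (dens P A n i v)\<^sup>2)" for v
  proof (cases "norm v < ?r")
    case True
    define s where "s = (\<Sum>i\<in>UNIV. p $ i * dens P A n i v)"
    have s: "1 / 2 \<le> s" unfolding s_def by (rule dens_average_lower[OF True])
    \<comment> \<open>Jensen's inequality for the weights \<open>p\<close>, obtained by expanding a
      weighted variance.\<close>
    have "0 \<le> (\<Sum>i\<in>UNIV. p $ i * (dens P A n i v - s)\<^sup>2)"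
      using p_pos by (intro sum_nonneg mult_nonneg_nonneg) (auto simp: less_imp_le)
    also have "\<dots> = (\<Sum>i\<in>UNIV. p $ i * (dens P A n i v)\<^sup>2 - 2 * s * (p $ i * dens P A n i v) + p $ i * s\<^sup>2)"
      by (intro sum.cong refl) (simp add: power2_eq_square algebra_simps)
    also have "\<dots> = (\<Sum>i\<in>UNIV. p $ i * (dens P A n i v)\<^sup>2) - 2 * s * s + s\<^sup>2"
      unfolding sum.distrib sum_subtractf sum_distrib_left[symmetric] sum_distrib_right[symmetric] s_def[symmetric]
      by (simp add: p_sum)
    finally have "s\<^sup>2 \<le> (\<Sum>i\<in>UNIV. p $ i * (dens P A n i v)\<^sup>2)" by (simp add: power2_eq_square)
    moreover have "(1 / 2)\<^sup>2 \<le> s\<^sup>2" using s by (intro power_mono) auto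
    ultimately show ?thesis using True by (simp add: power2_eq_square)
  next
    case False
    have "0 \<le> (\<Sum>i\<in>UNIV. p $ i * (dens P A n i v)\<^sup>2)"
      using p_pos by (intro sum_nonneg mult_nonneg_nonneg) (auto simp: less_imp_le)
    then show ?thesis using False by (simp add: dist_norm)
  qed
  have ib: "integrable lborel (\<lambda>v :: real ^ 2. indicator (ball 0 ?r) v / 4 :: real)"
    using emeasure_bounded_finite[OF bounded_ball, of "0 :: real ^ 2" ?r]
    by (intro integrable_divide integrable_real_indicator) auto
  have "?r\<^sup>2 * pi / 4 = (\<integral>v. indicator (ball 0 ?r) (v :: real ^ 2) / 4 \<partial>lborel)"
    using circle_area[of ?r 0] by simp
  also have "\<dots> \<le> (\<integral>v. (\<Sum>i\<in>UNIV. p $ i * (dens P A n i v)\<^sup>2) \<partial>lborel)"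
    by (rule integral_mono[OF ib _ pw]) (use sq in simp)
  also have "\<dots> = energy n" unfolding energy_def using sq by simp
  finally have "?r\<^sup>2 * pi / 4 \<le> energy n" .
  moreover have "?r\<^sup>2 = exp (- (4 * mean_log n + 2))"
    by (simp add: power2_eq_square algebra_simps flip: exp_add)
  ultimately show ?thesis by (simp add: mult.commute)
qed

lemma energy_pos: "0 < energy n"
proof -
  have "0 < pi / 4 * exp (- (4 * mean_log n + 2))" by simp
  then show ?thesis using energy_lower[of n] by linarith
qed

text \<open>Zero growth enters here: \<open>mean_log n\<close> is \<open>o(n)\<close>, so the energy
  decays subexponentially and the one-step logarithmic losses, which telescope to
  \<open>ln (energy 0 / energy n)\<close>, average to 0.\<close>

lemma energy_log_average: "(\<lambda>n. ln (energy 0 / energy n) / real n) \<longlonglongrightarrow> 0"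
proof (rule tendsto_sandwich)
  have mono: "energy n \<le> energy 0" for n
    by (induction n) (use energy_decreasing order_trans in auto)
  show "\<forall>\<^sub>F n in sequentially. 0 \<le> ln (energy 0 / energy n) / real n"
    using mono energy_pos by (intro always_eventually allI divide_nonneg_nonneg) (auto simp: ln_div)
  define C where "C = ln (energy 0) - ln (pi / 4) + 2"
  show "\<forall>\<^sub>F n in sequentially. ln (energy 0 / energy n) / real n \<le> C / real n + 4 * (mean_log n / real n)"
  proof (intro always_eventually allI)
    fix n
    have "ln (pi / 4 * exp (- (4 * mean_log n + 2))) \<le> ln (energy n)"
      using energy_lower[of n] energy_pos[of n] by simp
    then have "ln (pi / 4) - (4 * mean_log n + 2) \<le> ln (energy n)" by (subst (asm) ln_mult) auto
    then have "ln (energy 0 / energy n) \<le> C + 4 * mean_log n"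
      by (simp add: ln_divide_pos energy_pos C_def)
    then have "ln (energy 0 / energy n) / real n \<le> (C + 4 * mean_log n) / real n"
      by (intro divide_right_mono) auto
    then show "ln (energy 0 / energy n) / real n \<le> C / real n + 4 * (mean_log n / real n)"
      by (simp add: add_divide_distrib)
  qed
  have "(\<lambda>n. C / real n + 4 * (mean_log n / real n)) \<longlonglongrightarrow> 0 + 4 * 0"
    by (intro tendsto_intros lim_const_over_n mean_log_over_n)
  then show "(\<lambda>n. C / real n + 4 * (mean_log n / real n)) \<longlonglongrightarrow> 0" by simp
qed simp

section \<open>Normalized squares and their approximate invariance\<close>

definition mu :: "nat \<Rightarrow> 'n \<Rightarrow> (real ^ 2) set \<Rightarrow> real" where
  "mu k i E = (\<integral>v. indicator E v * (dens P A k i v)\<^sup>2 \<partial>lborel) / energy k"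

text \<open>The least weight of a state or an edge in the stationary sums; it turns bounds for
  weighted sums into bounds for single terms.\<close>

definition edge_const :: real where
  "edge_const = Min ({p $ i |i. True} \<union> {p $ i * P $ i $ j |i j. 0 < P $ i $ j})"

lemma edge_const:
  shows "0 < edge_const" "edge_const \<le> p $ i" "0 < P $ i $ j \<Longrightarrow> edge_const \<le> p $ i * P $ i $ j"
proof -
  let ?S = "{p $ i |i. True} \<union> {p $ i * P $ i $ j |i j. 0 < P $ i $ j}"
  have "{p $ i * P $ i $ j |i j. 0 < P $ i $ j} \<subseteq> (\<lambda>(i, j). p $ i * P $ i $ j) ` UNIV" by auto
  then have "finite {p $ i * P $ i $ j |i j. 0 < P $ i $ j}" by (rule finite_subset) simp
  then have fin: "finite ?S" by (simp add: full_SetCompr_eq)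
  have "?S \<noteq> {}" by blast
  then show "0 < edge_const" unfolding edge_const_def using fin p_pos by (subst Min_gr_iff) auto
  show "edge_const \<le> p $ i" unfolding edge_const_def by (rule Min_le[OF fin]) blast
  show "edge_const \<le> p $ i * P $ i $ j" if "0 < P $ i $ j"
    unfolding edge_const_def by (rule Min_le[OF fin]) (use that in blast)
qed

lemma square_integral_le: "(\<integral>v. (dens P A k i v)\<^sup>2 \<partial>lborel) \<le> energy k / edge_const"
proof -
  have "edge_const * (\<integral>v. (dens P A k i v)\<^sup>2 \<partial>lborel) \<le> p $ i * (\<integral>v. (dens P A k i v)\<^sup>2 \<partial>lborel)"
    by (intro mult_right_mono edge_const) simp
  also have "\<dots> \<le> energy k" unfolding energy_def
    using p_pos by (intro member_le_sum) (auto simp: less_imp_le)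
  finally show ?thesis using edge_const(1) by (simp add: field_simps)
qed

lemma tame_mu: "E \<in> sets borel \<Longrightarrow> tame_fn (\<lambda>v. indicator E v * (dens P A k i v)\<^sup>2)"
  by (rule tame_fn_mult_bounded[OF tame_square[OF tame_dens], where C = 1]) (auto simp: indicator_def)

lemma mu_nonneg: "0 \<le> mu k i E"
  unfolding mu_def using energy_pos[of k] by (simp add: less_imp_le)

lemma mu_le: "E \<in> sets borel \<Longrightarrow> mu k i E \<le> 1 / edge_const"
proof -
  assume E: "E \<in> sets borel"
  have "(\<integral>v. indicator E v * (dens P A k i v)\<^sup>2 \<partial>lborel) \<le> (\<integral>v. (dens P A k i v)\<^sup>2 \<partial>lborel)"
    by (rule integral_mono[OF tame_fn_integrable[OF tame_mu[OF E]] tame_fn_integrable[OF tame_square[OF tame_dens]]])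
      (simp add: indicator_def)
  also have "\<dots> \<le> energy k / edge_const" by (rule square_integral_le)
  finally show ?thesis unfolding mu_def using energy_pos[of k] by (simp add: field_simps)
qed

text \<open>The pullback of \<open>dens P A k j\<close> by \<open>A i\<close> and the function
  \<open>dens P A (Suc k) i\<close> have squared L2 distance at most the energy loss divided by
  \<open>edge_const\<close>. To pass to squares, AM-GM is used with a free parameter
  \<open>t\<close>, which is fixed before the number of averaged steps grows.\<close>

lemma mu_edge:
  assumes ij: "0 < P $ i $ j" and E: "E \<in> sets borel" and t: "0 < t"
  shows "\<bar>mu k j E - mu (Suc k) i ((*v) (A i) -` E)\<bar>
    \<le> ln (energy k / energy (Suc k)) * ((1 / (2 * t) + 1) / edge_const) + 2 * t / edge_const"
proof -
  let ?F = "\<lambda>v. dens P A k j (A i *v v)" and ?G = "dens P A (Suc k) i"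
  let ?a = "energy k" and ?b = "energy (Suc k)" and ?c = edge_const
  let ?I = "\<lambda>v. indicator E (A i *v v) :: real"
  note ba = energy_decreasing[of k] and a = energy_pos[of k] and b = energy_pos[of "Suc k"]
  have tF: "tame_fn ?F" by (rule tame_fn_unimodular[OF tame_dens uni])
  have tG: "tame_fn ?G" by (rule tame_dens)
  have Im: "?I \<in> borel_measurable borel"
    using measurable_compose[OF mv_measurable[of "A i"], of "indicator E :: _ \<Rightarrow> real"] E by simp
  have tIF: "tame_fn (\<lambda>v. ?I v * (?F v)\<^sup>2)" and tIG: "tame_fn (\<lambda>v. ?I v * (?G v)\<^sup>2)"
    using Im by (auto intro!: tame_fn_mult_bounded[where C = 1] tame_square tF tG simp: indicator_def simp del: dens.simps)
  have 1: "mu k j E = (\<integral>v. ?I v * (?F v)\<^sup>2 \<partial>lborel) / ?a"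
    unfolding mu_def using tame_mu[OF E, of k j]
    by (subst integral_unimodular[OF uni[of i], symmetric]) (auto simp: tame_fn_def)
  have 2: "mu (Suc k) i ((*v) (A i) -` E) = (\<integral>v. ?I v * (?G v)\<^sup>2 \<partial>lborel) / ?b"
    unfolding mu_def by (simp add: indicator_def vimage_def del: dens.simps)
  \<comment> \<open>A pointwise majorant: the bracket compares the two squares, and the last term
    accounts for dividing by \<open>energy (Suc k)\<close> instead of
    \<open>energy k\<close>.\<close>
  let ?R = "\<lambda>v. ((1 / (2 * t)) * (?F v - ?G v)\<^sup>2 + t * (?F v)\<^sup>2 + t * (?G v)\<^sup>2) / ?a + (1 / ?b - 1 / ?a) * (?G v)\<^sup>2"
  have tR: "integrable lborel ?R"
    using tame_fn_integrable[OF tame_square[OF tF]] tame_fn_integrable[OF tame_square[OF tG]]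
      tame_fn_integrable[OF tame_square[OF tame_fn_diff[OF tF tG]]]
    by (simp del: dens.simps)
  have pw: "\<bar>?I v * (?F v)\<^sup>2 / ?a - ?I v * (?G v)\<^sup>2 / ?b\<bar> \<le> ?R v" for v
  proof -
    define x y where "x = ?F v" and "y = ?G v"
    have amgm: "\<bar>x\<^sup>2 - y\<^sup>2\<bar> \<le> (1 / (2 * t)) * (x - y)\<^sup>2 + t * x\<^sup>2 + t * y\<^sup>2"
    proof -
      have "\<bar>x\<^sup>2 - y\<^sup>2\<bar> = \<bar>x - y\<bar> * \<bar>x + y\<bar>" by (simp add: power2_eq_square flip: abs_mult) (simp add: algebra_simps)
      also have "\<dots> \<le> (1 / (2 * t)) * (x - y)\<^sup>2 + (t / 2) * (x + y)\<^sup>2"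
      proof -
        have "0 \<le> (\<bar>x - y\<bar> - t * \<bar>x + y\<bar>)\<^sup>2" by simp
        also have "\<dots> = (x - y)\<^sup>2 - 2 * t * (\<bar>x - y\<bar> * \<bar>x + y\<bar>) + t\<^sup>2 * (x + y)\<^sup>2"
          by (simp add: power2_diff power_mult_distrib algebra_simps)
        finally show ?thesis using t by (simp add: field_simps power2_eq_square)
      qed
      also have "(x + y)\<^sup>2 \<le> 2 * x\<^sup>2 + 2 * y\<^sup>2"
        using zero_le_power2[of "x - y"] by (simp add: power2_eq_square algebra_simps)
      finally show ?thesis using t by (simp add: algebra_simps)
    qed
    have split: "x\<^sup>2 / ?a - y\<^sup>2 / ?b = (x\<^sup>2 - y\<^sup>2) / ?a - (1 / ?b - 1 / ?a) * y\<^sup>2"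
      by (simp add: diff_divide_distrib algebra_simps)
    have nn: "0 \<le> 1 / ?b - 1 / ?a" using ba a b by (simp add: frac_le)
    have "\<bar>x\<^sup>2 / ?a - y\<^sup>2 / ?b\<bar> \<le> \<bar>(x\<^sup>2 - y\<^sup>2) / ?a\<bar> + \<bar>(1 / ?b - 1 / ?a) * y\<^sup>2\<bar>"
      unfolding split by (rule abs_triangle_ineq4)
    also have "\<dots> = \<bar>x\<^sup>2 - y\<^sup>2\<bar> / ?a + (1 / ?b - 1 / ?a) * y\<^sup>2"
      using a nn by (simp add: abs_divide abs_mult)
    also have "\<dots> \<le> ((1 / (2 * t)) * (x - y)\<^sup>2 + t * x\<^sup>2 + t * y\<^sup>2) / ?a + (1 / ?b - 1 / ?a) * y\<^sup>2"
      using amgm a by (intro add_right_mono divide_right_mono) auto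
    finally have main: "\<bar>x\<^sup>2 / ?a - y\<^sup>2 / ?b\<bar> \<le> ?R v" unfolding x_def y_def .
    then have "0 \<le> ?R v" by linarith
    then show ?thesis using main unfolding x_def y_def by (cases "A i *v v \<in> E") auto
  qed
  have d: "mu k j E - mu (Suc k) i ((*v) (A i) -` E) = (\<integral>v. ?I v * (?F v)\<^sup>2 / ?a - ?I v * (?G v)\<^sup>2 / ?b \<partial>lborel)"
    unfolding 1 2 using tame_fn_integrable[OF tIF] tame_fn_integrable[OF tIG] by (simp del: dens.simps)
  have "\<bar>mu k j E - mu (Suc k) i ((*v) (A i) -` E)\<bar> \<le> (\<integral>v. \<bar>?I v * (?F v)\<^sup>2 / ?a - ?I v * (?G v)\<^sup>2 / ?b\<bar> \<partial>lborel)"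
    unfolding d by (rule integral_abs_bound)
  also have "\<dots> \<le> (\<integral>v. ?R v \<partial>lborel)"
    by (rule integral_mono[OF _ tR pw])
      (use tame_fn_integrable[OF tIF] tame_fn_integrable[OF tIG] in \<open>simp del: dens.simps\<close>)
  also have "\<dots> = ((1 / (2 * t)) * (\<integral>v. (?F v - ?G v)\<^sup>2 \<partial>lborel) + t * (\<integral>v. (?F v)\<^sup>2 \<partial>lborel)
      + t * (\<integral>v. (?G v)\<^sup>2 \<partial>lborel)) / ?a + (1 / ?b - 1 / ?a) * (\<integral>v. (?G v)\<^sup>2 \<partial>lborel)"
    using tame_fn_integrable[OF tame_square[OF tF]] tame_fn_integrable[OF tame_square[OF tG]]
      tame_fn_integrable[OF tame_square[OF tame_fn_diff[OF tF tG]]]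
    by (simp del: dens.simps)
  also have "\<dots> \<le> ((1 / (2 * t)) * ((?a - ?b) / ?c) + t * (?a / ?c) + t * (?a / ?c)) / ?a + (1 / ?b - 1 / ?a) * (?b / ?c)"
  proof -
    \<comment> \<open>The contribution of the edge from \<open>i\<close> to \<open>j\<close> to the
      energy loss, bounded by the whole loss.\<close>
    have "?c * (\<integral>v. (?F v - ?G v)\<^sup>2 \<partial>lborel) \<le> p $ i * P $ i $ j * (\<integral>v. (?F v - ?G v)\<^sup>2 \<partial>lborel)"
      by (intro mult_right_mono edge_const ij) simp
    also have "\<dots> \<le> p $ i * (\<Sum>j\<in>UNIV. P $ i $ j * (\<integral>v. (dens P A k j (A i *v v) - ?G v)\<^sup>2 \<partial>lborel))"
      unfolding mult.assoc using p_pos stochastic_nonneg[OF P]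
      by (intro mult_left_mono member_le_sum[where f = "\<lambda>j. P $ i $ j * (\<integral>v. (dens P A k j (A i *v v) - ?G v)\<^sup>2 \<partial>lborel)"])
        (auto simp: less_imp_le simp del: dens.simps)
    also have "\<dots> \<le> ?a - ?b" unfolding energy_defect[symmetric] using p_pos stochastic_nonneg[OF P]
      by (intro member_le_sum[where f = "\<lambda>i. p $ i * (\<Sum>j\<in>UNIV. P $ i $ j * (\<integral>v. (dens P A k j (A i *v v) - dens P A (Suc k) i v)\<^sup>2 \<partial>lborel))"])
        (auto intro!: mult_nonneg_nonneg sum_nonneg simp: less_imp_le simp del: dens.simps)
    finally have i1: "(\<integral>v. (?F v - ?G v)\<^sup>2 \<partial>lborel) \<le> (?a - ?b) / ?c" using edge_const(1) by (simp add: field_simps)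
    have "(\<integral>v. (?F v)\<^sup>2 \<partial>lborel) = (\<integral>v. (dens P A k j v)\<^sup>2 \<partial>lborel)"
      using tame_square[OF tame_dens[of k j]] by (intro integral_unimodular[OF uni]) (simp add: tame_fn_def)
    then have i2: "(\<integral>v. (?F v)\<^sup>2 \<partial>lborel) \<le> ?a / ?c" using square_integral_le by simp
    have i3: "(\<integral>v. (?G v)\<^sup>2 \<partial>lborel) \<le> ?b / ?c" by (rule square_integral_le)
    have i4: "(\<integral>v. (?G v)\<^sup>2 \<partial>lborel) \<le> ?a / ?c"
      using i3 ba edge_const(1) by (meson divide_right_mono less_imp_le order_trans)
    have nn: "0 \<le> 1 / ?b - 1 / ?a" using ba a b by (simp add: frac_le)
    show ?thesis using t a i1 i2 i3 i4 nn
      by (intro add_mono divide_right_mono mult_left_mono) auto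
  qed
  also have "\<dots> = (1 - ?b / ?a) * ((1 / (2 * t) + 1) / ?c) + 2 * t / ?c"
    using a b t edge_const(1) by (simp add: field_simps)
  also have "\<dots> \<le> ln (?a / ?b) * ((1 / (2 * t) + 1) / ?c) + 2 * t / ?c"
  proof -
    \<comment> \<open>The relative loss is traded for a logarithm so that the errors telescope over
      \<open>k\<close>.\<close>
    have "ln (?b / ?a) \<le> ?b / ?a - 1" using a b by (intro ln_le_minus_one) simp
    then have "1 - ?b / ?a \<le> ln (?a / ?b)" using a b by (simp add: ln_div)
    then show ?thesis using t edge_const(1) by (intro add_right_mono mult_right_mono) auto
  qed
  finally show ?thesis .
qed

definition avg :: "nat \<Rightarrow> 'n \<Rightarrow> (real ^ 2) set \<Rightarrow> real" where
  "avg n i E = (\<Sum>k<n. mu k i E) / real n"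

text \<open>Summing \<open>mu_edge\<close> over \<open>k\<close>, the logarithms telescope, and
  their average vanishes by \<open>energy_log_average\<close>. The invariance error left over is
  proportional to \<open>t\<close>.\<close>

lemma avg_edge:
  assumes ij: "0 < P $ i $ j" and E: "E \<in> sets borel"
  shows "(\<lambda>n. avg n j E - avg n i ((*v) (A i) -` E)) \<longlonglongrightarrow> 0"
proof (rule LIMSEQ_I)
  fix r :: real assume r: "0 < r"
  let ?E' = "(*v) (A i) -` E" and ?c = edge_const
  have E': "?E' \<in> sets borel" using measurable_sets[OF mv_measurable E] by simp
  \<comment> \<open>With this choice the part of the bound that does not decay in \<open>n\<close>
    is \<open>2 * t / ?c = r / 4\<close>.\<close>
  define t where "t = r * ?c / 8"
  have t: "0 < t" unfolding t_def using r edge_const(1) by simp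
  let ?K = "(1 / (2 * t) + 1) / ?c"
  have bound: "\<bar>avg n j E - avg n i ?E'\<bar> \<le> ln (energy 0 / energy n) / real n * ?K + 2 * t / ?c + (1 / ?c) / real n" if "0 < n" for n
  proof -
    \<comment> \<open>Along the edge the index \<open>k\<close> rises by one; over a whole average
      this shift costs only two boundary terms.\<close>
    have tel: "(\<Sum>k<n. mu k i ?E') = (\<Sum>k<n. mu (Suc k) i ?E') - (mu n i ?E' - mu 0 i ?E')"
      by (induction n) simp_all
    have lns: "(\<Sum>k<n. ln (energy k / energy (Suc k))) = ln (energy 0 / energy n)"
      by (induction n) (simp_all add: ln_divide_pos energy_pos)
    have "\<bar>(\<Sum>k<n. mu k j E) - (\<Sum>k<n. mu k i ?E')\<bar>
        \<le> \<bar>\<Sum>k<n. mu k j E - mu (Suc k) i ?E'\<bar> + \<bar>mu n i ?E' - mu 0 i ?E'\<bar>"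
      unfolding tel sum_subtractf by linarith
    also have "\<bar>\<Sum>k<n. mu k j E - mu (Suc k) i ?E'\<bar> \<le> (\<Sum>k<n. ln (energy k / energy (Suc k)) * ?K + 2 * t / ?c)"
      by (rule sum_abs[THEN order_trans]) (intro sum_mono mu_edge ij E t)
    also have "\<dots> = ln (energy 0 / energy n) * ?K + real n * (2 * t / ?c)"
      by (simp only: sum.distrib sum_distrib_right[symmetric] lns sum_constant card_lessThan)
    also have "\<bar>mu n i ?E' - mu 0 i ?E'\<bar> \<le> 1 / ?c"
      using mu_nonneg[of n i ?E'] mu_nonneg[of 0 i ?E'] mu_le[OF E', of n i] mu_le[OF E', of 0 i] by linarith
    finally have "\<bar>(\<Sum>k<n. mu k j E) - (\<Sum>k<n. mu k i ?E')\<bar> / real n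
        \<le> (ln (energy 0 / energy n) * ?K + real n * (2 * t / ?c) + 1 / ?c) / real n"
      by (intro divide_right_mono) auto
    then show ?thesis using that
      by (simp add: avg_def add_divide_distrib flip: diff_divide_distrib)
  qed
  have "(\<lambda>n. ln (energy 0 / energy n) / real n * ?K + 2 * t / ?c + (1 / ?c) / real n) \<longlonglongrightarrow> 0 * ?K + 2 * t / ?c + 0"
    by (intro tendsto_intros energy_log_average lim_const_over_n)
  moreover have "0 * ?K + 2 * t / ?c + 0 < r" using r edge_const(1) by (simp add: t_def)
  ultimately have "\<forall>\<^sub>F n in sequentially. ln (energy 0 / energy n) / real n * ?K + 2 * t / ?c + (1 / ?c) / real n < r"
    by (rule order_tendstoD(2))
  then have "\<forall>\<^sub>F n in sequentially. norm (avg n j E - avg n i ?E' - 0) < r"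
    using eventually_gt_at_top[of 0]
  proof eventually_elim
    case (elim n)
    from le_less_trans[OF bound[OF elim(2)] elim(1)] show ?case
      by (simp only: real_norm_def diff_zero)
  qed
  then show "\<exists>no. \<forall>n\<ge>no. norm (avg n j E - avg n i ?E' - 0) < r" by (simp add: eventually_sequentially)
qed

lemma mu_Un:
  assumes "E \<in> sets borel" "F \<in> sets borel" "E \<inter> F = {}"
  shows "mu k i (E \<union> F) = mu k i E + mu k i F"
proof -
  have "(\<lambda>v. indicator (E \<union> F) v * (dens P A k i v)\<^sup>2)
      = (\<lambda>v. indicator E v * (dens P A k i v)\<^sup>2 + indicator F v * (dens P A k i v)\<^sup>2)"
    using assms(3) by (auto simp: indicator_def fun_eq_iff)
  then show ?thesis unfolding mu_def
    using tame_fn_integrable[OF tame_mu[OF assms(1)]] tame_fn_integrable[OF tame_mu[OF assms(2)]]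
    by (simp add: add_divide_distrib)
qed

text \<open>Points are Lebesgue null. This is recorded for the limit, where additivity alone would
  not exclude mass at the origin, which has no direction.\<close>

lemma mu_zero: "mu k i {0} = 0"
proof -
  have "(\<integral>v. indicator {0} v * (dens P A k i v)\<^sup>2 \<partial>lborel) = (\<integral>v. 0 \<partial>(lborel :: (real ^ 2) measure))"
  proof (rule integral_cong_AE)
    have "AE v in (lborel :: (real ^ 2) measure). v \<noteq> 0"
      using AE_lborel_singleton[of "0 :: real ^ 2"] .
    then show "AE v in lborel. indicator {0} v * (dens P A k i v)\<^sup>2 = 0"
      by eventually_elim simp
  qed (use tame_mu[of "{0}" k i] in \<open>auto simp: tame_fn_def\<close>)
  then show ?thesis by (simp add: mu_def)
qed

text \<open>The normalization by \<open>energy k\<close> fixes only the \<open>p\<close>-average of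
  the masses; single states may carry different masses before the limit.\<close>

lemma mu_total: "(\<Sum>i\<in>UNIV. p $ i * mu k i UNIV) = 1"
proof -
  have "(\<Sum>i\<in>UNIV. p $ i * mu k i UNIV)
      = (\<Sum>i\<in>UNIV. p $ i * (\<integral>v. (dens P A k i v)\<^sup>2 \<partial>lborel)) / energy k"
    by (simp add: mu_def sum_divide_distrib)
  then show ?thesis unfolding energy_def[symmetric] using energy_pos[of k] by simp
qed

text \<open>A cluster point in a product of intervals over an arbitrary index set, where convergent
  subsequences need not exist. It is delivered as a transfer principle: if \<open>f\<close> is
  continuous at \<open>m\<close> for pointwise convergence and \<open>f (x n)\<close> converges,
  then \<open>f m\<close> is the limit.\<close>

lemma cluster_point:
  fixes x :: "nat \<Rightarrow> 'k \<Rightarrow> real"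
  assumes x: "\<And>n k. x n k \<in> {0..c}"
  obtains m where "\<And>f l. (\<And>F. (\<And>k. ((\<lambda>y. y k) \<longlongrightarrow> m k) F) \<Longrightarrow> (f \<longlongrightarrow> f m) F)
      \<Longrightarrow> (\<lambda>n. f (x n)) \<longlonglongrightarrow> (l :: real) \<Longrightarrow> f m = l"
proof -
  let ?S = "Pi\<^sub>E UNIV (\<lambda>_. {0..c}) :: ('k \<Rightarrow> real) set"
  have "compactin (product_topology (\<lambda>_. euclidean) UNIV) ?S"
    by (subst compactin_PiE) (simp add: compact_Icc)
  then have "compact ?S" by (simp add: euclidean_product_topology)
  moreover have "filtermap x sequentially \<noteq> bot" by (simp add: filtermap_bot_iff)
  moreover have "eventually (\<lambda>y. y \<in> ?S) (filtermap x sequentially)"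
    using x by (auto simp: eventually_filtermap PiE_iff intro!: always_eventually)
  ultimately obtain m where m: "inf (nhds m) (filtermap x sequentially) \<noteq> bot"
    unfolding compact_filter by blast
  show ?thesis
  proof (rule that)
    fix f l
    assume cont: "\<And>F. (\<And>k. ((\<lambda>y. y k) \<longlongrightarrow> m k) F) \<Longrightarrow> (f \<longlongrightarrow> f m) F"
      and lim: "(\<lambda>n. f (x n)) \<longlonglongrightarrow> (l :: real)"
    let ?F = "inf (nhds m) (filtermap x sequentially)"
    have "((\<lambda>y. y k) \<longlongrightarrow> m k) (nhds m)" for k
    proof -
      have "open ((\<lambda>y. y k) -` S)" if "open S" for S :: "real set"
        by (rule open_vimage[OF that continuous_on_product_coordinates])
      then show ?thesis unfolding tendsto_def eventually_nhds by fastforce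
    qed
    then have "(f \<longlongrightarrow> f m) ?F" by (intro cont) (rule tendsto_mono[OF inf_le1])
    moreover have "(f \<longlongrightarrow> l) ?F"
      by (rule tendsto_mono[OF inf_le2]) (use lim in \<open>simp add: filterlim_filtermap\<close>)
    ultimately show "f m = l" by (rule tendsto_unique[OF m])
  qed
qed

text \<open>Tychonoff's theorem replaces weak compactness, so that the limit is only finitely additive.\<close>

lemma invariant_measures:
  obtains m :: "'n \<Rightarrow> (real ^ 2) set \<Rightarrow> real"
  where "\<And>i E. 0 \<le> m i E"
    and "\<And>i E F. E \<in> sets borel \<Longrightarrow> F \<in> sets borel \<Longrightarrow> E \<inter> F = {} \<Longrightarrow> m i (E \<union> F) = m i E + m i F"
    and "\<And>i. m i UNIV = 1" and "\<And>i. m i {0} = 0"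
    and "\<And>i j E. 0 < P $ i $ j \<Longrightarrow> E \<in> sets borel \<Longrightarrow> m j E = m i ((*v) (A i) -` E)"
proof -
  \<comment> \<open>One coordinate for each pair of a state and a set. Sets that are not Borel get
    0, so that all coordinates lie in one compact interval; \<open>Suc n\<close> avoids division by
    0.\<close>
  define x where "x n k = (case k of (i, E) \<Rightarrow> if E \<in> sets borel then avg (Suc n) i E else 0)"
    for n and k :: "'n \<times> (real ^ 2) set"
  have avg: "0 \<le> avg n i E" "E \<in> sets borel \<Longrightarrow> avg n i E \<le> 1 / edge_const" for n i E
  proof -
    show "0 \<le> avg n i E" unfolding avg_def by (intro divide_nonneg_nonneg sum_nonneg mu_nonneg) simp
    assume E: "E \<in> sets borel"
    have "(\<Sum>k<n. mu k i E) \<le> (\<Sum>k<n. 1 / edge_const)" by (intro sum_mono mu_le E)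
    then show "avg n i E \<le> 1 / edge_const" unfolding avg_def
      using edge_const(1) by (cases "n = 0") (simp_all add: field_simps)
  qed
  have "x n k \<in> {0..1 / edge_const}" for n k
    using avg edge_const(1) by (auto simp: x_def split: prod.split)
  then obtain y where y: "\<And>f l. (\<And>F. (\<And>k. ((\<lambda>y. y k) \<longlongrightarrow> y k) F) \<Longrightarrow> (f \<longlongrightarrow> f y) F)
      \<Longrightarrow> (\<lambda>n. f (x n)) \<longlonglongrightarrow> (l :: real) \<Longrightarrow> f y = l"
    using cluster_point[of x "1 / edge_const"] by blast
  \<comment> \<open>The cut at 0 ensures nonnegativity on all sets; on Borel sets it changes
    nothing.\<close>
  define m where "m i E = max 0 (y (i, E))" for i E
  have nn: "0 \<le> y (i, E)" if "E \<in> sets borel" for i E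
  proof -
    have "(\<lambda>z. min 0 (z (i, E))) y = 0"
      by (rule y) (auto intro!: tendsto_intros simp: x_def avg that)
    then show ?thesis by (simp add: min_def split: if_splits)
  qed
  then have my: "m i E = y (i, E)" if "E \<in> sets borel" for i E using that by (simp add: m_def)
  have inv: "m j E = m i ((*v) (A i) -` E)" if ij: "0 < P $ i $ j" and E: "E \<in> sets borel" for i j E
  proof -
    have E': "(*v) (A i) -` E \<in> sets borel" using measurable_sets[OF mv_measurable E] by simp
    have "(\<lambda>z. z (j, E) - z (i, (*v) (A i) -` E)) y = 0"
    proof (rule y)
      show "(\<lambda>n. x n (j, E) - x n (i, (*v) (A i) -` E)) \<longlonglongrightarrow> 0"
        using LIMSEQ_Suc[OF avg_edge[OF ij E]] E E' by (simp add: x_def)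
    qed (auto intro!: tendsto_intros)
    then show ?thesis using E E' by (simp add: my)
  qed
  have tot: "(\<Sum>i\<in>UNIV. p $ i * m i UNIV) = 1"
  proof -
    have "(\<lambda>z. \<Sum>i\<in>UNIV. p $ i * z (i, UNIV)) y = 1"
    proof (rule y)
      have "(\<Sum>i\<in>UNIV. p $ i * avg (Suc n) i UNIV) = 1" for n
      proof -
        have "(\<Sum>i\<in>UNIV. p $ i * avg (Suc n) i UNIV) = (\<Sum>i\<in>UNIV. \<Sum>k<Suc n. p $ i * mu k i UNIV) / real (Suc n)"
          unfolding avg_def by (simp add: sum_divide_distrib sum_distrib_left distrib_left add_divide_distrib del: of_nat_Suc)
        also have "(\<Sum>i\<in>UNIV. \<Sum>k<Suc n. p $ i * mu k i UNIV) = (\<Sum>k<Suc n. \<Sum>i\<in>UNIV. p $ i * mu k i UNIV)"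
          by (rule sum.swap)
        also have "\<dots> = real (Suc n)" by (simp add: mu_total)
        finally show ?thesis by simp
      qed
      then show "(\<lambda>n. \<Sum>i\<in>UNIV. p $ i * x n (i, UNIV)) \<longlonglongrightarrow> 1" by (simp add: x_def)
    qed (auto intro!: tendsto_intros)
    then show ?thesis by (simp add: my)
  qed
  \<comment> \<open>Invariance makes the total mass constant along edges, and irreducibility turns
    average mass 1 into mass 1 at every state.\<close>
  have one: "m i UNIV = 1" for i
  proof -
    have eq: "m a UNIV = m i UNIV" for a
    proof -
      have "a \<in> {a. m a UNIV = m i UNIV}"
      proof (rule irreducible_closed[OF irr, of i])
        fix b d assume "b \<in> {a. m a UNIV = m i UNIV}" "0 < P $ b $ d"
        then show "d \<in> {a. m a UNIV = m i UNIV}" using inv[of b d UNIV] by simp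
      qed simp
      then show ?thesis by (rule CollectD)
    qed
    have "(\<Sum>a\<in>UNIV. p $ a * m i UNIV) = (\<Sum>a\<in>UNIV. p $ a * m a UNIV)"
    proof (rule sum.cong[OF refl])
      fix a show "p $ a * m i UNIV = p $ a * m a UNIV" unfolding eq[of a] ..
    qed
    then have "(\<Sum>a\<in>UNIV. p $ a * m i UNIV) = 1" using tot by (rule trans)
    then show ?thesis by (simp add: p_sum flip: sum_distrib_right)
  qed
  show ?thesis
  proof (rule that[of m])
    show "0 \<le> m i E" for i E by (simp add: m_def)
    show "m i (E \<union> F) = m i E + m i F" if "E \<in> sets borel" "F \<in> sets borel" "E \<inter> F = {}" for i E F
    proof -
      have "(\<lambda>z. z (i, E \<union> F) - z (i, E) - z (i, F)) y = 0"
      proof (rule y)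
        have "avg n i (E \<union> F) = avg n i E + avg n i F" for n
          unfolding avg_def by (simp add: mu_Un[OF that] sum.distrib add_divide_distrib)
        then show "(\<lambda>n. x n (i, E \<union> F) - x n (i, E) - x n (i, F)) \<longlonglongrightarrow> 0" using that by (simp add: x_def)
      qed (auto intro!: tendsto_intros)
      then show ?thesis using that by (simp add: my)
    qed
    show "m i {0} = 0" for i
    proof -
      have "(\<lambda>z. z (i, {0})) y = 0"
        by (rule y) (auto simp: x_def avg_def mu_zero)
      then show ?thesis by (simp add: my)
    qed
  qed (use one inv in auto)
qed

end

section \<open>Invariant lines\<close>

text \<open>Both end states are recorded because such a product carries the measure at the initial
  state to the measure at the final one.\<close>

inductive chain_path :: "real ^ 'n::finite ^ 'n \<Rightarrow> ('n \<Rightarrow> real ^ 2 ^ 2) \<Rightarrow> 'n \<Rightarrow> real ^ 2 ^ 2 \<Rightarrow> 'n \<Rightarrow> bool"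
  for P A where
  path_refl: "chain_path P A i (mat 1) i"
| path_step: "chain_path P A i g j \<Longrightarrow> 0 < P $ j $ k \<Longrightarrow> chain_path P A i (A j ** g) k"

lemma chain_path_cocycle:
  "(\<And>k. k < n \<Longrightarrow> 0 < P $ \<omega> k $ \<omega> (Suc k)) \<Longrightarrow> chain_path P A (\<omega> 0) (cocycle A \<omega> n) (\<omega> n)"
  by (induction n) (auto intro: chain_path.intros)

text \<open>The vectors making with \<open>u\<close> an angle of sine less than \<open>e\<close>.
  Strictness makes the cone open and keeps the origin out. Measures in the plane evaluated on cones
  replace measures on the projective line.\<close>

definition cone :: "real ^ 2 \<Rightarrow> real \<Rightarrow> (real ^ 2) set" where
  "cone u e = {v. \<bar>wedge u v\<bar> < e * norm u * norm v}"

lemma cone_borel: "cone u e \<in> sets borel"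
proof -
  have "open (cone u e)"
    unfolding cone_def wedge_def by (intro open_Collect_less continuous_intros)
  then show ?thesis by simp
qed

lemma cone_scaleR:
  assumes "c \<noteq> 0" shows "cone (c *\<^sub>R u) e = cone u e"
proof -
  have "\<bar>c\<bar> * a < \<bar>c\<bar> * b \<longleftrightarrow> a < b" for a b :: real using assms by simp
  from this[of "\<bar>wedge u v\<bar>" "e * norm u * norm v" for v] show ?thesis
    unfolding cone_def by (simp add: wedge_linear abs_mult mult.assoc mult.left_commute[of e])
qed

text \<open>Cramer's rule: the linear relation between three vectors of the plane.\<close>

lemma wedge_expand: "wedge u w *\<^sub>R v = wedge v w *\<^sub>R u + wedge u v *\<^sub>R w"
  by (simp add: vec_eq_iff forall_2 wedge_def algebra_simps)

locale invariant_family =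
  fixes P :: "real ^ 'n::finite ^ 'n" and A :: "'n \<Rightarrow> real ^ 2 ^ 2"
    and m :: "'n \<Rightarrow> (real ^ 2) set \<Rightarrow> real"
  assumes irr: "irreducible_chain P" and uni: "\<And>i. unimodular (A i)"
    and m_nonneg: "\<And>i E. 0 \<le> m i E"
    and m_Un: "\<And>i E F. E \<in> sets borel \<Longrightarrow> F \<in> sets borel \<Longrightarrow> E \<inter> F = {} \<Longrightarrow> m i (E \<union> F) = m i E + m i F"
    and m_UNIV: "\<And>i. m i UNIV = 1" and m_zero: "\<And>i. m i {0} = 0"
    and m_edge: "\<And>i j E. 0 < P $ i $ j \<Longrightarrow> E \<in> sets borel \<Longrightarrow> m j E = m i ((*v) (A i) -` E)"
begin

lemma m_mono: "E \<in> sets borel \<Longrightarrow> F \<in> sets borel \<Longrightarrow> E \<subseteq> F \<Longrightarrow> m i E \<le> m i F"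
  using m_Un[of E "F - E" i] m_nonneg[of i "F - E"] by (simp add: Un_absorb1)

lemma m_subadd: "E \<in> sets borel \<Longrightarrow> F \<in> sets borel \<Longrightarrow> m i (E \<union> F) \<le> m i E + m i F"
  using m_Un[of E "F - E" i] m_mono[of "F - E" F i] by simp

lemma path_unimodular: "chain_path P A i g j \<Longrightarrow> unimodular g"
  by (induction rule: chain_path.induct) (auto intro: unimodular_one unimodular_mult uni)

lemma m_path: "chain_path P A i g j \<Longrightarrow> E \<in> sets borel \<Longrightarrow> m j E = m i ((*v) g -` E)"
proof (induction arbitrary: E rule: chain_path.induct)
  case (path_refl i)
  then show ?case by simp
next
  case (path_step i g j k)
  have "(*v) (A j) -` E \<in> sets borel" using measurable_sets[OF mv_measurable path_step.prems] by simp
  then have "m k E = m i ((*v) g -` ((*v) (A j) -` E))"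
    using m_edge[OF path_step.hyps(2) path_step.prems] path_step.IH by simp
  also have "(*v) g -` ((*v) (A j) -` E) = (*v) (A j ** g) -` E"
    by (auto simp: matrix_vector_mul_assoc)
  finally show ?case .
qed

text \<open>The threshold exceeds \<open>1 / 3\<close>, so that there are at most two atoms, and is below \<open>1 / 2\<close>, as needed
  in \<open>bounded_or_atom\<close>.\<close>

definition atom :: "'n \<Rightarrow> real ^ 2 \<Rightarrow> bool" where
  "atom i u \<longleftrightarrow> u \<noteq> 0 \<and> (\<forall>e>0. 2 / 5 \<le> m i (cone u e))"

text \<open>A unimodular matrix of norm \<open>?K\<close> changes sines of angles by a factor of at
  most \<open>?K * ?K\<close>, so each cone around the image direction contains the image of a
  smaller cone around \<open>u\<close>.\<close>

lemma atom_edge: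
  assumes a: "atom i u" and ij: "0 < P $ i $ j" shows "atom j (A i *v u)"
  unfolding atom_def
proof (intro conjI allI impI)
  let ?K = "mnorm (A i)"
  have K: "1 \<le> ?K" by (rule unimodular_mnorm_ge[OF uni])
  have low: "norm v \<le> ?K * norm (A i *v v)" for v by (rule unimodular_lower[OF uni])
  show "A i *v u \<noteq> 0" using low[of u] a by (auto simp: atom_def)
  fix e :: real assume e: "0 < e"
  define e' where "e' = e / (?K * ?K)"
  have e': "0 < e'" using e K by (simp add: e'_def)
  have "cone u e' \<subseteq> (*v) (A i) -` cone (A i *v u) e"
  proof
    fix v assume v: "v \<in> cone u e'"
    have "\<bar>wedge (A i *v u) (A i *v v)\<bar> = \<bar>wedge u v\<bar>" by (rule unimodular_wedge[OF uni])
    also have "\<dots> < e' * (norm u * norm v)" using v by (simp add: cone_def mult_ac)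
    also have "\<dots> \<le> e' * ((?K * norm (A i *v u)) * (?K * norm (A i *v v)))"
      using e' K by (intro mult_left_mono mult_mono low) auto
    also have "\<dots> = e * norm (A i *v u) * norm (A i *v v)" using K by (simp add: e'_def)
    finally show "v \<in> (*v) (A i) -` cone (A i *v u) e" by (simp add: cone_def)
  qed
  moreover have "(*v) (A i) -` cone (A i *v u) e \<in> sets borel"
    using measurable_sets[OF mv_measurable cone_borel] by simp
  ultimately have "m i (cone u e') \<le> m j (cone (A i *v u) e)"
    using m_mono[OF cone_borel] m_edge[OF ij cone_borel] by simp
  moreover have "2 / 5 \<le> m i (cone u e')" using a e' by (simp add: atom_def)
  ultimately show "2 / 5 \<le> m j (cone (A i *v u) e)" by simp
qed

text \<open>By \<open>wedge_expand\<close>, a common vector \<open>v\<close> would make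
  \<open>\<bar>wedge u w\<bar> * norm v\<close> smaller than \<open>2 * e * norm v\<close>.\<close>

lemma cone_disjoint:
  assumes "norm u = 1" "norm w = 1" "2 * e \<le> \<bar>wedge u w\<bar>" shows "cone u e \<inter> cone w e = {}"
proof (rule ccontr)
  assume "cone u e \<inter> cone w e \<noteq> {}"
  then obtain v where v: "\<bar>wedge u v\<bar> < e * norm v" "\<bar>wedge w v\<bar> < e * norm v"
    using assms by (auto simp: cone_def)
  have "\<bar>wedge u w\<bar> * norm v = norm (wedge v w *\<^sub>R u + wedge u v *\<^sub>R w)"
    by (simp flip: wedge_expand)
  also have "\<dots> \<le> \<bar>wedge v w\<bar> + \<bar>wedge u v\<bar>"
    using norm_triangle_ineq[of "wedge v w *\<^sub>R u" "wedge u v *\<^sub>R w"] assms by simp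
  also have "\<dots> < 2 * e * norm v" using v wedge_anti[of v w] by simp
  also have "\<dots> \<le> \<bar>wedge u w\<bar> * norm v" using assms by (intro mult_right_mono) auto
  finally show False by simp
qed

lemma atom_scaleR: "atom i u \<Longrightarrow> c \<noteq> 0 \<Longrightarrow> atom i (c *\<^sub>R u)"
  by (simp add: atom_def cone_scaleR)

lemma atom_normalize: "atom i u \<Longrightarrow> atom i (u /\<^sub>R norm u) \<and> norm (u /\<^sub>R norm u) = 1"
  using atom_scaleR[of i u "inverse (norm u)"] by (auto simp: atom_def)

lemma no_three_atoms_unit:
  assumes "atom i u" "atom i v" "atom i w" "norm u = 1" "norm v = 1" "norm w = 1"
  shows "wedge u v = 0 \<or> wedge u w = 0 \<or> wedge v w = 0"
proof (rule ccontr)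
  assume n: "\<not> ?thesis"
  define e where "e = min \<bar>wedge u v\<bar> (min \<bar>wedge u w\<bar> \<bar>wedge v w\<bar>) / 2"
  have e: "0 < e" using n by (simp add: e_def)
  have d: "cone u e \<inter> cone v e = {}" "cone u e \<inter> cone w e = {}" "cone v e \<inter> cone w e = {}"
    by (intro cone_disjoint; use assms in \<open>simp add: e_def\<close>)+
  have "2 / 5 + 2 / 5 + 2 / 5 \<le> m i (cone u e) + m i (cone v e) + m i (cone w e)"
    using assms e by (intro add_mono) (auto simp: atom_def)
  also have "\<dots> = m i (cone u e \<union> cone v e \<union> cone w e)"
    using m_Un[of "cone u e" "cone v e" i] m_Un[of "cone u e \<union> cone v e" "cone w e" i] d cone_borel
    by (simp add: Int_Un_distrib2)
  also have "\<dots> \<le> m i UNIV" by (intro m_mono sets.Un cone_borel) auto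
  finally show False by (simp add: m_UNIV)
qed

lemma no_three_atoms:
  assumes "atom i u" "atom i v" "atom i w"
  shows "wedge u v = 0 \<or> wedge u w = 0 \<or> wedge v w = 0"
proof -
  have "u \<noteq> 0" "v \<noteq> 0" "w \<noteq> 0" using assms by (auto simp: atom_def)
  then show ?thesis
    using no_three_atoms_unit[of i "u /\<^sub>R norm u" "v /\<^sub>R norm v" "w /\<^sub>R norm w"] atom_normalize assms
    by (auto simp: wedge_linear)
qed

text \<open>Compactness of the circle: if ever narrower cones kept mass at least 2/5, a limit of
  their axes would be an atom.\<close>

lemma cone_small_or_atom:
  assumes none: "\<And>u. \<not> atom i u"
  obtains e where "0 < e" "\<And>u. u \<noteq> 0 \<Longrightarrow> m i (cone u e) < 2 / 5"
proof -
  have "\<exists>e>0. \<forall>u. norm u = 1 \<longrightarrow> m i (cone u e) < 2 / 5"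
  proof (rule ccontr)
    assume "\<not> ?thesis"
    then have "\<exists>u. norm u = 1 \<and> 2 / 5 \<le> m i (cone u (inverse (real (Suc k))))" for k
      by (metis inverse_positive_iff_positive not_less of_nat_0_less_iff zero_less_Suc)
    then obtain u where u: "\<And>k. norm (u k) = 1" "\<And>k. 2 / 5 \<le> m i (cone (u k) (inverse (real (Suc k))))"
      by metis
    have "compact (sphere (0 :: real ^ 2) 1)" by simp
    then obtain l r where l: "l \<in> sphere 0 1" and r: "strict_mono r" and lim: "(u \<circ> r) \<longlonglongrightarrow> l"
      using u(1) unfolding compact_def by (metis dist_0_norm mem_sphere)
    have "atom i l" unfolding atom_def
    proof (intro conjI allI impI)
      show "l \<noteq> 0" using l by auto
      fix e :: real assume e: "0 < e"
      have "(\<lambda>k. inverse (real (Suc (r k)))) \<longlonglongrightarrow> 0"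
        using LIMSEQ_subseq_LIMSEQ[OF LIMSEQ_inverse_real_of_nat r] by (simp add: o_def)
      then have "\<forall>\<^sub>F k in sequentially. inverse (real (Suc (r k))) < e / 2"
        by (rule order_tendstoD(2)) (use e in simp)
      moreover have "\<forall>\<^sub>F k in sequentially. dist ((u \<circ> r) k) l < e / 2"
        by (rule tendstoD[OF lim]) (use e in simp)
      ultimately have "\<forall>\<^sub>F k in sequentially. inverse (real (Suc (r k))) < e / 2 \<and> dist ((u \<circ> r) k) l < e / 2"
        by (rule eventually_conj)
      then obtain k where k: "inverse (real (Suc (r k))) < e / 2" "norm (l - u (r k)) < e / 2"
        using eventually_happens'[OF sequentially_bot] by (auto simp: dist_norm norm_minus_commute)
      \<comment> \<open>The opening, below \<open>e / 2\<close>, and the displacement of the axis,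
        below \<open>e / 2\<close>, add up to less than \<open>e\<close>.\<close>
      have "cone (u (r k)) (inverse (real (Suc (r k)))) \<subseteq> cone l e"
      proof
        fix v assume v: "v \<in> cone (u (r k)) (inverse (real (Suc (r k))))"
        then have v0: "0 < norm v" using u by (cases "v = 0") (auto simp: cone_def wedge_def)
        have "\<bar>wedge l v\<bar> \<le> \<bar>wedge (u (r k)) v\<bar> + \<bar>wedge (l - u (r k)) v\<bar>" by (simp add: wedge_linear)
        also have "\<dots> < e / 2 * norm v + e / 2 * norm v"
        proof (rule add_strict_mono)
          show "\<bar>wedge (u (r k)) v\<bar> < e / 2 * norm v"
          proof -
            have "\<bar>wedge (u (r k)) v\<bar> < inverse (real (Suc (r k))) * norm v" using v u by (simp add: cone_def)
            also have "\<dots> < e / 2 * norm v" by (rule mult_strict_right_mono[OF k(1) v0])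
            finally show ?thesis .
          qed
          show "\<bar>wedge (l - u (r k)) v\<bar> < e / 2 * norm v"
            using wedge_le[of "l - u (r k)" v] mult_strict_right_mono[OF k(2) v0] by linarith
        qed
        finally show "v \<in> cone l e" using l by (simp add: cone_def)
      qed
      then show "2 / 5 \<le> m i (cone l e)" using u(2)[of "r k"] m_mono[OF cone_borel cone_borel] order_trans by blast
    qed
    then show False using none by blast
  qed
  then obtain e where e: "0 < e" "\<And>u. norm u = 1 \<Longrightarrow> m i (cone u e) < 2 / 5" by blast
  have "m i (cone u e) < 2 / 5" if "u \<noteq> 0" for u
    using e(2)[of "u /\<^sub>R norm u"] cone_scaleR[of "inverse (norm u)" u e] that by simp
  then show ?thesis using e(1) that by blast
qed

text \<open>A matrix of large norm sends everything outside a thin cone around its contracted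
  direction into a thin cone around its dominant image direction. An almost maximally stretched
  vector \<open>w\<close> takes the place of a singular vector.\<close>

lemma contraction_cones:
  assumes g: "unimodular g" and e: "0 < e" and large: "2 < e * mnorm g"
  obtains u R where "u \<noteq> 0" "R \<noteq> 0" "\<And>v. v \<noteq> 0 \<Longrightarrow> v \<notin> cone u e \<Longrightarrow> g *v v \<in> cone R e"
proof -
  have N1: "1 \<le> mnorm g" by (rule unimodular_mnorm_ge[OF g])
  \<comment> \<open>More than half of the norm is reached by some vector; the 2 in the hypothesis
    \<open>large\<close> pays for this loss.\<close>
  have "\<exists>w. mnorm g / 2 * norm w < norm (g *v w)"
  proof (rule ccontr)
    assume "\<not> ?thesis"
    then have "mnorm g \<le> mnorm g / 2" using N1 by (intro mnorm_le) (auto simp: not_less)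
    then show False using N1 by simp
  qed
  then obtain w where w: "mnorm g / 2 * norm w < norm (g *v w)" by blast
  have w0: "w \<noteq> 0" using w by auto
  have R0: "g *v w \<noteq> 0" using w N1 by (auto simp: mult_less_0_iff)
  define N where "N = norm (g *v w) / norm w"
  have N: "mnorm g / 2 < N" using w w0 by (simp add: N_def field_simps)
  then have Ne: "1 < N * e" using large mult_strict_right_mono[OF N e] by (simp add: mult.commute)
  have Npos: "0 < N" using N N1 by simp
  \<comment> \<open>Pairing with \<open>z\<close> computes the component of \<open>g *v v\<close>
    along \<open>g *v w\<close>; the kernel of this functional, spanned by \<open>perp z\<close>, is
    the contracted direction.\<close>
  define z where "z = transpose g *v (g *v w)"
  have zin: "z \<bullet> v = (g *v w) \<bullet> (g *v v)" for v
    unfolding z_def by (metis dot_lmul_matrix inner_commute transpose_matrix_vector)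
  have "z \<bullet> w = (norm (g *v w))\<^sup>2" by (simp add: zin power2_norm_eq_inner)
  moreover have "z \<bullet> w \<le> norm z * norm w" by (rule norm_cauchy_schwarz)
  ultimately have z: "N * norm (g *v w) \<le> norm z" using w0 by (simp add: N_def field_simps power2_eq_square)
  have gv: "N * \<bar>wedge (perp z) v\<bar> \<le> norm z * norm (g *v v)" for v
  proof -
    have "wedge (perp z) v = - (z \<bullet> v)" by (simp add: wedge_def inner_real2)
    then have "\<bar>wedge (perp z) v\<bar> = \<bar>z \<bullet> v\<bar>" by simp
    also have "\<dots> \<le> norm (g *v w) * norm (g *v v)" unfolding zin by (rule Cauchy_Schwarz_ineq2)
    finally have "N * \<bar>wedge (perp z) v\<bar> \<le> (N * norm (g *v w)) * norm (g *v v)"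
      using Npos by (simp add: mult.assoc)
    also have "\<dots> \<le> norm z * norm (g *v v)" using z by (intro mult_right_mono) auto
    finally show ?thesis .
  qed
  have z0: "0 < norm z" using z Npos R0 by (meson less_le_trans mult_pos_pos zero_less_norm_iff)
  show ?thesis
  proof (rule that[of "perp z" "g *v w"])
    show "perp z \<noteq> 0" using z0 by (metis norm_perp norm_zero less_irrefl)
    show "g *v w \<noteq> 0" by (rule R0)
    fix v assume v: "v \<noteq> 0" "v \<notin> cone (perp z) e"
    have gv0: "0 < norm (g *v v)" using unimodular_lower[OF g, of v] v(1) N1 by (cases "g *v v = 0") auto
    have "N * (e * norm z * norm v) \<le> N * \<bar>wedge (perp z) v\<bar>"
      using v(2) Npos by (intro mult_left_mono) (auto simp: cone_def not_less)
    then have "norm z * (N * e * norm v) \<le> norm z * norm (g *v v)" using gv[of v] by (simp add: mult_ac)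
    then have 1: "N * e * norm v \<le> norm (g *v v)" using z0 by simp
    have "\<bar>wedge (g *v w) (g *v v)\<bar> = \<bar>wedge w v\<bar>" by (rule unimodular_wedge[OF g])
    also have "\<dots> \<le> norm w * norm v" by (rule wedge_le)
    \<comment> \<open>Areas are kept, \<open>w\<close> is stretched by \<open>N\<close> and
      \<open>v\<close> by at least \<open>N * e\<close>; since \<open>1 < N * e\<close>, the sine of
      the angle between the images drops below \<open>e\<close>.\<close>
    also have "\<dots> < norm w * (N * e * (N * e * norm v))"
    proof -
      have 2: "norm v < N * e * norm v" using Ne v(1) by simp
      also have "\<dots> < N * e * (N * e * norm v)"
        by (rule mult_strict_left_mono[OF 2]) (use Ne in simp)
      finally show ?thesis using w0 by simp
    qed
    also have "\<dots> \<le> norm w * (N * e * norm (g *v v))"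
      using 1 Npos e by (intro mult_left_mono) auto
    also have "\<dots> = e * norm (g *v w) * norm (g *v v)" using w0 by (simp add: N_def)
    finally show "g *v v \<in> cone (g *v w) e" by (simp add: cone_def)
  qed
qed

text \<open>Without atoms all cones of some common width \<open>d\<close> have mass below 2/5. A
  path product of norm above \<open>2 / d\<close> would cover the plane by the origin, of mass 0,
  one such cone, and the preimage of another, leaving total mass below 4/5.\<close>

lemma bounded_or_atom:
  "(\<exists>K. \<forall>i g j. chain_path P A i g j \<longrightarrow> mnorm g \<le> K) \<or> (\<exists>i u. atom i u)"
proof (rule disjCI)
  assume "\<not> (\<exists>i u. atom i u)"
  then have "\<exists>e>0. \<forall>u. u \<noteq> 0 \<longrightarrow> m i (cone u e) < 2 / 5" for i
    using cone_small_or_atom[of i] by metis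
  then obtain e where e: "\<And>i. 0 < e i" "\<And>i u. u \<noteq> 0 \<Longrightarrow> m i (cone u (e i)) < 2 / 5" by metis
  define d where "d = Min (range e)"
  have d: "0 < d" unfolding d_def using e by (subst Min_gr_iff) auto
  have de: "d \<le> e i" for i unfolding d_def by (rule Min_le) auto
  have small: "m i (cone u d) < 2 / 5" if "u \<noteq> 0" for i u
  proof -
    have "cone u d \<subseteq> cone u (e i)" unfolding cone_def
      using mult_right_mono[OF de[of i], of "norm u * norm v" for v]
      by (auto simp: mult.assoc intro: less_le_trans)
    then show ?thesis using m_mono[OF cone_borel cone_borel, of u d u "e i" i] e(2)[OF that, of i] by simp
  qed
  have "mnorm g \<le> 2 / d" if path: "chain_path P A i g j" for i g j
  proof (rule ccontr)
    assume "\<not> mnorm g \<le> 2 / d"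
    then have "2 < d * mnorm g" using d by (simp add: not_le field_simps)
    then obtain u R where uR: "u \<noteq> 0" "R \<noteq> 0" "\<And>v. v \<noteq> 0 \<Longrightarrow> v \<notin> cone u d \<Longrightarrow> g *v v \<in> cone R d"
      using contraction_cones[OF path_unimodular[OF path] d] by blast
    have sg: "(*v) g -` cone R d \<in> sets borel" using measurable_sets[OF mv_measurable cone_borel] by simp
    have "1 = m i UNIV" by (simp add: m_UNIV)
    also have "UNIV = ({0} \<union> cone u d) \<union> ((*v) g -` cone R d)" using uR(3) by auto
    also have "m i \<dots> \<le> m i ({0} \<union> cone u d) + m i ((*v) g -` cone R d)"
      by (rule m_subadd) (use cone_borel sg in auto)
    also have "m i ({0} \<union> cone u d) \<le> m i {0} + m i (cone u d)" by (rule m_subadd) (use cone_borel in auto)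
    also have "m i ((*v) g -` cone R d) = m j (cone R d)" by (rule m_path[OF path cone_borel, symmetric])
    finally show False using small[OF uR(1), of i] small[OF uR(2), of j] by (simp add: m_zero)
  qed
  then show "\<exists>K. \<forall>i g j. chain_path P A i g j \<longrightarrow> mnorm g \<le> K" by blast
qed

lemma wedge_zero_trans: "u \<noteq> 0 \<Longrightarrow> wedge v u = 0 \<Longrightarrow> wedge w u = 0 \<Longrightarrow> wedge v w = 0"
  using wedge_expand[of v w u] wedge_anti[of w u] by auto

text \<open>Atoms are carried along edges to atoms, and independent atoms to independent atoms. By
  irreducibility the number of atomic directions, at most two, is the same at every state. With two
  of them, \<open>s\<close> tells whether an edge keeps or exchanges the labels.\<close>

lemma invariant_lines:
  obtains (bounded) K where "\<And>i g j. chain_path P A i g j \<Longrightarrow> mnorm g \<le> K"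
  | (line) u where "\<And>i. norm (u i) = 1" "\<And>i j. 0 < P $ i $ j \<Longrightarrow> wedge (A i *v u i) (u j) = 0"
  | (two_lines) u where "\<And>i b. norm (u i b) = 1" "\<And>i. wedge (u i True) (u i False) \<noteq> 0"
      "\<And>i j. 0 < P $ i $ j \<Longrightarrow> \<exists>s. \<forall>b. wedge (A i *v u i b) (u j (b \<noteq> s)) = 0"
proof (cases "\<exists>i u. atom i u")
  case False
  then show ?thesis using bounded_or_atom bounded by blast
next
  case True
  then obtain i0 u0 where "atom i0 u0" by blast
  have ex: "\<exists>u. atom i u" for i
  proof -
    have "i \<in> {i. \<exists>u. atom i u}"
      by (rule irreducible_closed[OF irr, of i0]) (use \<open>atom i0 u0\<close> atom_edge in blast)+
    then show ?thesis by simp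
  qed
  show ?thesis
  proof (cases "\<exists>i u w. atom i u \<and> atom i w \<and> wedge u w \<noteq> 0")
    case False
    have "\<exists>u. atom i u \<and> norm u = 1" for i using ex atom_normalize by blast
    then obtain u where u: "\<And>i. atom i (u i)" "\<And>i. norm (u i) = 1" by metis
    show ?thesis
    proof (rule line[of u])
      show "wedge (A i *v u i) (u j) = 0" if "0 < P $ i $ j" for i j
        using False atom_edge[OF u(1) that] u(1) by blast
    qed (rule u)
  next
    case True
    then obtain i1 where i1: "\<exists>u w. atom i1 u \<and> atom i1 w \<and> wedge u w \<noteq> 0" by blast
    have w_edge: "wedge (A i *v u) (A i *v w) \<noteq> 0 \<longleftrightarrow> wedge u w \<noteq> 0" for i u w
      using unimodular_wedge[OF uni[of i], of u w] by auto
    have two: "\<exists>u w. atom i u \<and> atom i w \<and> wedge u w \<noteq> 0" for i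
    proof -
      have "i \<in> {i. \<exists>u w. atom i u \<and> atom i w \<and> wedge u w \<noteq> 0}"
      proof (rule irreducible_closed[OF irr, of i1])
        fix i j assume "i \<in> {i. \<exists>u w. atom i u \<and> atom i w \<and> wedge u w \<noteq> 0}" and ij: "0 < P $ i $ j"
        then obtain u w where "atom i u" "atom i w" "wedge u w \<noteq> 0" by blast
        then show "j \<in> {i. \<exists>u w. atom i u \<and> atom i w \<and> wedge u w \<noteq> 0}"
          using atom_edge[OF _ ij] w_edge by blast
      qed (use i1 in simp)
      then show ?thesis by simp
    qed
    have "\<exists>u w. atom i u \<and> atom i w \<and> norm u = 1 \<and> norm w = 1 \<and> wedge u w \<noteq> 0" for i
    proof -
      obtain u w where uw: "atom i u" "atom i w" "wedge u w \<noteq> 0" using two by blast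
      then have "u \<noteq> 0" "w \<noteq> 0" by (auto simp: atom_def)
      then have "wedge (u /\<^sub>R norm u) (w /\<^sub>R norm w) \<noteq> 0" using uw by (simp add: wedge_linear)
      then show ?thesis using atom_normalize uw by blast
    qed
    then obtain u w where uw: "\<And>i. atom i (u i)" "\<And>i. atom i (w i)" "\<And>i. norm (u i) = 1"
      "\<And>i. norm (w i) = 1" "\<And>i. wedge (u i) (w i) \<noteq> 0" by metis
    define x where "x i b = (if b then u i else w i)" for i and b :: bool
    have xa: "atom i (x i b)" for i b using uw by (simp add: x_def)
    have xn: "norm (x i b) = 1" for i b using uw by (simp add: x_def)
    have xw: "wedge (x i True) (x i False) \<noteq> 0" for i using uw by (simp add: x_def)
    show ?thesis
    proof (rule two_lines[of x])
      fix i j assume ij: "0 < P $ i $ j"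
      have img: "atom j (A i *v x i b)" for b by (rule atom_edge[OF xa ij])
      have par: "wedge (A i *v x i b) (x j True) = 0 \<or> wedge (A i *v x i b) (x j False) = 0" for b
        using no_three_atoms[OF img[of b] xa[of j True] xa[of j False]] xw by blast
      have nz: "x j b \<noteq> 0" for b using xn[of j b] by auto
      \<comment> \<open>The images of the two lines are independent, so they cannot both be parallel
        to the same line: the induced map of labels is a bijection.\<close>
      have npar: "wedge (A i *v x i True) (x j b) \<noteq> 0 \<or> wedge (A i *v x i False) (x j b) \<noteq> 0" for b
        using wedge_zero_trans[OF nz[of b], of "A i *v x i True" "A i *v x i False"] w_edge[of i "x i True" "x i False"] xw
        by blast
      show "\<exists>s. \<forall>b. wedge (A i *v x i b) (x j (b \<noteq> s)) = 0"
      proof (cases "wedge (A i *v x i True) (x j True) = 0")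
        case True
        then have "wedge (A i *v x i False) (x j False) = 0" using par[of False] npar[of True] by blast
        then show ?thesis using True by (intro exI[of _ False]) (metis (full_types))
      next
        case False
        then have "wedge (A i *v x i True) (x j False) = 0" using par[of True] by blast
        moreover have "wedge (A i *v x i False) (x j True) = 0"
          using par[of False] npar[of False] calculation by blast
        ultimately show ?thesis by (intro exI[of _ True]) (metis (full_types))
      qed
    qed (use xn xw in auto)
  qed
qed

end

section \<open>Signed sums along the chain\<close>

lemma expect_integrable:
  fixes F :: "(nat \<Rightarrow> 'n::finite) \<Rightarrow> real"
  assumes P: "stochastic P" and F: "fdep n F" shows "integrable (started P i) F"
proof -
  interpret prob_space "started P i" by (rule prob_space_started[OF P])
  obtain B where "\<And>\<omega>. \<bar>F \<omega>\<bar> \<le> B" using fdep_bounded[OF F] by blast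
  moreover have "F \<in> borel_measurable (started P i)"
    using fdep_borel[OF F] measurable_cong_sets[OF sets_started refl] by blast
  ultimately show ?thesis by (intro integrable_const_bound[where B = B]) auto
qed

lemma expect_const: "stochastic P \<Longrightarrow> expect P i (\<lambda>_. c) = c"
  using prob_space.prob_space[OF prob_space_started[of P i]] by (simp add: expect_def)

lemma expect_mono:
  assumes "stochastic P" "fdep n F" "fdep n G" "\<And>\<omega>. F \<omega> \<le> G \<omega>"
  shows "expect P i F \<le> expect P i G"
  unfolding expect_def by (rule integral_mono) (use assms expect_integrable in auto)

lemma expect_affine:
  assumes P: "stochastic P" and F: "fdep n F" shows "expect P i (\<lambda>\<omega>. a * F \<omega> + b) = a * expect P i F + b"
proof -
  interpret prob_space "started P i" by (rule prob_space_started[OF P])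
  show ?thesis unfolding expect_def using expect_integrable[OF P F, of i] by (simp add: prob_space)
qed

lemma expect_step_fdep:
  assumes P: "stochastic P" and F: "fdep n F"
  shows "expect P i F = (\<Sum>j\<in>UNIV. P $ i $ j * expect P j (\<lambda>\<omega>. F (case_nat i \<omega>)))"
proof -
  obtain B where "\<And>\<omega>. \<bar>F \<omega>\<bar> \<le> B" using fdep_bounded[OF F] by blast
  then show ?thesis by (rule expect_step[OF P fdep_borel[OF F]])
qed

lemma fdep_prepend: "fdep (Suc n) F \<Longrightarrow> fdep n (\<lambda>\<omega>. F (case_nat i \<omega>))"
  unfolding fdep_def by (auto split: nat.split)

lemma expect_start_cong:
  assumes P: "stochastic P" and F: "fdep n F" and G: "fdep n G" and eq: "\<And>\<omega>. \<omega> 0 = i \<Longrightarrow> F \<omega> = G \<omega>"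
  shows "expect P i F = expect P i G"
proof -
  have "expect P i H = (\<integral>\<omega>. H (case_nat i \<omega>) \<partial>markov_measure P (P $ i))" if "fdep n H" for H
    unfolding expect_def started_def
    by (rule integral_distr[OF measurable_prepend_markov_measure[OF P stochasticD[OF P]] fdep_borel[OF that]])
  then show ?thesis using F G eq by simp
qed

text \<open>Unfolded, this is the sum over \<open>k < n\<close> of
  \<open>\<phi> (\<omega> k)\<close> times the product of the signs of the preceding edges, plus a
  signed terminal term \<open>g (\<omega> n)\<close>. Recursion from the front fits first-step
  analysis.\<close>

primrec signed_sum :: "('n \<Rightarrow> 'n \<Rightarrow> real) \<Rightarrow> ('n \<Rightarrow> real) \<Rightarrow> ('n \<Rightarrow> real) \<Rightarrow> nat \<Rightarrow> (nat \<Rightarrow> 'n) \<Rightarrow> real" where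
  "signed_sum \<epsilon> \<phi> g 0 \<omega> = g (\<omega> 0)"
| "signed_sum \<epsilon> \<phi> g (Suc n) \<omega> = \<phi> (\<omega> 0) + \<epsilon> (\<omega> 0) (\<omega> 1) * signed_sum \<epsilon> \<phi> g n (shift \<omega>)"

lemma signed_sum_fdep: "fdep (Suc n) (signed_sum \<epsilon> \<phi> g n)"
proof (induction n)
  case (Suc n)
  show ?case
  proof (rule fdepI)
    fix \<omega> \<omega>' :: "nat \<Rightarrow> 'a" assume e: "\<And>k. k < Suc (Suc n) \<Longrightarrow> \<omega> k = \<omega>' k"
    then have "signed_sum \<epsilon> \<phi> g n (shift \<omega>) = signed_sum \<epsilon> \<phi> g n (shift \<omega>')"
      by (intro fdepD[OF Suc]) (simp add: shift_def)
    then show "signed_sum \<epsilon> \<phi> g (Suc n) \<omega> = signed_sum \<epsilon> \<phi> g (Suc n) \<omega>'" using e by simp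
  qed
qed (simp add: fdep_def)

text \<open>If \<open>g\<close> solves the twisted Poisson equation, \<open>signed_sum \<epsilon> \<phi> g n\<close> is a martingale in \<open>n\<close>.\<close>

lemma signed_sum_second_moment:
  fixes P :: "real ^ 'n::finite ^ 'n"
  assumes P: "stochastic P" and \<epsilon>: "\<And>i j. \<epsilon> i j = 1 \<or> \<epsilon> i j = -1"
    and g: "\<And>i. \<phi> i = g i - (\<Sum>j\<in>UNIV. P $ i $ j * (\<epsilon> i j * g j))" and B: "\<And>i. \<bar>g i\<bar> \<le> B"
  shows "expect P i (\<lambda>\<omega>. (s + signed_sum \<epsilon> \<phi> g n \<omega>)\<^sup>2) \<le> (s + g i)\<^sup>2 + real n * B\<^sup>2"
\<comment> \<open>The offset \<open>s\<close> is generalized because the first step adds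
  \<open>\<phi> i\<close> to it and may flip its sign.\<close>
proof (induction n arbitrary: i s)
  case 0
  have "expect P i (\<lambda>\<omega>. (s + signed_sum \<epsilon> \<phi> g 0 \<omega>)\<^sup>2) = expect P i (\<lambda>\<omega>. (s + g i)\<^sup>2)"
    by (rule expect_start_cong[OF P, where n = 1]) (auto simp: fdep_def)
  then show ?case by (simp add: expect_const[OF P])
next
  case (Suc n)
  have e2: "(\<epsilon> i j)\<^sup>2 = 1" for i j using \<epsilon>[of i j] by auto
  let ?x = "s + \<phi> i"
  have fd: "fdep (Suc (Suc n)) (\<lambda>\<omega>. (s + signed_sum \<epsilon> \<phi> g (Suc n) \<omega>)\<^sup>2)"
    by (rule fdep_comp[OF signed_sum_fdep])
  have fd': "fdep (Suc n) (\<lambda>\<omega>. (\<epsilon> i j * ?x + signed_sum \<epsilon> \<phi> g n \<omega>)\<^sup>2)" for j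
    by (rule fdep_comp[OF signed_sum_fdep])
  have step: "expect P j (\<lambda>\<omega>. (s + signed_sum \<epsilon> \<phi> g (Suc n) (case_nat i \<omega>))\<^sup>2)
      \<le> (\<epsilon> i j * ?x + g j)\<^sup>2 + real n * B\<^sup>2" for j
  proof -
    have "expect P j (\<lambda>\<omega>. (s + signed_sum \<epsilon> \<phi> g (Suc n) (case_nat i \<omega>))\<^sup>2)
        = expect P j (\<lambda>\<omega>. (\<epsilon> i j * ?x + signed_sum \<epsilon> \<phi> g n \<omega>)\<^sup>2)"
    proof (rule expect_start_cong[OF P fdep_prepend[OF fd] fd'])
      fix \<omega> :: "nat \<Rightarrow> 'n" assume j: "\<omega> 0 = j"
      have "(s + signed_sum \<epsilon> \<phi> g (Suc n) (case_nat i \<omega>)) = ?x + \<epsilon> i j * signed_sum \<epsilon> \<phi> g n \<omega>"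
        using j by simp
      \<comment> \<open>A square does not see a common sign, so the sign of the edge can be moved to
        the offset.\<close>
      moreover have "(?x + \<epsilon> i j * q)\<^sup>2 = (\<epsilon> i j * ?x + q)\<^sup>2" for q
        using \<epsilon>[of i j] by (auto simp: power2_eq_square algebra_simps)
      ultimately show "(s + signed_sum \<epsilon> \<phi> g (Suc n) (case_nat i \<omega>))\<^sup>2 = (\<epsilon> i j * ?x + signed_sum \<epsilon> \<phi> g n \<omega>)\<^sup>2"
        by (simp only:)
    qed
    then show ?thesis using Suc by simp
  qed
  define y where "y j = \<epsilon> i j * g j" for j
  define m where "m = (\<Sum>j\<in>UNIV. P $ i $ j * y j)"
  have m: "\<phi> i + m = g i" using g[of i] by (simp add: m_def y_def)
  have y2: "(y j)\<^sup>2 \<le> B\<^sup>2" for j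
  proof -
    have "(y j)\<^sup>2 = \<bar>g j\<bar>\<^sup>2" by (simp add: y_def power_mult_distrib e2)
    also have "\<dots> \<le> B\<^sup>2" using B[of j] by (intro power_mono) auto
    finally show ?thesis .
  qed
  have "expect P i (\<lambda>\<omega>. (s + signed_sum \<epsilon> \<phi> g (Suc n) \<omega>)\<^sup>2)
      \<le> (\<Sum>j\<in>UNIV. P $ i $ j * ((\<epsilon> i j * ?x + g j)\<^sup>2 + real n * B\<^sup>2))"
    unfolding expect_step_fdep[OF P fd]
    by (intro sum_mono mult_left_mono step stochastic_nonneg[OF P])
  also have "\<dots> = (\<Sum>j\<in>UNIV. P $ i $ j * (?x + y j)\<^sup>2) + real n * B\<^sup>2"
  proof -
    have "(\<epsilon> i j * ?x + g j)\<^sup>2 = (?x + y j)\<^sup>2" for j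
      using \<epsilon>[of i j] by (auto simp: y_def power2_eq_square algebra_simps)
    then show ?thesis
      by (simp add: distrib_left sum.distrib stochastic_sum[OF P] flip: sum_distrib_right)
  qed
  also have "(\<Sum>j\<in>UNIV. P $ i $ j * (?x + y j)\<^sup>2) = ?x\<^sup>2 + 2 * ?x * m + (\<Sum>j\<in>UNIV. P $ i $ j * (y j)\<^sup>2)"
  proof -
    have "(\<Sum>j\<in>UNIV. P $ i $ j * (?x + y j)\<^sup>2)
        = (\<Sum>j\<in>UNIV. P $ i $ j * ?x\<^sup>2 + 2 * ?x * (P $ i $ j * y j) + P $ i $ j * (y j)\<^sup>2)"
      by (intro sum.cong refl) (simp add: power2_eq_square algebra_simps)
    then show ?thesis unfolding sum.distrib sum_distrib_left[symmetric] sum_distrib_right[symmetric] m_def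
      by (simp add: stochastic_sum[OF P])
  qed
  also have "(\<Sum>j\<in>UNIV. P $ i $ j * (y j)\<^sup>2) \<le> (\<Sum>j\<in>UNIV. P $ i $ j * B\<^sup>2)"
    by (intro sum_mono mult_left_mono y2 stochastic_nonneg[OF P])
  also have "\<dots> = B\<^sup>2" by (simp add: stochastic_sum[OF P] flip: sum_distrib_right)
  also have "?x\<^sup>2 + 2 * ?x * m + B\<^sup>2 + real n * B\<^sup>2 \<le> (s + g i)\<^sup>2 + real (Suc n) * B\<^sup>2"
  proof -
    \<comment> \<open>Completing the square: \<open>?x + m\<close> is \<open>s + g i\<close> by the
      equation for \<open>g\<close>, so the cross term is absorbed and a step costs only
      \<open>B\<^sup>2\<close>.\<close>
    have "?x\<^sup>2 + 2 * ?x * m \<le> (?x + m)\<^sup>2" by (simp add: power2_sum)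
    also have "?x + m = s + g i" using m by simp
    finally show ?thesis by (simp add: algebra_simps)
  qed
  finally show ?case by simp
qed

lemma signed_sum_drop_end:
  assumes \<epsilon>: "\<And>i j. \<epsilon> i j = 1 \<or> \<epsilon> i j = -1" and B: "\<And>i. \<bar>g i\<bar> \<le> B"
  shows "\<bar>signed_sum \<epsilon> \<phi> g n \<omega> - signed_sum \<epsilon> \<phi> (\<lambda>_. 0) n \<omega>\<bar> \<le> B"
proof (induction n arbitrary: \<omega>)
  case 0
  then show ?case using B by simp
next
  case (Suc n)
  have "\<bar>signed_sum \<epsilon> \<phi> g (Suc n) \<omega> - signed_sum \<epsilon> \<phi> (\<lambda>_. 0) (Suc n) \<omega>\<bar>
      = \<bar>signed_sum \<epsilon> \<phi> g n (shift \<omega>) - signed_sum \<epsilon> \<phi> (\<lambda>_. 0) n (shift \<omega>)\<bar>"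
    using \<epsilon>[of "\<omega> 0" "\<omega> 1"] by auto
  then show ?case using Suc[of "shift \<omega>"] by simp
qed

text \<open>The first moment is bounded through
  \<open>\<bar>y\<bar> \<le> y\<^sup>2 / (2 * r) + r / 2\<close> with \<open>r = sqrt n\<close>,
  since the second moment of the martingale is linear in \<open>n\<close>; dropping the terminal
  term costs a bounded amount.\<close>

lemma signed_sum_mean_abs:
  fixes P :: "real ^ 'n::finite ^ 'n"
  assumes P: "stochastic P" and \<epsilon>: "\<And>i j. \<epsilon> i j = 1 \<or> \<epsilon> i j = -1"
    and g: "\<And>i. \<phi> i = g i - (\<Sum>j\<in>UNIV. P $ i $ j * (\<epsilon> i j * g j))"
  obtains c where "0 < c"
    "\<And>i n. 1 \<le> n \<Longrightarrow> expect P i (\<lambda>\<omega>. \<bar>signed_sum \<epsilon> \<phi> (\<lambda>_. 0) n \<omega>\<bar>) \<le> c * sqrt (real n)"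
proof -
  obtain B where B: "1 \<le> B" "\<And>i. \<bar>g i\<bar> \<le> B" using finite_upper[of "\<lambda>i. \<bar>g i\<bar>"] by blast
  let ?S = "signed_sum \<epsilon> \<phi> g" and ?Z = "signed_sum \<epsilon> \<phi> (\<lambda>_. 0)"
  show ?thesis
  proof (rule that[of "B\<^sup>2 + B + 1"])
    show "0 < B\<^sup>2 + B + 1" using B(1) by (intro add_nonneg_pos add_nonneg_nonneg) auto
    fix i n assume n: "1 \<le> (n :: nat)"
    let ?r = "sqrt (real n)"
    have r: "1 \<le> ?r" "?r * ?r = real n" using n by auto
    have pw: "\<bar>?Z n \<omega>\<bar> \<le> (1 / (2 * ?r)) * (0 + ?S n \<omega>)\<^sup>2 + (?r / 2 + B)" for \<omega>
    proof -
      have "\<bar>?Z n \<omega>\<bar> \<le> \<bar>?S n \<omega>\<bar> + B" using signed_sum_drop_end[of \<epsilon> g B \<phi> n \<omega>] \<epsilon> B by fastforce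
      moreover have "0 \<le> (\<bar>?S n \<omega>\<bar> - ?r)\<^sup>2" by simp
      then have "2 * ?r * \<bar>?S n \<omega>\<bar> \<le> (?S n \<omega>)\<^sup>2 + ?r * ?r" by (simp add: power2_eq_square algebra_simps)
      then have "\<bar>?S n \<omega>\<bar> \<le> (1 / (2 * ?r)) * (?S n \<omega>)\<^sup>2 + ?r / 2" using r(1) by (simp add: field_simps)
      ultimately show ?thesis by simp
    qed
    have "expect P i (\<lambda>\<omega>. \<bar>?Z n \<omega>\<bar>) \<le> expect P i (\<lambda>\<omega>. (1 / (2 * ?r)) * (0 + ?S n \<omega>)\<^sup>2 + (?r / 2 + B))"
      by (rule expect_mono[OF P _ _ pw]) (rule fdep_comp[OF signed_sum_fdep])+
    also have "\<dots> = (1 / (2 * ?r)) * expect P i (\<lambda>\<omega>. (0 + ?S n \<omega>)\<^sup>2) + (?r / 2 + B)"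
      by (rule expect_affine[OF P fdep_comp[OF signed_sum_fdep]])
    also have "\<dots> \<le> (1 / (2 * ?r)) * (2 * (?r * ?r) * B\<^sup>2) + (?r / 2 + B)"
    proof -
      have "expect P i (\<lambda>\<omega>. (0 + ?S n \<omega>)\<^sup>2) \<le> (0 + g i)\<^sup>2 + real n * B\<^sup>2"
        by (rule signed_sum_second_moment[OF P \<epsilon> g B(2)])
      also have "(0 + g i)\<^sup>2 = \<bar>g i\<bar>\<^sup>2" by simp
      also have "\<dots> \<le> B\<^sup>2" using B(2)[of i] by (intro power_mono) auto
      also have "B\<^sup>2 + real n * B\<^sup>2 \<le> 2 * (?r * ?r) * B\<^sup>2"
        unfolding r(2) using mult_right_mono[of 1 "real n" "B\<^sup>2"] n by simp
      finally show ?thesis using r(1) by (intro add_right_mono mult_left_mono) auto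
    qed
    also have "\<dots> = ?r * B\<^sup>2 + ?r / 2 + B"
    proof -
      have "(1 / (2 * r)) * (2 * (r * r) * x) = r * x" if "r \<noteq> 0" for r x :: real
        using that by (simp add: field_simps)
      moreover have "?r \<noteq> 0" using n by simp
      ultimately have "(1 / (2 * ?r)) * (2 * (?r * ?r) * B\<^sup>2) = ?r * B\<^sup>2" by blast
      then show ?thesis by linarith
    qed
    also have "\<dots> \<le> (B\<^sup>2 + B + 1) * ?r"
    proof -
      have "B * 1 \<le> B * ?r" using r(1) B(1) by (intro mult_left_mono) auto
      moreover have "(B\<^sup>2 + B + 1) * ?r = ?r * B\<^sup>2 + B * ?r + ?r" by (simp add: algebra_simps)
      ultimately show ?thesis using r(1) by linarith
    qed
    finally show "expect P i (\<lambda>\<omega>. \<bar>?Z n \<omega>\<bar>) \<le> (B\<^sup>2 + B + 1) * ?r" .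
  qed
qed

section \<open>Controlled growth\<close>

text \<open>\<open>N\<close> may depend on the time horizon \<open>n\<close>, and may degenerate exponentially in \<open>n\<close>: this costs only a
  factor \<open>K ^ n\<close> in the perturbation argument. For a single invariant line it suppresses the off-diagonal
  entries, so that no maximal inequality is needed.\<close>

definition gauge_control ::
    "real ^ 'n::finite ^ 'n \<Rightarrow> ('n \<Rightarrow> real ^ 2 ^ 2) \<Rightarrow> real \<Rightarrow> nat \<Rightarrow> real \<Rightarrow> bool" where
  "gauge_control P A K n b \<longleftrightarrow> (\<exists>(N :: 'n \<Rightarrow> real ^ 2 ^ 2) G.
     (\<forall>i v. norm v \<le> K ^ n * norm (N i *v v)) \<and> (\<forall>i v. norm (N i *v v) \<le> K * norm v) \<and>
     fdep (Suc n) G \<and> (\<forall>\<omega>. 0 \<le> G \<omega>) \<and>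
     (\<forall>\<omega>. (\<forall>k<n. 0 < P $ \<omega> k $ \<omega> (Suc k)) \<longrightarrow>
        (\<forall>v. norm (N (\<omega> n) *v (cocycle A \<omega> n *v v)) \<le> exp (G \<omega>) * norm (N (\<omega> 0) *v v))) \<and>
     (\<forall>i. expect P i G \<le> b))"

text \<open>\<open>K\<close> is common to all horizons, while the gauge and its growth function may
  change with \<open>n\<close>; \<open>\<beta> n\<close> bounds the mean logarithmic growth over
  \<open>n\<close> steps from every starting state.\<close>

definition controlled :: "real ^ 'n::finite ^ 'n \<Rightarrow> ('n \<Rightarrow> real ^ 2 ^ 2) \<Rightarrow> (nat \<Rightarrow> real) \<Rightarrow> bool" where
  "controlled P A \<beta> \<longleftrightarrow> (\<exists>K\<ge>1. \<forall>n\<ge>1. gauge_control P A K n (\<beta> n))"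

lemma gauge_controlI:
  fixes P :: "real ^ 'n::finite ^ 'n" and N :: "'n \<Rightarrow> real ^ 2 ^ 2"
  assumes "\<And>i v. norm v \<le> K ^ n * norm (N i *v v)" "\<And>i v. norm (N i *v v) \<le> K * norm v"
    and "fdep (Suc n) G" "\<And>\<omega>. 0 \<le> G \<omega>"
    and "\<And>\<omega> v. \<forall>k<n. 0 < P $ \<omega> k $ \<omega> (Suc k) \<Longrightarrow>
        norm (N (\<omega> n) *v (cocycle A \<omega> n *v v)) \<le> exp (G \<omega>) * norm (N (\<omega> 0) *v v)"
    and "\<And>i. expect P i G \<le> b"
  shows "gauge_control P A K n b"
  unfolding gauge_control_def using assms by (intro exI[of _ N] exI[of _ G] conjI allI impI)

lemma gauge_control_mono:
  assumes "gauge_control P A K n b" "b \<le> b'" shows "gauge_control P A K n b'"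
proof -
  have *: "\<forall>i. x i \<le> b \<Longrightarrow> \<forall>i. x i \<le> b'" for x :: "'a \<Rightarrow> real" using assms(2) order_trans by blast
  show ?thesis
    using assms(1) unfolding gauge_control_def
    by - (elim exE, elim conjE, intro exI conjI; (assumption | erule *))
qed

lemma controlled_mono:
  assumes "controlled P A \<beta>" and "\<And>n. 1 \<le> n \<Longrightarrow> \<beta> n \<le> \<beta>' n"
  shows "controlled P A \<beta>'"
  using assms gauge_control_mono unfolding controlled_def by blast

text \<open>A single gauge, the same for all horizons, in which the products along paths are
  bounded. It serves both the case without atoms and the compact normal form.\<close>

lemma controlled_const:
  fixes P :: "real ^ 'n::finite ^ 'n" and N :: "'n \<Rightarrow> real ^ 2 ^ 2"
  assumes P: "stochastic P" and M: "1 \<le> M" and N: "\<And>i. invertible (N i)"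
    and bound: "\<And>\<omega> n v. (\<And>k. k < n \<Longrightarrow> 0 < P $ \<omega> k $ \<omega> (Suc k)) \<Longrightarrow>
        norm (N (\<omega> n) *v (cocycle A \<omega> n *v v)) \<le> M * norm (N (\<omega> 0) *v v)"
  shows "controlled P A (\<lambda>_. ln M)"
proof -
  obtain K1 where K1: "1 \<le> K1" "\<And>i. mnorm (N i) \<le> K1"
    using finite_upper[of "\<lambda>i. mnorm (N i)"] by blast
  obtain K2 where K2: "1 \<le> K2" "\<And>i. mnorm (matrix_inv (N i)) \<le> K2"
    using finite_upper[of "\<lambda>i. mnorm (matrix_inv (N i))"] by blast
  let ?K = "max K1 K2"
  have K: "1 \<le> ?K" using K1 by simp
  have up: "norm (N i *v v) \<le> ?K * norm v" for i v
  proof -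
    have "mnorm (N i) * norm v \<le> ?K * norm v"
      using K1(2)[of i] by (intro mult_right_mono) auto
    then show ?thesis using mnorm[of "N i" v] by linarith
  qed
  have low: "norm v \<le> ?K ^ n * norm (N i *v v)" if "1 \<le> n" for i v n
  proof -
    have "norm v = norm (matrix_inv (N i) *v (N i *v v))" by (simp add: inverse_vector'[OF N])
    also have "\<dots> \<le> mnorm (matrix_inv (N i)) * norm (N i *v v)" by (rule mnorm)
    also have "\<dots> \<le> ?K * norm (N i *v v)" using K2(2)[of i] by (intro mult_right_mono) auto
    also have "?K \<le> ?K ^ n" using power_increasing[OF that K] by simp
    finally show ?thesis by (meson mult_right_mono norm_ge_zero order_trans)
  qed
  show ?thesis unfolding controlled_def
  proof (intro exI[of _ ?K] conjI allI impI)
    fix n :: nat assume n: "1 \<le> n"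
    show "gauge_control P A ?K n (ln M)"
      by (rule gauge_controlI[of _ _ N "\<lambda>_. ln M"])
        (use low[OF n] up M bound in \<open>simp_all add: fdep_def expect_const[OF P]\<close>)
  qed (rule K)
qed

section \<open>Coordinates adapted to lines\<close>

definition rows2 :: "real ^ 2 \<Rightarrow> real ^ 2 \<Rightarrow> real ^ 2 ^ 2" where
  "rows2 a b = vector [a, b]"

lemma rows2_simps: "(rows2 a b *v v) $ 1 = a \<bullet> v" "(rows2 a b *v v) $ 2 = b \<bullet> v"
  by (simp_all add: rows2_def matrix_vector_mult_def inner_vec_def sum_2)

lemma rows2_norm_sq: "(norm (rows2 a b *v v))\<^sup>2 = (a \<bullet> v)\<^sup>2 + (b \<bullet> v)\<^sup>2"
  by (simp add: norm_real2 rows2_simps)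

lemma rows2_norm_le: "norm (rows2 a b *v v) \<le> \<bar>a \<bullet> v\<bar> + \<bar>b \<bullet> v\<bar>"
  using norm_le_l1_cart[of "rows2 a b *v v"] by (simp add: sum_2 rows2_simps)

lemma rows2_component_le: "\<bar>a \<bullet> v\<bar> \<le> norm (rows2 a b *v v)" "\<bar>b \<bullet> v\<bar> \<le> norm (rows2 a b *v v)"
  using component_le_norm_cart[of "rows2 a b *v v" 1] component_le_norm_cart[of "rows2 a b *v v" 2]
  by (simp_all add: rows2_simps)

lemma perp_inner: "perp u \<bullet> v = wedge u v"
  by (simp add: inner_real2 wedge_def)

lemma parallel_unit:
  assumes "wedge x u = 0" "norm u = 1"
  shows "x = (x \<bullet> u) *\<^sub>R u" "\<bar>x \<bullet> u\<bar> = norm x"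
proof -
  have u: "u $ 1 * u $ 1 + u $ 2 * u $ 2 = 1"
    using assms(2) norm_real2[of u] by (simp add: power2_eq_square)
  have "(x \<bullet> u) *\<^sub>R u = (u $ 1 * u $ 1 + u $ 2 * u $ 2) *\<^sub>R x + wedge x u *\<^sub>R perp u"
    by (simp add: vec_eq_iff forall_2 wedge_def inner_real2 algebra_simps)
  then show x: "x = (x \<bullet> u) *\<^sub>R u" using u assms(1) by simp
  have "norm x = norm ((x \<bullet> u) *\<^sub>R u)" using x by metis
  then show "\<bar>x \<bullet> u\<bar> = norm x" using assms(2) by simp
qed

text \<open>Areas are preserved, so the component transversal to an invariant line is scaled by the
  reciprocal of the stretching along the line.\<close>

lemma edge_wedge:
  assumes M: "unimodular M" and par: "wedge (M *v u) u' = 0" and "norm u' = 1"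
  shows "norm (M *v u) * \<bar>wedge u' (M *v v)\<bar> = \<bar>wedge u v\<bar>"
proof -
  have "\<bar>wedge u v\<bar> = \<bar>wedge (M *v u) (M *v v)\<bar>" using unimodular_wedge[OF M] by simp
  also have "M *v u = ((M *v u) \<bullet> u') *\<^sub>R u'" by (rule parallel_unit[OF par assms(3)])
  also have "\<bar>wedge (((M *v u) \<bullet> u') *\<^sub>R u') (M *v v)\<bar> = norm (M *v u) * \<bar>wedge u' (M *v v)\<bar>"
    by (simp only: wedge_linear abs_mult parallel_unit(2)[OF par assms(3)])
  finally show ?thesis by simp
qed

text \<open>Almost every trajectory follows edges of the graph, which turns statements about
  admissible paths into almost sure ones. Time 0 is computed, and stationarity gives the other
  times.\<close>

lemma AE_edges:
  fixes P :: "real ^ 'n::finite ^ 'n"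
  assumes P: "stochastic P" and irr: "irreducible_chain P"
  shows "AE \<omega> in stationary_chain P. \<forall>k. 0 < P $ \<omega> k $ \<omega> (Suc k)"
proof -
  interpret ergodic_system "stationary_chain P" shift by (rule chain_ergodic_system[OF P irr])
  let ?M = "stationary_chain P" and ?p = "stationary_vector P"
  let ?E = "{\<omega> :: nat \<Rightarrow> 'n. P $ \<omega> 0 $ \<omega> 1 = 0}"
  have p: "prob_vector ?p" by (rule prob_vector_stationary[OF P irr])
  have fd: "fdep 2 (\<lambda>\<omega>. \<omega> \<in> ?E)" by (auto simp: fdep_def)
  then have fdi: "fdep (Suc 1) (indicator ?E :: _ \<Rightarrow> real)"
    by (auto simp: fdep_def indicator_def)
  have E: "?E \<in> sets traj" by (rule fdep_sets[OF fd])
  have "expect P i (indicator ?E) = 0" for i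
  proof -
    have "expect P j (\<lambda>\<omega>. indicator ?E (case_nat i \<omega>)) = expect P j (\<lambda>_. if P $ i $ j = 0 then 1 else 0)" for j
      by (rule expect_start_cong[OF P fdep_prepend[OF fdi]]) (auto simp: fdep_def)
    then have "expect P i (indicator ?E) = (\<Sum>j\<in>UNIV. P $ i $ j * (if P $ i $ j = 0 then 1 else 0))"
      unfolding expect_step_fdep[OF P fdi] by (simp only: expect_const[OF P])
    also have "\<dots> = 0" by (intro sum.neutral) auto
    finally show ?thesis .
  qed
  then have "measure ?M ?E = 0"
    unfolding stationary_chain_def measure_markov_measure_start[OF P p E] by simp
  moreover have "?E \<in> sets ?M"
    using E sets_markov_measure[OF P p] by (simp add: stationary_chain_def)
  ultimately have "AE \<omega> in ?M. \<omega> \<notin> ?E" using prob_eq_0 by blast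
  then have "AE \<omega> in ?M. 0 < P $ \<omega> 0 $ \<omega> 1"
    by eventually_elim (use stochastic_nonneg[OF P] in \<open>auto simp: less_le\<close>)
  then have "AE \<omega> in ?M. 0 < P $ ((shift ^^ k) \<omega>) 0 $ ((shift ^^ k) \<omega>) 1" for k
    using AE_distrD[OF Tn_measurable[of k], of "\<lambda>\<omega>. 0 < P $ \<omega> 0 $ \<omega> 1"] by (simp only: Tn_preserves)
  then show ?thesis by (simp add: AE_all_countable shift_funpow)
qed

section \<open>Square root control from one or two invariant lines\<close>

context zero_growth begin

text \<open>In the bases \<open>u i\<close>, \<open>perp (u i)\<close> the products are triangular,
  with diagonal entries of size \<open>exp T\<close> and \<open>exp (- T)\<close>, where
  \<open>T\<close> is an additive functional of the chain. A weight on one coordinate tames the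
  off-diagonal entry.\<close>

lemma controlled_line:
  assumes u: "\<And>i. norm (u i) = 1" and par: "\<And>i j. 0 < P $ i $ j \<Longrightarrow> wedge (A i *v u i) (u j) = 0"
  shows "\<exists>c>0. controlled P A (\<lambda>n. c * sqrt (real n))"
proof -
  define \<phi> where "\<phi> i = ln (norm (A i *v u i))" for i
  define T where "T = signed_sum (\<lambda>_ _. 1 :: real) \<phi> (\<lambda>_. 0)"
  have pos: "0 < norm (A i *v u i)" for i
    using unimodular_lower[OF uni, of "u i" i] u[of i] unimodular_mnorm_ge[OF uni, of i] by (cases "A i *v u i = 0") auto
  have T0: "T 0 \<omega> = 0" and TS: "T (Suc n) \<omega> = \<phi> (\<omega> 0) + T n (shift \<omega>)" for n \<omega>
    by (simp_all add: T_def)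
  have eT: "exp (T n \<omega>) = norm (cocycle A \<omega> n *v u (\<omega> 0))
      \<and> wedge (cocycle A \<omega> n *v u (\<omega> 0)) (u (\<omega> n)) = 0"
    if "\<And>k. k < n \<Longrightarrow> 0 < P $ \<omega> k $ \<omega> (Suc k)" for n \<omega>
    using that
  proof (induction n arbitrary: \<omega>)
    case 0
    then show ?case using u by (simp add: T0 wedge_linear)
  next
    case (Suc n)
    let ?a = "A (\<omega> 0) *v u (\<omega> 0)"
    have IH: "exp (T n (shift \<omega>)) = norm (cocycle A (shift \<omega>) n *v u (\<omega> 1))"
      "wedge (cocycle A (shift \<omega>) n *v u (\<omega> 1)) (u (\<omega> (Suc n))) = 0"
      using Suc.IH[of "shift \<omega>"] Suc.prems by (auto simp: shift_def)
    have a: "wedge ?a (u (\<omega> 1)) = 0" using par Suc.prems[of 0] by simp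
    have C: "cocycle A \<omega> (Suc n) *v u (\<omega> 0) = (?a \<bullet> u (\<omega> 1)) *\<^sub>R (cocycle A (shift \<omega>) n *v u (\<omega> 1))"
      unfolding cocycle_Suc_shift matrix_vector_mul_assoc[symmetric]
      by (subst parallel_unit(1)[OF a u]) (rule matrix_vector_mult_scaleR)
    have "norm (cocycle A \<omega> (Suc n) *v u (\<omega> 0)) = exp (T (Suc n) \<omega>)"
      unfolding C norm_scaleR parallel_unit(2)[OF a u] IH(1)[symmetric] TS exp_add \<phi>_def using pos by simp
    then show ?case using IH(2) unfolding C by (simp add: wedge_linear)
  qed
  \<comment> \<open>Both \<open>exp T\<close> and \<open>exp (- T)\<close> are at most the norm of
    the product, the second because the inverse has the same norm.\<close>
  have Tle: "\<bar>T n \<omega>\<bar> \<le> ln (mnorm (cocycle A \<omega> n))"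
    if "\<And>k. k < n \<Longrightarrow> 0 < P $ \<omega> k $ \<omega> (Suc k)" for n \<omega>
  proof -
    let ?C = "cocycle A \<omega> n"
    have uC: "unimodular ?C" by (rule cocycle_unimodular[OF uni])
    have m: "0 < mnorm ?C" using unimodular_mnorm_ge[OF uC] by simp
    have e: "exp (T n \<omega>) = norm (?C *v u (\<omega> 0))" using eT[of n \<omega>] that by blast
    have "exp (T n \<omega>) \<le> mnorm ?C" unfolding e using mnorm[of ?C "u (\<omega> 0)"] u by simp
    then have 1: "T n \<omega> \<le> ln (mnorm ?C)" using m by (simp add: ln_ge_iff)
    have "1 \<le> mnorm ?C * exp (T n \<omega>)" unfolding e using unimodular_lower[OF uC, of "u (\<omega> 0)"] u by simp
    then have "exp (- T n \<omega>) \<le> mnorm ?C" by (simp add: exp_minus field_simps)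
    then have "- T n \<omega> \<le> ln (mnorm ?C)" using m by (simp add: ln_ge_iff)
    then show ?thesis using 1 by simp
  qed
  \<comment> \<open>\<open>T n / n\<close> tends to the mean of \<open>\<phi>\<close> by Birkhoff's
    theorem and to 0 by zero growth. This centring makes the Poisson equation solvable.\<close>
  have mean0: "(\<Sum>i\<in>UNIV. p $ i * \<phi> i) = 0"
  proof -
    interpret ergodic_system "stationary_chain P" shift by (rule chain_ergodic_system[OF P irr])
    have fd: "fdep 1 (\<lambda>\<omega>. \<phi> (\<omega> 0))" by (simp add: fdep_def)
    obtain B where B: "\<And>i. \<bar>\<phi> i\<bar> \<le> B" using finite_upper[of "\<lambda>i. \<bar>\<phi> i\<bar>"] by blast
    have "(\<lambda>\<omega>. \<phi> (\<omega> 0)) \<in> borel_measurable (stationary_chain P)"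
      unfolding measurable_chain[OF P irr] by (rule fdep_borel[OF fd])
    from birkhoff[OF this B]
    have b: "AE \<omega> in stationary_chain P. (\<lambda>n. (\<Sum>k<n. \<phi> (((shift ^^ k) \<omega>) 0)) / real n) \<longlonglongrightarrow> (\<integral>\<omega>. \<phi> (\<omega> 0) \<partial>stationary_chain P)" .
    have Tsum: "T n \<omega> = (\<Sum>k<n. \<phi> (((shift ^^ k) \<omega>) 0))" for n \<omega>
    proof (induction n arbitrary: \<omega>)
      case (Suc n)
      show ?case unfolding sum.lessThan_Suc_shift TS Suc by (simp add: shift_funpow shift_def)
    qed (simp add: T0)
    have int: "(\<integral>\<omega>. \<phi> (\<omega> 0) \<partial>stationary_chain P) = (\<Sum>i\<in>UNIV. p $ i * \<phi> i)"
    proof -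
      have "expect P i (\<lambda>\<omega>. \<phi> (\<omega> 0)) = expect P i (\<lambda>_. \<phi> i)" for i
        by (rule expect_start_cong[OF P fd]) (auto simp: fdep_def)
      then have "expect P i (\<lambda>\<omega>. \<phi> (\<omega> 0)) = \<phi> i" for i by (simp add: expect_const[OF P])
      then show ?thesis unfolding stationary_chain_def
        using integral_markov_measure_start[OF P p fdep_borel[OF fd] B] by simp
    qed
    have "AE \<omega> in stationary_chain P. (\<Sum>i\<in>UNIV. p $ i * \<phi> i) = 0"
      using b growth_AE[of P A, OF P irr uni] AE_edges[OF P irr]
    proof eventually_elim
      case (elim \<omega>)
      have "(\<lambda>n. T n \<omega> / real n) \<longlonglongrightarrow> 0"
      proof (rule Lim_null_comparison)
        show "(\<lambda>n. ln (mnorm (cocycle A \<omega> n)) / real n) \<longlonglongrightarrow> 0" using elim(2) by (simp add: zero)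
        show "\<forall>\<^sub>F n in sequentially. norm (T n \<omega> / real n) \<le> ln (mnorm (cocycle A \<omega> n)) / real n"
          using Tle elim(3) by (intro always_eventually allI) (simp add: divide_right_mono)
      qed
      moreover have "(\<lambda>n. T n \<omega> / real n) \<longlonglongrightarrow> (\<Sum>i\<in>UNIV. p $ i * \<phi> i)"
        using elim(1) by (simp add: Tsum int)
      ultimately show ?case by (rule LIMSEQ_unique[symmetric])
    qed
    then show ?thesis by simp
  qed
  obtain g where "\<And>i. \<phi> i = g i - (\<Sum>j\<in>UNIV. P $ i $ j * g j)"
    using poisson[OF P irr p p_fixed mean0] by blast
  then obtain c where c: "0 < c" "\<And>i n. 1 \<le> n \<Longrightarrow> expect P i (\<lambda>\<omega>. \<bar>T n \<omega>\<bar>) \<le> c * sqrt (real n)"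
    unfolding T_def using signed_sum_mean_abs[OF P, of "\<lambda>_ _. 1" \<phi> g] by auto
  obtain K where K: "1 \<le> K" "\<And>i. mnorm (A i) \<le> K" using finite_upper[of "\<lambda>i. mnorm (A i)"] by blast
  have "controlled P A (\<lambda>n. (c + ln 3) * sqrt (real n))"
    unfolding controlled_def
  proof (intro exI[of _ "2 * K"] conjI allI impI)
    show "1 \<le> 2 * K" using K by simp
    fix n :: nat assume n: "1 \<le> n"
    \<comment> \<open>Off-diagonal entries are known only to be at most \<open>K ^ n\<close>;
      scaling the coordinate along the line by \<open>t\<close> reduces them to at most 1.\<close>
    define t where "t = 1 / K ^ n"
    have t: "0 < t" "t * K ^ n = 1" "t \<le> 1" using K by (auto simp: t_def)
    define N where "N i = rows2 (t *\<^sub>R u i) (perp (u i))" for i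
    \<comment> \<open>The new norm is bounded by three terms, each at most
      \<open>exp \<bar>T\<bar>\<close> times the old norm; hence the summand
      \<open>ln 3\<close>.\<close>
    define G where "G \<omega> = ln 3 + \<bar>T n \<omega>\<bar>" for \<omega>
    have a_le: "t * \<bar>u i \<bullet> v\<bar> \<le> norm (N i *v v)" and b_le: "\<bar>wedge (u i) v\<bar> \<le> norm (N i *v v)" for i v
      using rows2_component_le[of "t *\<^sub>R u i" v "perp (u i)"] rows2_component_le(2)[of "perp (u i)" v "t *\<^sub>R u i"] t
      by (simp_all add: N_def perp_inner abs_mult)
    have le: "norm (N i *v v) \<le> t * \<bar>u i \<bullet> v\<bar> + \<bar>wedge (u i) v\<bar>" for i v
      using rows2_norm_le[of "t *\<^sub>R u i" "perp (u i)" v] t by (simp add: N_def perp_inner abs_mult)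
    have dec: "v = (u i \<bullet> v) *\<^sub>R u i + wedge (u i) v *\<^sub>R perp (u i)" for i v
    proof -
      have u1: "u i $ 1 * u i $ 1 + u i $ 2 * u i $ 2 = 1"
        using u[of i] norm_real2[of "u i"] by (simp add: power2_eq_square)
      have "(u i \<bullet> v) *\<^sub>R u i + wedge (u i) v *\<^sub>R perp (u i) = (u i $ 1 * u i $ 1 + u i $ 2 * u i $ 2) *\<^sub>R v"
        by (simp add: vec_eq_iff forall_2 wedge_def inner_real2 algebra_simps)
      then show ?thesis by (simp add: u1)
    qed
    have low: "norm v \<le> (2 * K) ^ n * norm (N i *v v)" for i v
    proof -
      have "norm v \<le> \<bar>u i \<bullet> v\<bar> + \<bar>wedge (u i) v\<bar>"
        by (subst dec[of v i]) (rule norm_triangle_le, simp add: u)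
      then have "t * norm v \<le> t * \<bar>u i \<bullet> v\<bar> + t * \<bar>wedge (u i) v\<bar>"
        using t by (metis distrib_left less_imp_le mult_left_mono)
      also have "t * \<bar>wedge (u i) v\<bar> \<le> \<bar>wedge (u i) v\<bar>" using t by (simp add: mult_left_le_one_le)
      finally have "t * norm v \<le> 2 * norm (N i *v v)" using a_le[of i v] b_le[of i v] by linarith
      then have "K ^ n * (t * norm v) \<le> K ^ n * (2 * norm (N i *v v))" using K by (intro mult_left_mono) auto
      moreover have "K ^ n * (t * norm v) = norm v"
        by (simp only: mult.assoc[symmetric] mult.commute[of "K ^ n" t] t(2) mult_1)
      ultimately have "norm v \<le> 2 * K ^ n * norm (N i *v v)" by (simp only: mult_ac)
      also have "2 * K ^ n \<le> (2 * K) ^ n"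
        using self_le_power[of "2 :: real" n] n K by (simp add: power_mult_distrib)
      finally show ?thesis by (simp add: mult_right_mono)
    qed
    have up: "norm (N i *v v) \<le> 2 * K * norm v" for i v
    proof -
      have "\<bar>u i \<bullet> v\<bar> \<le> norm v" using Cauchy_Schwarz_ineq2[of "u i" v] u by simp
      then have "t * \<bar>u i \<bullet> v\<bar> \<le> norm v" using t by (meson abs_ge_zero less_imp_le mult_left_le_one_le order_trans)
      moreover have "\<bar>wedge (u i) v\<bar> \<le> norm v" using wedge_le[of "u i" v] u by simp
      ultimately have "norm (N i *v v) \<le> 2 * norm v" using le[of i v] by simp
      also have "\<dots> \<le> 2 * K * norm v" using K by (simp add: mult_right_mono)
      finally show ?thesis .
    qed
    have main: "norm (N (\<omega> n) *v (cocycle A \<omega> n *v v)) \<le> exp (G \<omega>) * norm (N (\<omega> 0) *v v)"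
      if path: "\<forall>k<n. 0 < P $ \<omega> k $ \<omega> (Suc k)" for \<omega> v
    proof -
      let ?C = "cocycle A \<omega> n" and ?u = "u (\<omega> 0)" and ?T = "T n \<omega>"
      have uC: "unimodular ?C" by (rule cocycle_unimodular[OF uni])
      have e: "exp ?T = norm (?C *v ?u)" "wedge (?C *v ?u) (u (\<omega> n)) = 0" using eT path by auto
      have w: "\<bar>wedge (u (\<omega> n)) (?C *v v)\<bar> = exp (- ?T) * \<bar>wedge ?u v\<bar>"
        using edge_wedge[OF uC e(2) u, of v] unfolding e(1)[symmetric] by (simp add: exp_minus field_simps)
      have eq: "?C *v v = (?u \<bullet> v) *\<^sub>R (?C *v ?u) + wedge ?u v *\<^sub>R (?C *v perp ?u)"
        by (subst dec[of v "\<omega> 0"]) (simp only: matrix_vector_right_distrib matrix_vector_mult_scaleR)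
      have "norm (?C *v perp ?u) \<le> K ^ n"
        using mnorm[of ?C "perp ?u"] cocycle_mnorm_le[of A K \<omega> n] K u by simp
      then have "\<bar>wedge ?u v\<bar> * norm (?C *v perp ?u) \<le> \<bar>wedge ?u v\<bar> * K ^ n" by (intro mult_left_mono) auto
      then have nC: "norm (?C *v v) \<le> \<bar>?u \<bullet> v\<bar> * exp ?T + \<bar>wedge ?u v\<bar> * K ^ n"
        unfolding e(1) by (subst eq) (rule norm_triangle_le, simp)
      have "\<bar>u (\<omega> n) \<bullet> (?C *v v)\<bar> \<le> norm (?C *v v)"
        using Cauchy_Schwarz_ineq2[of "u (\<omega> n)" "?C *v v"] u by simp
      then have "t * \<bar>u (\<omega> n) \<bullet> (?C *v v)\<bar> \<le> t * (\<bar>?u \<bullet> v\<bar> * exp ?T + \<bar>wedge ?u v\<bar> * K ^ n)"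
        using nC t by (intro mult_left_mono) auto
      also have "\<dots> = exp ?T * (t * \<bar>?u \<bullet> v\<bar>) + (t * K ^ n) * \<bar>wedge ?u v\<bar>" by (simp add: algebra_simps)
      also have "\<dots> = exp ?T * (t * \<bar>?u \<bullet> v\<bar>) + \<bar>wedge ?u v\<bar>" by (simp add: t)
      finally have "norm (N (\<omega> n) *v (?C *v v)) \<le> exp ?T * (t * \<bar>?u \<bullet> v\<bar>) + \<bar>wedge ?u v\<bar> + exp (- ?T) * \<bar>wedge ?u v\<bar>"
        using le[of "\<omega> n" "?C *v v"] w by linarith
      also have "\<dots> \<le> exp \<bar>?T\<bar> * norm (N (\<omega> 0) *v v) + exp \<bar>?T\<bar> * norm (N (\<omega> 0) *v v) + exp \<bar>?T\<bar> * norm (N (\<omega> 0) *v v)"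
      proof (intro add_mono mult_mono a_le b_le)
        show "\<bar>wedge ?u v\<bar> \<le> exp \<bar>?T\<bar> * norm (N (\<omega> 0) *v v)"
          using b_le[of "\<omega> 0" v] mult_right_mono[of 1 "exp \<bar>?T\<bar>" "norm (N (\<omega> 0) *v v)"] by simp
      qed (use t in auto)
      also have "\<dots> = exp (G \<omega>) * norm (N (\<omega> 0) *v v)" by (simp add: G_def exp_add)
      finally show ?thesis .
    qed
    have fdG: "fdep (Suc n) G" unfolding G_def[abs_def] T_def by (rule fdep_comp[OF signed_sum_fdep])
    have exG: "expect P i G \<le> (c + ln 3) * sqrt (real n)" for i
    proof -
      have "expect P i G = expect P i (\<lambda>\<omega>. 1 * \<bar>T n \<omega>\<bar> + ln 3)" by (simp add: G_def[abs_def] add.commute)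
      also have "\<dots> = 1 * expect P i (\<lambda>\<omega>. \<bar>T n \<omega>\<bar>) + ln 3"
        unfolding T_def by (rule expect_affine[OF P fdep_comp[OF signed_sum_fdep]])
      also have "\<dots> \<le> c * sqrt (real n) + ln 3 * sqrt (real n)"
      proof -
        have "ln 3 * 1 \<le> ln 3 * sqrt (real n)" using n by (intro mult_left_mono) auto
        then show ?thesis using c(2)[OF n, of i] by linarith
      qed
      finally show ?thesis by (simp add: algebra_simps)
    qed
    have Gnn: "0 \<le> G \<omega>" for \<omega> by (simp add: G_def)
    show "gauge_control P A (2 * K) n ((c + ln 3) * sqrt (real n))"
      by (rule gauge_controlI[OF low up fdG Gnn main exG])
  qed
  then show ?thesis using c(1) by (intro exI[of _ "c + ln 3"]) (simp add: add_pos_pos)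
qed

text \<open>Fredholm alternative. A kernel element \<open>h\<close> has subharmonic, hence constant,
  absolute value, and the equality case of the triangle inequality forces
  \<open>\<epsilon> i j * h i * h j > 0\<close> on every edge: the signs of \<open>h\<close>
  trivialize the twist.\<close>

lemma twisted_poisson:
  assumes \<epsilon>: "\<And>i j. \<epsilon> i j = 1 \<or> \<epsilon> i j = (-1 :: real)"
  obtains (solution) g where "\<And>i. \<phi> i = g i - (\<Sum>j\<in>UNIV. P $ i $ j * (\<epsilon> i j * g j))"
  | (coherent) h where "\<And>i. h i \<noteq> (0 :: real)" "\<And>i j. 0 < P $ i $ j \<Longrightarrow> 0 < \<epsilon> i j * h i * h j"
proof (cases "\<exists>h. (\<exists>i. h i \<noteq> 0) \<and> (\<forall>i. h i - (\<Sum>j\<in>UNIV. P $ i $ j * (\<epsilon> i j * h j)) = 0)")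
  case False
  have "\<exists>g. \<forall>i. g i - (\<Sum>j\<in>UNIV. P $ i $ j * (\<epsilon> i j * g j)) = \<phi> i"
  proof (rule finite_linear_surj[of "\<lambda>g i. g i - (\<Sum>j\<in>UNIV. P $ i $ j * (\<epsilon> i j * g j))" \<phi>])
    fix g i assume "\<And>i. g i - (\<Sum>j\<in>UNIV. P $ i $ j * (\<epsilon> i j * g j)) = 0"
    then show "g i = 0" using False by blast
  next
    fix g assume "\<And>i. g i - (\<Sum>j\<in>UNIV. P $ i $ j * (\<epsilon> i j * g j)) = \<phi> i"
    then show "\<exists>g. \<forall>i. g i - (\<Sum>j\<in>UNIV. P $ i $ j * (\<epsilon> i j * g j)) = \<phi> i" by blast
  qed (simp_all add: distrib_left sum.distrib sum_distrib_left right_diff_distrib mult.left_commute)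
  then show ?thesis using solution by metis
next
  case True
  then obtain h i0 where h0: "\<And>i. h i - (\<Sum>j\<in>UNIV. P $ i $ j * (\<epsilon> i j * h j)) = 0" and i0: "h i0 \<noteq> 0" by blast
  have h: "h i = (\<Sum>j\<in>UNIV. P $ i $ j * (\<epsilon> i j * h j))" for i using h0[of i] by linarith
  have ea: "\<bar>\<epsilon> i j\<bar> = 1" for i j using \<epsilon>[of i j] by auto
  define c where "c = \<bar>h i0\<bar>"
  have "\<bar>h i\<bar> \<le> (\<Sum>j\<in>UNIV. P $ i $ j * \<bar>h j\<bar>)" for i
  proof -
    have "\<bar>h i\<bar> \<le> (\<Sum>j\<in>UNIV. \<bar>P $ i $ j * (\<epsilon> i j * h j)\<bar>)" by (subst h) (rule sum_abs)
    then show ?thesis using stochastic_nonneg[OF P] by (simp add: abs_mult ea)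
  qed
  then have c: "\<bar>h i\<bar> = c" for i
    unfolding c_def by (rule subharmonic_constant[OF P irr, of "\<lambda>i. \<bar>h i\<bar>"])
  have c0: "0 < c" using i0 by (simp add: c_def)
  show ?thesis
  proof (rule coherent[of h])
    show "h i \<noteq> 0" for i using c[of i] c0 by auto
    fix i j assume ij: "0 < P $ i $ j"
    have cc: "h i * h i = c * c" for i using c[of i] by (metis abs_mult_self_eq)
    have nn: "0 \<le> P $ i $ j * (c * c - \<epsilon> i j * h i * h j)" for j
    proof -
      have "\<bar>\<epsilon> i j * h i * h j\<bar> = c * c" by (simp add: abs_mult ea c)
      then have "\<epsilon> i j * h i * h j \<le> c * c" by linarith
      then show ?thesis using stochastic_nonneg[OF P, of i j] by simp
    qed
    \<comment> \<open>The nonnegative deficits of the triangle inequality have weighted sum 0, so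
      each of them vanishes on edges.\<close>
    have "(\<Sum>j\<in>UNIV. P $ i $ j * (c * c - \<epsilon> i j * h i * h j))
        = (\<Sum>j\<in>UNIV. P $ i $ j * (c * c)) - (\<Sum>j\<in>UNIV. h i * (P $ i $ j * (\<epsilon> i j * h j)))"
      unfolding sum_subtractf[symmetric] by (intro sum.cong refl) (simp add: algebra_simps)
    also have "\<dots> = c * c - h i * h i"
      unfolding sum_distrib_right[symmetric] sum_distrib_left[symmetric] h[symmetric] by (simp add: stochastic_sum[OF P])
    also have "\<dots> = 0" by (simp add: cc)
    finally have "P $ i $ j * (c * c - \<epsilon> i j * h i * h j) = 0"
      using sum_nonneg_eq_0_iff[of UNIV "\<lambda>j. P $ i $ j * (c * c - \<epsilon> i j * h i * h j)"] nn by simp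
    then have "\<epsilon> i j * h i * h j = c * c" using ij by simp
    then show "0 < \<epsilon> i j * h i * h j" using c0 by simp
  qed
qed

text \<open>The growth rates along the two lines have bounded sum, because areas are kept and the
  angles take finitely many nonzero values. Hence each is half of their difference up to a bounded
  error, and the difference is a sum twisted by the exchanges.\<close>

lemma controlled_two_lines:
  assumes u: "\<And>i b. norm (u i b) = 1" and indep: "\<And>i. wedge (u i True) (u i False) \<noteq> 0"
    and par: "\<And>i j. 0 < P $ i $ j \<Longrightarrow> \<exists>s. \<forall>b. wedge (A i *v u i b) (u j (b \<noteq> s)) = 0"
  shows "\<exists>c>0. controlled P A (\<lambda>n. c * sqrt (real n))"
proof -
  obtain s where s: "\<And>i j b. 0 < P $ i $ j \<Longrightarrow> wedge (A i *v u i b) (u j (b \<noteq> s i j)) = 0"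
    using par by metis
  define \<alpha> where "\<alpha> i b = norm (A i *v u i b)" for i b
  define \<epsilon> where "\<epsilon> i j = (if s i j then -1 else 1 :: real)" for i j
  define \<phi> where "\<phi> i = ln (\<alpha> i True) - ln (\<alpha> i False)" for i
  have \<epsilon>: "\<epsilon> i j = 1 \<or> \<epsilon> i j = -1" for i j by (simp add: \<epsilon>_def)
  have pos: "0 < \<alpha> i b" for i b
    using unimodular_lower[OF uni, of "u i b" i] u[of i b] unimodular_mnorm_ge[OF uni, of i]
    by (cases "A i *v u i b = 0") (auto simp: \<alpha>_def)
  show ?thesis
  proof (rule twisted_poisson[of \<epsilon> \<phi>])
    fix h :: "'n \<Rightarrow> real"
    assume coherent: "\<And>i. h i \<noteq> 0" "\<And>i j. 0 < P $ i $ j \<Longrightarrow> 0 < \<epsilon> i j * h i * h j"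
    \<comment> \<open>The sign of \<open>h i\<close> selects one of the two lines at
      \<open>i\<close>, compatibly with all edges, so a single invariant line is obtained.\<close>
    show ?thesis
    proof (rule controlled_line[of "\<lambda>i. u i (0 < h i)"])
      fix i j assume ij: "0 < P $ i $ j"
      have "0 < \<epsilon> i j * h i * h j" by (rule coherent(2)[OF ij])
      then have "((0 < h i) \<noteq> s i j) = (0 < h j)"
        using coherent(1)[of i] coherent(1)[of j]
        by (auto simp: \<epsilon>_def zero_less_mult_iff mult_less_0_iff split: if_splits)
      then show "wedge (A i *v u i (0 < h i)) (u j (0 < h j)) = 0" using s[OF ij, of "0 < h i"] by simp
    qed (rule u)
  next
    fix g assume solution: "\<And>i. \<phi> i = g i - (\<Sum>j\<in>UNIV. P $ i $ j * (\<epsilon> i j * g j))"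
    obtain c where c: "0 < c" "\<And>i n. 1 \<le> n \<Longrightarrow> expect P i (\<lambda>\<omega>. \<bar>signed_sum \<epsilon> \<phi> (\<lambda>_. 0) n \<omega>\<bar>) \<le> c * sqrt (real n)"
      using signed_sum_mean_abs[OF P \<epsilon> solution] by blast
    \<comment> \<open>The logarithm of the sine of the angle between the two lines.\<close>
    define w where "w i = ln \<bar>wedge (u i True) (u i False)\<bar>" for i
    obtain W where W: "1 \<le> W" "\<And>i. \<bar>w i\<bar> \<le> W" using finite_upper[of "\<lambda>i. \<bar>w i\<bar>"] by blast
    have wpos: "0 < \<bar>wedge (u i True) (u i False)\<bar>" for i using indep by simp
    \<comment> \<open>Area of the parallelogram on the two unit vectors: the product of the
      stretchings is a quotient of sines, so the sum of the logarithms is a coboundary.\<close>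
    have tele: "ln (\<alpha> i True) + ln (\<alpha> i False) = w i - w j" if ij: "0 < P $ i $ j" for i j
    proof -
      have a: "wedge (A i *v u i b) (u j (b \<noteq> s i j)) = 0" for b by (rule s[OF ij])
      have 1: "\<alpha> i True * \<bar>wedge (u j (True \<noteq> s i j)) (A i *v u i False)\<bar> = \<bar>wedge (u i True) (u i False)\<bar>"
        unfolding \<alpha>_def by (rule edge_wedge[OF uni a u])
      have "\<bar>wedge (u j (True \<noteq> s i j)) (A i *v u i False)\<bar> = \<alpha> i False * \<bar>wedge (u j True) (u j False)\<bar>"
      proof -
        let ?w = "u j (False \<noteq> s i j)" and ?x = "A i *v u i False"
        have "\<bar>wedge (u j (True \<noteq> s i j)) ?x\<bar> = \<bar>?x \<bullet> ?w\<bar> * \<bar>wedge (u j (True \<noteq> s i j)) ?w\<bar>"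
          by (subst parallel_unit(1)[OF a[of False] u]) (simp only: wedge_linear abs_mult)
        also have "\<bar>?x \<bullet> ?w\<bar> = \<alpha> i False" unfolding \<alpha>_def by (rule parallel_unit(2)[OF a u])
        also have "\<bar>wedge (u j (True \<noteq> s i j)) ?w\<bar> = \<bar>wedge (u j True) (u j False)\<bar>"
          using wedge_anti[of "u j True" "u j False"] by (cases "s i j") simp_all
        finally show ?thesis .
      qed
      then have "\<alpha> i True * \<alpha> i False * \<bar>wedge (u j True) (u j False)\<bar> = \<bar>wedge (u i True) (u i False)\<bar>"
        using 1 by (simp add: mult.assoc)
      then have "ln (\<alpha> i True * \<alpha> i False * \<bar>wedge (u j True) (u j False)\<bar>) = w i" by (simp add: w_def)
      then show ?thesis using pos wpos by (simp add: ln_mult_pos w_def)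
    qed
    \<comment> \<open>\<open>T n b\<close> is the logarithmic growth over \<open>n\<close> steps
      along the line that bears label \<open>b\<close> at the start; the label changes whenever the
      edge exchanges the lines.\<close>
    define T where "T = rec_nat (\<lambda>b \<omega>. 0) (\<lambda>n T b \<omega>. ln (\<alpha> (\<omega> 0) b) + T (b \<noteq> s (\<omega> 0) (\<omega> 1)) (shift \<omega>))"
    have T0: "T 0 b \<omega> = 0" and TS: "T (Suc n) b \<omega> = ln (\<alpha> (\<omega> 0) b) + T n (b \<noteq> s (\<omega> 0) (\<omega> 1)) (shift \<omega>)" for n b \<omega>
      by (simp_all add: T_def)
    have Tdiff: "T n True \<omega> - T n False \<omega> = signed_sum \<epsilon> \<phi> (\<lambda>_. 0) n \<omega>" for n \<omega>
    proof (induction n arbitrary: \<omega>)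
      case (Suc n)
      show ?case using Suc[of "shift \<omega>"] by (cases "s (\<omega> 0) (\<omega> 1)") (simp_all add: TS \<epsilon>_def \<phi>_def)
    qed (simp add: T0)
    have Tsum: "T n True \<omega> + T n False \<omega> = w (\<omega> 0) - w (\<omega> n)"
      if "\<And>k. k < n \<Longrightarrow> 0 < P $ \<omega> k $ \<omega> (Suc k)" for n \<omega>
      using that
    proof (induction n arbitrary: \<omega>)
      case (Suc n)
      have "T n True (shift \<omega>) + T n False (shift \<omega>) = w (\<omega> 1) - w (\<omega> (Suc n))"
        using Suc.IH[of "shift \<omega>"] Suc.prems by (simp add: shift_def)
      moreover have "ln (\<alpha> (\<omega> 0) True) + ln (\<alpha> (\<omega> 0) False) = w (\<omega> 0) - w (\<omega> 1)"
        using tele[of "\<omega> 0" "\<omega> 1"] Suc.prems[of 0] by simp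
      ultimately show ?case by (cases "s (\<omega> 0) (\<omega> 1)") (simp_all add: TS)
    qed (simp add: T0)
    \<comment> \<open>\<open>f\<close> maps the label of a line at time 0 to its label at time
      \<open>n\<close>. The component transversal to a line scales inversely to the growth along
      it.\<close>
    have comp: "\<exists>f. bij f \<and> (\<forall>b v. \<bar>wedge (u (\<omega> n) (f b)) (cocycle A \<omega> n *v v)\<bar> = exp (- T n b \<omega>) * \<bar>wedge (u (\<omega> 0) b) v\<bar>)"
      if "\<And>k. k < n \<Longrightarrow> 0 < P $ \<omega> k $ \<omega> (Suc k)" for n \<omega>
      using that
    proof (induction n arbitrary: \<omega>)
      case 0
      then show ?case by (intro exI[of _ id]) (simp add: T0 bij_def)
    next
      case (Suc n)
      let ?s = "s (\<omega> 0) (\<omega> 1)"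
      obtain f where f: "bij f" "\<And>b v. \<bar>wedge (u (\<omega> (Suc n)) (f b)) (cocycle A (shift \<omega>) n *v v)\<bar>
          = exp (- T n b (shift \<omega>)) * \<bar>wedge (u (\<omega> 1) b) v\<bar>"
        using Suc.IH[of "shift \<omega>"] Suc.prems by (auto simp: shift_def)
      have flip: "bij (\<lambda>b. b \<noteq> ?s)" by (rule o_bij[of "\<lambda>b. b \<noteq> ?s"]) auto
      show ?case
      proof (intro exI[of _ "f \<circ> (\<lambda>b. b \<noteq> ?s)"] conjI allI)
        show "bij (f \<circ> (\<lambda>b. b \<noteq> ?s))" by (rule bij_comp[OF flip f(1)])
        fix b v
        have "wedge (A (\<omega> 0) *v u (\<omega> 0) b) (u (\<omega> 1) (b \<noteq> ?s)) = 0" using s Suc.prems[of 0] by simp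
        from edge_wedge[OF uni this u, of v]
        have e: "\<bar>wedge (u (\<omega> 1) (b \<noteq> ?s)) (A (\<omega> 0) *v v)\<bar> = exp (- ln (\<alpha> (\<omega> 0) b)) * \<bar>wedge (u (\<omega> 0) b) v\<bar>"
          using pos[of "\<omega> 0" b] by (simp add: \<alpha>_def exp_minus field_simps)
        have "\<bar>wedge (u (\<omega> (Suc n)) ((f \<circ> (\<lambda>b. b \<noteq> ?s)) b)) (cocycle A \<omega> (Suc n) *v v)\<bar>
            = exp (- T n (b \<noteq> ?s) (shift \<omega>)) * (exp (- ln (\<alpha> (\<omega> 0) b)) * \<bar>wedge (u (\<omega> 0) b) v\<bar>)"
          unfolding cocycle_Suc_shift matrix_vector_mul_assoc[symmetric] o_def f(2) e ..
        also have "\<dots> = exp (- T (Suc n) b \<omega>) * \<bar>wedge (u (\<omega> 0) b) v\<bar>"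
          by (simp add: TS exp_diff exp_minus field_simps exp_add)
        finally show "\<bar>wedge (u (\<omega> (Suc n)) ((f \<circ> (\<lambda>b. b \<noteq> ?s)) b)) (cocycle A \<omega> (Suc n) *v v)\<bar>
            = exp (- T (Suc n) b \<omega>) * \<bar>wedge (u (\<omega> 0) b) v\<bar>" .
      qed
    qed
    define N where "N i = rows2 (perp (u i True)) (perp (u i False))" for i
    \<comment> \<open>The sum of squares is symmetric in the two lines, so the relabelling
      \<open>f\<close> does not affect the gauge.\<close>
    have nN: "(norm (N i *v v))\<^sup>2 = (\<Sum>b\<in>UNIV. \<bar>wedge (u i b) v\<bar>\<^sup>2)" for i v
      unfolding N_def rows2_norm_sq by (simp add: perp_inner UNIV_bool)
    let ?K = "2 * exp W"
    have "controlled P A (\<lambda>n. (c + W) * sqrt (real n))"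
      unfolding controlled_def
    proof (intro exI[of _ ?K] conjI allI impI)
      show "1 \<le> ?K" using W(1) one_le_exp_iff[of W] by linarith
      then have K1: "1 \<le> ?K" .
      fix n :: nat assume n: "1 \<le> n"
      define G where "G \<omega> = W + \<bar>signed_sum \<epsilon> \<phi> (\<lambda>_. 0) n \<omega>\<bar> / 2" for \<omega>
      have low: "norm v \<le> ?K ^ n * norm (N i *v v)" for i v
      proof -
        let ?d = "wedge (u i True) (u i False)"
        have "\<bar>?d\<bar> * norm v = norm (wedge v (u i False) *\<^sub>R u i True + wedge (u i True) v *\<^sub>R u i False)"
          by (simp flip: wedge_expand)
        also have "\<dots> \<le> \<bar>wedge v (u i False)\<bar> + \<bar>wedge (u i True) v\<bar>"
          by (rule norm_triangle_le) (simp add: u)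
        also have "\<dots> \<le> 2 * norm (N i *v v)"
          using rows2_component_le(1)[of "perp (u i True)" v "perp (u i False)"]
            rows2_component_le(2)[of "perp (u i False)" v "perp (u i True)"] wedge_anti[of v "u i False"]
          by (simp add: N_def perp_inner)
        finally have "\<bar>?d\<bar> * norm v \<le> 2 * norm (N i *v v)" .
        moreover have "exp (- W) \<le> \<bar>?d\<bar>"
        proof -
          have "exp (- W) \<le> exp (w i)" using W(2)[of i] by simp
          also have "exp (w i) = \<bar>?d\<bar>" unfolding w_def by (rule exp_ln[OF wpos])
          finally show ?thesis .
        qed
        ultimately have "exp (- W) * norm v \<le> 2 * norm (N i *v v)"
          by (meson mult_right_mono norm_ge_zero order_trans)
        then have "norm v \<le> ?K * norm (N i *v v)" by (simp add: exp_minus field_simps)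
        also have "\<dots> \<le> ?K ^ n * norm (N i *v v)"
          using power_increasing[OF n K1] by (intro mult_right_mono) auto
        finally show ?thesis .
      qed
      have up: "norm (N i *v v) \<le> ?K * norm v" for i v
      proof -
        have "\<bar>wedge (u i b) v\<bar> \<le> norm v" for b using wedge_le[of "u i b" v] u by simp
        then have "norm (N i *v v) \<le> norm v + norm v"
          unfolding N_def by (intro rows2_norm_le[THEN order_trans] add_mono) (simp_all add: perp_inner)
        also have "\<dots> \<le> ?K * norm v" using mult_right_mono[of 1 "exp W" "norm v"] W(1) by simp
        finally show ?thesis .
      qed
      have main: "norm (N (\<omega> n) *v (cocycle A \<omega> n *v v)) \<le> exp (G \<omega>) * norm (N (\<omega> 0) *v v)"
        if path: "\<forall>k<n. 0 < P $ \<omega> k $ \<omega> (Suc k)" for \<omega> v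
      proof (rule power2_le_imp_le)
        obtain f where f: "bij f" "\<And>b v. \<bar>wedge (u (\<omega> n) (f b)) (cocycle A \<omega> n *v v)\<bar> = exp (- T n b \<omega>) * \<bar>wedge (u (\<omega> 0) b) v\<bar>"
          using comp[of n \<omega>] path by blast
        \<comment> \<open>The half sum of the two growths is at most \<open>W\<close> in absolute
          value, and their half difference is half of the signed sum.\<close>
        have TG: "- T n b \<omega> \<le> G \<omega>" for b
          using Tdiff[of n \<omega>] Tsum[of n \<omega>] path W(2)[of "\<omega> 0"] W(2)[of "\<omega> n"]
          by (cases b) (simp_all add: G_def abs_if field_simps split: if_splits)
        have "(norm (N (\<omega> n) *v (cocycle A \<omega> n *v v)))\<^sup>2 = (\<Sum>b\<in>UNIV. \<bar>wedge (u (\<omega> n) (f b)) (cocycle A \<omega> n *v v)\<bar>\<^sup>2)"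
          unfolding nN by (rule sum.reindex_bij_betw[OF f(1), symmetric])
        also have "\<dots> = (\<Sum>b\<in>UNIV. (exp (- T n b \<omega>))\<^sup>2 * \<bar>wedge (u (\<omega> 0) b) v\<bar>\<^sup>2)"
          unfolding f(2) power_mult_distrib ..
        also have "\<dots> \<le> (\<Sum>b\<in>UNIV. (exp (G \<omega>))\<^sup>2 * \<bar>wedge (u (\<omega> 0) b) v\<bar>\<^sup>2)"
          using TG by (intro sum_mono mult_right_mono power_mono) auto
        also have "\<dots> = (exp (G \<omega>) * norm (N (\<omega> 0) *v v))\<^sup>2"
          unfolding power_mult_distrib nN sum_distrib_left ..
        finally show "(norm (N (\<omega> n) *v (cocycle A \<omega> n *v v)))\<^sup>2 \<le> (exp (G \<omega>) * norm (N (\<omega> 0) *v v))\<^sup>2" .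
      qed simp
      have fdG: "fdep (Suc n) G" unfolding G_def[abs_def] by (rule fdep_comp[OF signed_sum_fdep])
      have exG: "expect P i G \<le> (c + W) * sqrt (real n)" for i
      proof -
        have r: "1 \<le> sqrt (real n)" using n by simp
        have "expect P i G = expect P i (\<lambda>\<omega>. (1 / 2) * \<bar>signed_sum \<epsilon> \<phi> (\<lambda>_. 0) n \<omega>\<bar> + W)"
          by (simp add: G_def[abs_def] add.commute)
        also have "\<dots> = (1 / 2) * expect P i (\<lambda>\<omega>. \<bar>signed_sum \<epsilon> \<phi> (\<lambda>_. 0) n \<omega>\<bar>) + W"
          by (rule expect_affine[OF P fdep_comp[OF signed_sum_fdep]])
        also have "\<dots> \<le> c * sqrt (real n) + W * sqrt (real n)"
        proof (rule add_mono)
          show "(1 / 2) * expect P i (\<lambda>\<omega>. \<bar>signed_sum \<epsilon> \<phi> (\<lambda>_. 0) n \<omega>\<bar>) \<le> c * sqrt (real n)"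
          proof -
            have "0 \<le> c * sqrt (real n)" using c(1) by simp
            then show ?thesis using c(2)[OF n, of i] by linarith
          qed
          show "W \<le> W * sqrt (real n)" using mult_left_mono[OF r, of W] W(1) by simp
        qed
        finally show ?thesis by (simp add: algebra_simps)
      qed
      have Gnn: "0 \<le> G \<omega>" for \<omega> using W(1) by (simp add: G_def)
      show "gauge_control P A ?K n ((c + W) * sqrt (real n))"
      by (rule gauge_controlI[OF low up fdG Gnn main exG])
    qed
    then show ?thesis using c(1) W(1) by (intro exI[of _ "c + W"]) simp
  qed (rule \<epsilon>)
qed

theorem controlled_sqrt: "\<exists>c>0. controlled P A (\<lambda>n. c * sqrt (real n))"
proof (rule invariant_measures)
  fix m :: "'n \<Rightarrow> (real ^ 2) set \<Rightarrow> real"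
  assume m: "\<And>i E. 0 \<le> m i E"
    "\<And>i E F. E \<in> sets borel \<Longrightarrow> F \<in> sets borel \<Longrightarrow> E \<inter> F = {} \<Longrightarrow> m i (E \<union> F) = m i E + m i F"
    "\<And>i. m i UNIV = 1" "\<And>i. m i {0} = 0"
    "\<And>i j E. 0 < P $ i $ j \<Longrightarrow> E \<in> sets borel \<Longrightarrow> m j E = m i ((*v) (A i) -` E)"
  interpret invariant_family P A m by (rule invariant_family.intro) (fact irr uni m)+
  show ?thesis
  proof (cases rule: invariant_lines)
    case (bounded K)
    \<comment> \<open>The cut at 2 makes the logarithm positive, as required of the constant
      \<open>c\<close>.\<close>
    have "controlled P A (\<lambda>_. ln (max K 2))"
    proof (rule controlled_const[OF P, where N = "\<lambda>_. mat 1"])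
      fix \<omega> n and v :: "real ^ 2" assume "\<And>k. k < n \<Longrightarrow> 0 < P $ \<omega> k $ \<omega> (Suc k)"
      then have "mnorm (cocycle A \<omega> n) \<le> K" by (rule bounded[OF chain_path_cocycle])
      then have "mnorm (cocycle A \<omega> n) * norm v \<le> max K 2 * norm v" by (intro mult_right_mono) auto
      then show "norm (mat 1 *v (cocycle A \<omega> n *v v)) \<le> max K 2 * norm (mat 1 *v v)"
        using mnorm[of "cocycle A \<omega> n" v] by simp
    qed (simp_all add: unimodular_invertible[OF unimodular_one])
    then have "controlled P A (\<lambda>n. ln (max K 2) * sqrt (real n))"
    proof (rule controlled_mono)
      fix n :: nat assume "1 \<le> n"
      then show "ln (max K 2) \<le> ln (max K 2) * sqrt (real n)"
        using mult_left_mono[of 1 "sqrt (real n)" "ln (max K 2)"] by simp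
    qed
    then show ?thesis by (intro exI[of _ "ln (max K 2)"]) simp
  next
    case (line u)
    then show ?thesis by (rule controlled_line)
  next
    case (two_lines u)
    then show ?thesis by (rule controlled_two_lines)
  qed
qed

end

section \<open>The compact normal form case\<close>

lemma mnorm_le_norm: "mnorm M \<le> 4 * norm M"
proof -
  have "mnorm M \<le> (\<Sum>i\<in>UNIV. \<Sum>j\<in>UNIV. \<bar>M $ i $ j\<bar>)"
    using onorm_le_matrix_component_sum[of M] by simp
  also have "\<dots> \<le> (\<Sum>i\<in>(UNIV :: 2 set). \<Sum>j\<in>(UNIV :: 2 set). norm M)"
  proof (intro sum_mono)
    fix i j
    show "\<bar>M $ i $ j\<bar> \<le> norm M"
      using component_le_norm_cart[of "M $ i" j] Finite_Cartesian_Product.norm_nth_le[of M i] by linarith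
  qed
  finally show ?thesis by (simp add: sum_2)
qed

text \<open>Along a path the conjugating matrices cancel between consecutive factors, so conjugated
  products stay in the compact group. In the gauge given by the inverses of the \<open>C i\<close>
  they are bounded.\<close>

lemma controlled_compact:
  fixes P :: "real ^ 'n::finite ^ 'n"
  assumes P: "stochastic P" and cnf: "compact_normal_form A P"
  shows "\<exists>c>0. controlled P (\<lambda>i. det_normalized (A i)) (\<lambda>_. c)"
proof -
  obtain C K where C: "\<And>i. invertible (C i)" and K: "GL2_subgroup K" "compact K"
    and edge: "\<And>i j. 0 < P $ i $ j \<Longrightarrow> matrix_inv (C j) ** det_normalized (A i) ** C i \<in> K"
    using cnf unfolding compact_normal_form_def by blast
  obtain b where b: "\<And>M. M \<in> K \<Longrightarrow> norm M \<le> b"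
    using compact_imp_bounded[OF K(2)] unfolding bounded_iff by blast
  let ?A = "\<lambda>i. det_normalized (A i)"
  have mem: "matrix_inv (C (\<omega> n)) ** cocycle ?A \<omega> n ** C (\<omega> 0) \<in> K"
    if "\<And>k. k < n \<Longrightarrow> 0 < P $ \<omega> k $ \<omega> (Suc k)" for n \<omega>
    using that
  proof (induction n)
    case 0
    then show ?case using K(1) by (simp add: matrix_inv_left[OF C] GL2_subgroup_def)
  next
    case (Suc n)
    have IH: "matrix_inv (C (\<omega> n)) ** cocycle ?A \<omega> n ** C (\<omega> 0) \<in> K" using Suc by simp
    have "matrix_inv (C (\<omega> (Suc n))) ** ?A (\<omega> n) ** C (\<omega> n) \<in> K" using edge Suc.prems by simp
    then have "(matrix_inv (C (\<omega> (Suc n))) ** ?A (\<omega> n) ** C (\<omega> n)) **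
        (matrix_inv (C (\<omega> n)) ** cocycle ?A \<omega> n ** C (\<omega> 0)) \<in> K"
      using IH K(1) unfolding GL2_subgroup_def by blast
    also have "(matrix_inv (C (\<omega> (Suc n))) ** ?A (\<omega> n) ** C (\<omega> n)) **
        (matrix_inv (C (\<omega> n)) ** cocycle ?A \<omega> n ** C (\<omega> 0))
      = matrix_inv (C (\<omega> (Suc n))) ** ?A (\<omega> n) ** (C (\<omega> n) ** matrix_inv (C (\<omega> n))) ** cocycle ?A \<omega> n ** C (\<omega> 0)"
      by (simp only: matrix_mul_assoc)
    finally show ?case by (simp add: matrix_inv_right[OF C] matrix_mul_assoc)
  qed
  \<comment> \<open>\<open>b\<close> bounds the Euclidean norm of the entries, and passing to the
    operator norm costs the factor 4.\<close>
  let ?M = "max 2 (4 * b)"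
  have "controlled P ?A (\<lambda>_. ln ?M)"
  proof (rule controlled_const[OF P, where N = "\<lambda>i. matrix_inv (C i)"])
    show "1 \<le> ?M" by simp
    show "invertible (matrix_inv (C i))" for i
      using matrix_inv_left[OF C] matrix_inv_right[OF C] unfolding invertible_def by blast
    fix \<omega> n and v :: "real ^ 2" assume path: "\<And>k. k < n \<Longrightarrow> 0 < P $ \<omega> k $ \<omega> (Suc k)"
    let ?T = "matrix_inv (C (\<omega> n)) ** cocycle ?A \<omega> n ** C (\<omega> 0)"
    have "?T ** matrix_inv (C (\<omega> 0)) = matrix_inv (C (\<omega> n)) ** cocycle ?A \<omega> n"
      by (simp add: matrix_inv_right[OF C] flip: matrix_mul_assoc)
    then have "matrix_inv (C (\<omega> n)) *v (cocycle ?A \<omega> n *v v) = ?T *v (matrix_inv (C (\<omega> 0)) *v v)"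
      by (simp add: matrix_vector_mul_assoc)
    also have "norm \<dots> \<le> mnorm ?T * norm (matrix_inv (C (\<omega> 0)) *v v)" by (rule mnorm)
    also have "\<dots> \<le> ?M * norm (matrix_inv (C (\<omega> 0)) *v v)"
      using mnorm_le_norm[of ?T] b[OF mem[of n \<omega>, OF path]] by (intro mult_right_mono) auto
    finally show "norm (matrix_inv (C (\<omega> n)) *v (cocycle ?A \<omega> n *v v)) \<le> ?M * norm (matrix_inv (C (\<omega> 0)) *v v)" .
  qed
  then show ?thesis by (intro exI[of _ "ln ?M"]) simp
qed

section \<open>Perturbation of controlled pairs\<close>

text \<open>The probability of a path of \<open>n\<close> steps under \<open>Q\<close> is at most
  \<open>(1 + d) ^ n\<close> times that under \<open>P\<close>. A function of \<open>Suc n\<close>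
  states involves \<open>n\<close> steps only, the starting state being fixed.\<close>

lemma expect_change_chain:
  fixes P Q :: "real ^ 'n::finite ^ 'n"
  assumes P: "stochastic P" and Q: "stochastic Q" and d: "0 \<le> d"
    and le: "\<And>i j. Q $ i $ j \<le> (1 + d) * P $ i $ j"
    and G: "fdep (Suc n) G" "\<And>\<omega>. 0 \<le> G \<omega>"
  shows "expect Q i G \<le> (1 + d) ^ n * expect P i G"
  using G
proof (induction n arbitrary: i G)
  case 0
  define c where "c = G (\<lambda>_. i)"
  have c: "G \<omega> = c" if "\<omega> 0 = i" for \<omega>
    unfolding c_def using that by (intro fdepD[OF 0(1)]) simp
  have "expect R i G = c" if "stochastic R" for R
  proof -
    have "expect R i G = expect R i (\<lambda>_. c)"
      by (rule expect_start_cong[OF that 0(1)]) (auto simp: fdep_def c)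
    then show ?thesis by (simp add: expect_const[OF that])
  qed
  then show ?case using P Q by simp
next
  case (Suc n)
  let ?G = "\<lambda>\<omega>. G (case_nat i \<omega>)"
  have IH: "expect Q j ?G \<le> (1 + d) ^ n * expect P j ?G" for j
    by (rule Suc.IH[OF fdep_prepend[OF Suc.prems(1)]]) (rule Suc.prems)
  have nn: "0 \<le> expect P j ?G" for j unfolding expect_def using Suc.prems(2) by simp
  have "expect Q i G = (\<Sum>j\<in>UNIV. Q $ i $ j * expect Q j ?G)" by (rule expect_step_fdep[OF Q Suc.prems(1)])
  also have "\<dots> \<le> (\<Sum>j\<in>UNIV. ((1 + d) * P $ i $ j) * ((1 + d) ^ n * expect P j ?G))"
  proof (rule sum_mono)
    fix j
    have "Q $ i $ j * expect Q j ?G \<le> Q $ i $ j * ((1 + d) ^ n * expect P j ?G)"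
      by (intro mult_left_mono IH stochastic_nonneg[OF Q])
    also have "\<dots> \<le> ((1 + d) * P $ i $ j) * ((1 + d) ^ n * expect P j ?G)"
      using nn d by (intro mult_right_mono le mult_nonneg_nonneg) auto
    finally show "Q $ i $ j * expect Q j ?G \<le> ((1 + d) * P $ i $ j) * ((1 + d) ^ n * expect P j ?G)" .
  qed
  also have "\<dots> = (1 + d) ^ Suc n * expect P i G"
    by (simp add: expect_step_fdep[OF P Suc.prems(1), of i] sum_distrib_left mult_ac)
  finally show ?case .
qed

text \<open>The difference of the products is split at the last factor: either \<open>A\<close> acts
  on the old error or the new error \<open>A - B\<close> acts on the product of the
  \<open>B\<close>, whose factors have norm at most \<open>K + 1\<close>.\<close>

lemma cocycle_perturbation:
  assumes A: "\<And>i. mnorm (A i) \<le> K" and K: "1 \<le> K" and d: "0 \<le> d" "d \<le> 1"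
    and close: "\<And>i. mnorm (A i - B i) \<le> d"
  shows "norm (cocycle A \<omega> n *v v - cocycle B \<omega> n *v v) \<le> d * (K + 1) ^ n * norm v"
proof (induction n)
  case 0
  then show ?case using d by simp
next
  case (Suc n)
  have diff: "norm (A i *v w - B i *v w) \<le> d * norm w" for i w
  proof -
    have "norm ((A i - B i) *v w) \<le> d * norm w"
      using mnorm[of "A i - B i" w] mult_right_mono[OF close[of i], of "norm w"] by simp
    then show ?thesis by (simp add: matrix_vector_mult_diff_rdistrib)
  qed
  have Aw: "norm (A i *v w) \<le> K * norm w" for i w
    using mnorm[of "A i" w] mult_right_mono[OF A[of i], of "norm w"] by simp
  have "mnorm (B i) \<le> K + 1" for i
  proof (rule mnorm_le)
    fix w
    have "norm (B i *v w) \<le> norm (A i *v w) + norm (A i *v w - B i *v w)"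
      using norm_triangle_ineq4[of "A i *v w" "A i *v w - B i *v w"] by simp
    also have "\<dots> \<le> K * norm w + 1 * norm w"
      using diff[of i w] d mult_right_mono[OF d(2), of "norm w"] by (intro add_mono Aw) auto
    finally show "norm (B i *v w) \<le> (K + 1) * norm w" by (simp add: algebra_simps)
  qed (use K in simp)
  then have "mnorm (cocycle B \<omega> n) \<le> (K + 1) ^ n" by (rule cocycle_mnorm_le) (use K in simp)
  then have Bn: "norm (cocycle B \<omega> n *v v) \<le> (K + 1) ^ n * norm v"
    using mnorm[of "cocycle B \<omega> n" v] mult_right_mono[of "mnorm (cocycle B \<omega> n)" "(K + 1) ^ n" "norm v"] by simp
  let ?x = "cocycle A \<omega> n *v v" and ?y = "cocycle B \<omega> n *v v"
  have "cocycle A \<omega> (Suc n) *v v - cocycle B \<omega> (Suc n) *v v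
      = A (\<omega> n) *v (?x - ?y) + (A (\<omega> n) *v ?y - B (\<omega> n) *v ?y)"
    by (simp add: matrix_vector_mult_diff_distrib flip: matrix_vector_mul_assoc)
  then have "norm (cocycle A \<omega> (Suc n) *v v - cocycle B \<omega> (Suc n) *v v)
      \<le> norm (A (\<omega> n) *v (?x - ?y)) + norm (A (\<omega> n) *v ?y - B (\<omega> n) *v ?y)"
    by (simp only: norm_triangle_ineq)
  also have "\<dots> \<le> K * (d * (K + 1) ^ n * norm v) + d * ((K + 1) ^ n * norm v)"
  proof (rule add_mono)
    show "norm (A (\<omega> n) *v (?x - ?y)) \<le> K * (d * (K + 1) ^ n * norm v)"
      using Aw[of "\<omega> n" "?x - ?y"] mult_left_mono[OF Suc, of K] K by linarith
    show "norm (A (\<omega> n) *v ?y - B (\<omega> n) *v ?y) \<le> d * ((K + 1) ^ n * norm v)"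
      using diff[of "\<omega> n" ?y] mult_left_mono[OF Bn d(1)] by linarith
  qed
  also have "\<dots> = d * (K + 1) ^ Suc n * norm v" by (simp add: algebra_simps)
  finally show ?case .
qed

text \<open>The gauge of \<open>A\<close> at horizon \<open>n\<close> serves for \<open>B\<close> as
  well: changing the matrices at most doubles the growth factor, hence \<open>ln 2\<close>, and
  changing the chain multiplies the mean by at most \<open>exp 1 \<le> 3\<close>.\<close>

lemma growth_perturbation:
  fixes P :: "real ^ 'n::finite ^ 'n"
  assumes P: "stochastic P" and irr: "irreducible_chain P" and ctrl: "controlled P A \<beta>"
  obtains \<kappa> where "2 \<le> \<kappa>"
    "\<And>n B Q d. 1 \<le> n \<Longrightarrow> (\<And>i. unimodular (B i)) \<Longrightarrow> stochastic Q \<Longrightarrow> same_transition_graph P Q \<Longrightarrow>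
      0 \<le> d \<Longrightarrow> (\<And>i. mnorm (A i - B i) \<le> d) \<Longrightarrow> (\<And>i j. Q $ i $ j \<le> (1 + d) * P $ i $ j) \<Longrightarrow>
      \<kappa> ^ n * d \<le> 1 \<Longrightarrow> growth Q B \<le> (ln 2 + 3 * \<beta> n) / real n"
proof -
  obtain K where K: "1 \<le> K" and step: "\<And>n. 1 \<le> n \<Longrightarrow> gauge_control P A K n (\<beta> n)"
    using ctrl unfolding controlled_def by blast
  obtain K1 where K1: "1 \<le> K1" "\<And>i. mnorm (A i) \<le> K1" using finite_upper[of "\<lambda>i. mnorm (A i)"] by blast
  \<comment> \<open>One \<open>K\<close> for the upper gauge bound, one for the lower one, which
    degenerates like \<open>K ^ n\<close>, and \<open>K1 + 1\<close> for the difference of the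
    products.\<close>
  let ?\<kappa> = "K * K * (K1 + 1)"
  have "1 * 1 * (1 + 1) \<le> ?\<kappa>" using K K1(1) by (intro mult_mono) auto
  then have \<kappa>2: "2 \<le> ?\<kappa>" by simp
  show ?thesis
  proof (rule that[OF \<kappa>2])
    fix n :: nat and B :: "'n \<Rightarrow> real ^ 2 ^ 2" and Q :: "real ^ 'n ^ 'n" and d :: real
    assume n: "1 \<le> n" and uB: "\<And>i. unimodular (B i)" and Q: "stochastic Q"
      and graph: "same_transition_graph P Q" and d: "0 \<le> d"
      and close: "\<And>i. mnorm (A i - B i) \<le> d"
      and le: "\<And>i j. Q $ i $ j \<le> (1 + d) * P $ i $ j" and small: "?\<kappa> ^ n * d \<le> 1"
    have irrQ: "irreducible_chain Q" by (rule irreducible_same_graph[OF irr graph])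
    obtain N :: "'n \<Rightarrow> real ^ 2 ^ 2" and G where NG: "\<forall>i v. norm v \<le> K ^ n * norm (N i *v v)"
      "\<forall>i v. norm (N i *v v) \<le> K * norm v" "fdep (Suc n) G" "\<forall>\<omega>. 0 \<le> G \<omega>"
      "\<forall>\<omega>. (\<forall>k<n. 0 < P $ \<omega> k $ \<omega> (Suc k)) \<longrightarrow>
        (\<forall>v. norm (N (\<omega> n) *v (cocycle A \<omega> n *v v)) \<le> exp (G \<omega>) * norm (N (\<omega> 0) *v v))"
      "\<forall>i. expect P i G \<le> \<beta> n"
      using step[OF n] unfolding gauge_control_def by - (elim exE, elim conjE, rule that)
    note low = NG(1)[rule_format] and up = NG(2)[rule_format] and fdG = NG(3)
      and Gnn = NG(4)[rule_format] and exG = NG(6)[rule_format]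
    have main: "norm (N (\<omega> n) *v (cocycle A \<omega> n *v v)) \<le> exp (G \<omega>) * norm (N (\<omega> 0) *v v)"
      if "\<forall>k<n. 0 < P $ \<omega> k $ \<omega> (Suc k)" for \<omega> v
      using NG(5) that by blast
    \<comment> \<open>As \<open>?\<kappa> \<ge> 2\<close>, smallness of
      \<open>?\<kappa> ^ n * d\<close> also gives \<open>n * d \<le> 1\<close>, which bounds
      \<open>(1 + d) ^ n\<close>.\<close>
    have "real n \<le> ?\<kappa> ^ n"
    proof -
      have "real n \<le> 2 ^ n" using of_nat_less_two_power[of n] by (simp add: less_imp_le)
      also have "\<dots> \<le> ?\<kappa> ^ n" using \<kappa>2 by (intro power_mono) auto
      finally show ?thesis .
    qed
    then have nd: "real n * d \<le> 1" using mult_right_mono[of "real n" "?\<kappa> ^ n" d] d small by linarith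
    have "1 * d \<le> real n * d" using n d by (intro mult_right_mono) auto
    then have d1: "d \<le> 1" using nd by simp
    have "growth Q B \<le> (\<integral>\<omega>. ln 2 + G \<omega> \<partial>stationary_chain Q) / real n"
    proof (rule growth_le_gauge[OF Q irrQ uB n, of "Suc n" "\<lambda>\<omega>. ln 2 + G \<omega>" "K ^ n" N])
      show "fdep (Suc n) (\<lambda>\<omega>. ln 2 + G \<omega>)" by (rule fdep_comp[OF fdG])
      show "norm v \<le> K ^ n * norm (N i *v v)" for i v by (rule low)
      show "0 < K ^ n" using K by simp
      show "AE \<omega> in stationary_chain Q. \<forall>v. norm (N (\<omega> n) *v (cocycle B \<omega> n *v v)) \<le> exp (ln 2 + G \<omega>) * norm (N (\<omega> 0) *v v)"
        using AE_edges[OF Q irrQ]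
      proof eventually_elim
        case (elim \<omega>)
        then have path: "\<forall>k<n. 0 < P $ \<omega> k $ \<omega> (Suc k)"
          using graph by (simp add: same_transition_graph_def)
        show ?case
        proof
          fix v
          let ?N = "norm (N (\<omega> 0) *v v)"
          let ?D = "cocycle B \<omega> n *v v - cocycle A \<omega> n *v v"
          have "norm (N (\<omega> n) *v ?D) \<le> K * norm ?D" by (rule up)
          also have "\<dots> \<le> K * (d * (K1 + 1) ^ n * norm v)"
            using cocycle_perturbation[of A K1 d B \<omega> n v] K1 d d1 close K
            by (intro mult_left_mono) (auto simp: norm_minus_commute)
          also have "\<dots> \<le> K ^ n * (d * (K1 + 1) ^ n * (K ^ n * ?N))"
            using power_increasing[OF n K] low[of v "\<omega> 0"] d K K1(1) by (intro mult_mono) auto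
          also have "\<dots> = (?\<kappa> ^ n * d) * ?N" by (simp add: power_mult_distrib)
          also have "\<dots> \<le> 1 * ?N" by (intro mult_right_mono small) simp
          \<comment> \<open>Nonnegativity of \<open>G\<close> lets the error be absorbed by the main
            term.\<close>
          also have "\<dots> \<le> exp (G \<omega>) * ?N" using Gnn by (intro mult_right_mono) auto
          finally have "norm (N (\<omega> n) *v ?D) \<le> exp (G \<omega>) * ?N" .
          moreover have "N (\<omega> n) *v (cocycle B \<omega> n *v v) = N (\<omega> n) *v (cocycle A \<omega> n *v v) + N (\<omega> n) *v ?D"
            by (simp add: matrix_vector_mult_diff_distrib)
          then have "norm (N (\<omega> n) *v (cocycle B \<omega> n *v v))
              \<le> norm (N (\<omega> n) *v (cocycle A \<omega> n *v v)) + norm (N (\<omega> n) *v ?D)"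
            by (simp only: norm_triangle_ineq)
          ultimately show "norm (N (\<omega> n) *v (cocycle B \<omega> n *v v)) \<le> exp (ln 2 + G \<omega>) * ?N"
            using main[OF path, of v] by (simp add: exp_add)
        qed
      qed
    qed
    also have "(\<integral>\<omega>. ln 2 + G \<omega> \<partial>stationary_chain Q) \<le> ln 2 + 3 * \<beta> n"
    proof -
      let ?q = "stationary_vector Q"
      have q: "prob_vector ?q" by (rule prob_vector_stationary[OF Q irrQ])
      have fd: "fdep (Suc n) (\<lambda>\<omega>. 1 * G \<omega> + ln 2)" by (rule fdep_comp[OF fdG])
      obtain b where b: "\<And>\<omega>. \<bar>1 * G \<omega> + ln 2\<bar> \<le> b" using fdep_bounded[OF fd] by blast
      have exQ: "expect Q i G \<le> 3 * \<beta> n" for i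
      proof -
        have "expect Q i G \<le> (1 + d) ^ n * expect P i G" by (rule expect_change_chain[OF P Q d le fdG Gnn])
        also have "(1 + d) ^ n \<le> exp d ^ n" using d by (intro power_mono exp_ge_add_one_self) auto
        also have "exp d ^ n = exp (real n * d)" by (simp add: exp_of_nat_mult)
        also have "\<dots> \<le> exp 1" using nd by simp
        also have "\<dots> \<le> 3" by (rule exp_le)
        finally have "expect Q i G \<le> 3 * expect P i G"
          using Gnn by (simp add: expect_def mult_right_mono)
        then show ?thesis using exG[of i] by simp
      qed
      have "(\<integral>\<omega>. ln 2 + G \<omega> \<partial>stationary_chain Q) = (\<integral>\<omega>. 1 * G \<omega> + ln 2 \<partial>markov_measure Q ?q)"
        by (simp add: stationary_chain_def add.commute)
      also have "\<dots> = (\<Sum>i\<in>UNIV. ?q $ i * expect Q i (\<lambda>\<omega>. 1 * G \<omega> + ln 2))"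
        by (rule integral_markov_measure_start[OF Q q fdep_borel[OF fd] b])
      also have "\<dots> = (\<Sum>i\<in>UNIV. ?q $ i * (1 * expect Q i G + ln 2))"
        by (simp only: expect_affine[OF Q fdG])
      also have "\<dots> \<le> (\<Sum>i\<in>UNIV. ?q $ i * (3 * \<beta> n + ln 2))"
        using exQ q by (intro sum_mono mult_left_mono) (auto simp: prob_vector_def)
      also have "\<dots> = 3 * \<beta> n + ln 2" using q by (simp add: prob_vector_def flip: sum_distrib_right)
      finally show ?thesis by simp
    qed
    finally show "growth Q B \<le> (ln 2 + 3 * \<beta> n) / real n" using n by (simp add: divide_right_mono)
  qed
qed

section \<open>Lyapunov exponents and determinants\<close>

lemma matrix_mult_scaleR:
  "(c *\<^sub>R M) ** (d *\<^sub>R N) = (c * d) *\<^sub>R (M ** (N :: real ^ 2 ^ 2))"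
  by (simp add: vec_eq_iff matrix_matrix_mult_def sum_2 algebra_simps)

lemma det_scaleR2: "det (c *\<^sub>R (M :: real ^ 2 ^ 2)) = c\<^sup>2 * det M"
  by (simp add: det_2 power2_eq_square algebra_simps)

lemma det_normalized_eq:
  assumes "invertible M" shows "det_normalized M = (1 / sqrt \<bar>det M\<bar>) *\<^sub>R M"
proof -
  have "0 < \<bar>det M\<bar>" using assms by (simp add: invertible_det_nz)
  then have "\<bar>det M\<bar> powr (- (1 / 2)) = 1 / sqrt \<bar>det M\<bar>"
    by (simp only: powr_minus_divide powr_half_sqrt)
  then show ?thesis by (simp add: det_normalized_def)
qed

lemma unimodular_det_normalized:
  assumes "invertible M" shows "unimodular (det_normalized M)"
proof -
  have "0 < \<bar>det M\<bar>" using assms by (simp add: invertible_det_nz)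
  then show ?thesis
    by (simp add: det_normalized_eq[OF assms] unimodular_def det_scaleR2 abs_mult power_divide)
qed

definition half_log_det :: "real ^ 2 ^ 2 \<Rightarrow> real" where
  "half_log_det M = ln \<bar>det M\<bar> / 2"

lemma exp_half_log_det:
  assumes "invertible M" shows "exp (half_log_det M) = sqrt \<bar>det M\<bar>"
proof -
  have p: "0 < \<bar>det M\<bar>" using assms by (simp add: invertible_det_nz)
  have "(exp (half_log_det M))\<^sup>2 = exp (ln \<bar>det M\<bar>)"
    by (simp add: half_log_det_def power2_eq_square flip: exp_add)
  then have "(exp (half_log_det M))\<^sup>2 = \<bar>det M\<bar>" using p by simp
  then show ?thesis by (metis exp_ge_zero real_sqrt_unique)
qed

lemma cocycle_det_normalized:
  assumes inv: "\<And>i. invertible (A i)"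
  shows "cocycle A \<omega> n = exp (\<Sum>k<n. half_log_det (A (\<omega> k))) *\<^sub>R cocycle (\<lambda>i. det_normalized (A i)) \<omega> n"
proof (induction n)
  case (Suc n)
  have "A i = exp (half_log_det (A i)) *\<^sub>R det_normalized (A i)" for i
    using inv[of i] by (simp add: exp_half_log_det[OF inv] det_normalized_eq[OF inv] invertible_det_nz)
  then have "cocycle A \<omega> (Suc n) = (exp (half_log_det (A (\<omega> n))) *\<^sub>R det_normalized (A (\<omega> n))) **
      (exp (\<Sum>k<n. half_log_det (A (\<omega> k))) *\<^sub>R cocycle (\<lambda>i. det_normalized (A i)) \<omega> n)"
    unfolding cocycle.simps Suc[symmetric] by metis
  also have "\<dots> = (exp (half_log_det (A (\<omega> n))) * exp (\<Sum>k<n. half_log_det (A (\<omega> k)))) *\<^sub>R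
      cocycle (\<lambda>i. det_normalized (A i)) \<omega> (Suc n)"
    by (simp add: matrix_mult_scaleR)
  also have "exp (half_log_det (A (\<omega> n))) * exp (\<Sum>k<n. half_log_det (A (\<omega> k)))
      = exp (\<Sum>k<Suc n. half_log_det (A (\<omega> k)))"
    by (simp flip: exp_add)
  finally show ?case .
qed simp

section \<open>Comparison of operator norms\<close>

lemma norm_equivalent:
  fixes \<nu> :: "real ^ 2 \<Rightarrow> real"
  assumes \<nu>: "is_norm \<nu>"
  obtains a b where "0 < a" "0 < b" "\<And>v. a * norm v \<le> \<nu> v" "\<And>v. \<nu> v \<le> b * norm v"
proof -
  have nn: "0 \<le> \<nu> v" and z: "\<nu> v = 0 \<longleftrightarrow> v = 0" and sc: "\<nu> (c *\<^sub>R v) = \<bar>c\<bar> * \<nu> v"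
    and tri: "\<nu> (v + w) \<le> \<nu> v + \<nu> w" for v w c
    using \<nu> unfolding is_norm_def by blast+
  define b where "b = \<nu> (axis 1 1) + \<nu> (axis 2 1) + 1"
  have b: "0 < b" unfolding b_def using nn[of "axis 1 1"] nn[of "axis 2 1"] by linarith
  have up: "\<nu> v \<le> b * norm v" for v
  proof -
    have "v = v $ 1 *\<^sub>R axis 1 1 + v $ 2 *\<^sub>R axis 2 1"
      by (simp add: vec_eq_iff forall_2 axis_def)
    then have "\<nu> v \<le> \<bar>v $ 1\<bar> * \<nu> (axis 1 1) + \<bar>v $ 2\<bar> * \<nu> (axis 2 1)"
      using tri[of "v $ 1 *\<^sub>R axis 1 1" "v $ 2 *\<^sub>R axis 2 1"] by (simp add: sc)
    also have "\<dots> \<le> norm v * \<nu> (axis 1 1) + norm v * \<nu> (axis 2 1)"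
      by (intro add_mono mult_right_mono component_le_norm_cart nn)
    also have "\<dots> \<le> b * norm v" by (simp add: b_def algebra_simps)
    finally show ?thesis .
  qed
  have lip: "\<bar>\<nu> v - \<nu> w\<bar> \<le> b * norm (v - w)" for v w
  proof -
    have "\<nu> v \<le> \<nu> (v - w) + \<nu> w" "\<nu> w \<le> \<nu> (w - v) + \<nu> v" using tri[of "v - w" w] tri[of "w - v" v] by simp_all
    then show ?thesis using up[of "v - w"] up[of "w - v"] by (simp add: norm_minus_commute)
  qed
  have cont: "continuous_on (sphere 0 1) \<nu>"
  proof (rule continuous_onI)
    fix x e assume "0 < (e :: real)"
    then have "0 < e / b" using b by simp
    moreover have "dist (\<nu> x') (\<nu> x) \<le> e" if "dist x' x < e / b" for x'
    proof -
      have "b * norm (x' - x) \<le> b * (e / b)" using that b by (intro mult_left_mono) (auto simp: dist_norm)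
      then show ?thesis using lip[of x' x] b by (simp add: dist_real_def)
    qed
    ultimately show "\<exists>d>0. \<forall>x'\<in>sphere 0 1. dist x' x < d \<longrightarrow> dist (\<nu> x') (\<nu> x) \<le> e" by blast
  qed
  have "axis 1 1 \<in> sphere (0 :: real ^ 2) 1" by (simp add: norm_axis_1)
  then have "\<exists>x\<in>sphere 0 1. \<forall>y\<in>sphere 0 1. \<nu> x \<le> \<nu> y"
    by (intro continuous_attains_inf[OF compact_sphere _ cont]) blast
  then obtain x where x: "norm x = 1" "\<And>y. norm y = 1 \<Longrightarrow> \<nu> x \<le> \<nu> y" by auto
  have "x \<noteq> 0" using x(1) by auto
  then have a: "0 < \<nu> x" using nn[of x] z[of x] by linarith
  have low: "\<nu> x * norm v \<le> \<nu> v" for v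
  proof (cases "v = 0")
    case False
    have "\<nu> x \<le> \<nu> (v /\<^sub>R norm v)" using False by (intro x(2)) simp
    then show ?thesis using False by (simp add: sc field_simps)
  qed (simp add: nn)
  show ?thesis by (rule that[OF a b low up])
qed

lemma op_norm_equivalent:
  assumes \<nu>: "is_norm \<nu>"
  obtains c where "1 \<le> c" "\<And>M. mnorm M \<le> c * op_norm \<nu> M" "\<And>M. op_norm \<nu> M \<le> c * mnorm M"
proof -
  obtain a b where ab: "0 < a" "0 < b" and low: "\<And>v. a * norm v \<le> \<nu> v" and up: "\<And>v. \<nu> v \<le> b * norm v"
    using norm_equivalent[OF \<nu>] by blast
  have nn: "0 \<le> \<nu> v" and z: "\<nu> v = 0 \<longleftrightarrow> v = 0" for v using \<nu> unfolding is_norm_def by blast+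
  define c where "c = b / a"
  have c1: "1 \<le> c"
  proof -
    have "a * norm (axis 1 1 :: real ^ 2) \<le> b * norm (axis 1 1 :: real ^ 2)" using low up order_trans by blast
    then show ?thesis using ab by (simp add: c_def norm_axis_1)
  qed
  have ratio: "\<nu> (M *v v) / \<nu> v \<le> c * mnorm M" for M v
  proof (cases "v = 0")
    case True
    then show ?thesis using z[of 0] c1 mnorm_nonneg[of M] by simp
  next
    case False
    have pos: "0 < \<nu> v" using False nn[of v] z[of v] by linarith
    have "\<nu> (M *v v) \<le> b * (mnorm M * norm v)"
      using up[of "M *v v"] mult_left_mono[OF mnorm[of M v], of b] ab by linarith
    also have "\<dots> = c * mnorm M * (a * norm v)" using ab by (simp add: c_def)
    also have "\<dots> \<le> c * mnorm M * \<nu> v" using low c1 mnorm_nonneg[of M] by (intro mult_left_mono) auto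
    finally show ?thesis using pos by (simp add: pos_divide_le_eq)
  qed
  have bdd: "bdd_above (range (\<lambda>v. \<nu> (M *v v) / \<nu> v))" for M
    using ratio by (intro bdd_aboveI2)
  have le: "op_norm \<nu> M \<le> c * mnorm M" for M
    unfolding op_norm_def by (rule cSUP_least) (use ratio in auto)
  have op: "\<nu> (M *v v) / \<nu> v \<le> op_norm \<nu> M" for M v
    unfolding op_norm_def by (rule cSUP_upper[OF _ bdd]) simp
  have op0: "0 \<le> op_norm \<nu> M" for M
    using op[of M 0] z[of 0] by simp
  have ge: "mnorm M \<le> c * op_norm \<nu> M" for M
  proof (rule mnorm_le)
    show "0 \<le> c * op_norm \<nu> M" using c1 op0[of M] by simp
    fix v
    show "norm (M *v v) \<le> c * op_norm \<nu> M * norm v"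
    proof (cases "v = 0")
      case False
      have pos: "0 < \<nu> v" using False nn[of v] z[of v] by linarith
      have "a * norm (M *v v) \<le> op_norm \<nu> M * \<nu> v"
        using low[of "M *v v"] op[of M v] pos by (simp add: pos_divide_le_eq)
      also have "\<dots> \<le> op_norm \<nu> M * (b * norm v)" by (intro mult_left_mono up op0)
      finally show ?thesis using ab by (simp add: c_def field_simps)
    qed simp
  qed
  show ?thesis by (rule that[OF c1 ge le])
qed

text \<open>By the two formulas below this is half the sum of the two exponents.\<close>

definition mean_half_log_det :: "real ^ 'n::finite ^ 'n \<Rightarrow> ('n \<Rightarrow> real ^ 2 ^ 2) \<Rightarrow> real" where
  "mean_half_log_det P A = (\<Sum>i\<in>UNIV. stationary_vector P $ i * half_log_det (A i))"

lemma matrix_inv_scaleR: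
  assumes "invertible (M :: real ^ 2 ^ 2)" "c \<noteq> 0"
  shows "matrix_inv (c *\<^sub>R M) = (1 / c) *\<^sub>R matrix_inv M"
proof (rule matrix_inv_eqI)
  show "(c *\<^sub>R M) ** ((1 / c) *\<^sub>R matrix_inv M) = mat 1" "((1 / c) *\<^sub>R matrix_inv M) ** (c *\<^sub>R M) = mat 1"
    using assms by (simp_all add: matrix_mult_scaleR matrix_inv_left matrix_inv_right)
qed

text \<open>The scalar part of the product has a rate by Birkhoff's theorem; it enters the inverse
  with the opposite sign, whereas the unimodular part and its inverse have equal norms. Equivalent
  norms change logarithms by at most \<open>ln c\<close>.\<close>

lemma
  fixes P :: "real ^ 'n::finite ^ 'n"
  assumes \<nu>: "is_norm \<nu>" and P: "stochastic P" and irr: "irreducible_chain P" and inv: "\<And>i. invertible (A i)"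
  shows lyapunov_plus_eq: "lyapunov_plus \<nu> A P = mean_half_log_det P A + growth P (\<lambda>i. det_normalized (A i))"
    and lyapunov_minus_eq: "lyapunov_minus \<nu> A P = mean_half_log_det P A - growth P (\<lambda>i. det_normalized (A i))"
proof -
  interpret ergodic_system "stationary_chain P" shift by (rule chain_ergodic_system[OF P irr])
  let ?N = "\<lambda>i. det_normalized (A i)" and ?p = "stationary_vector P"
  let ?d = "mean_half_log_det P A" and ?g = "growth P ?N"
  have p: "prob_vector ?p" by (rule prob_vector_stationary[OF P irr])
  have uni: "unimodular (?N i)" for i by (rule unimodular_det_normalized[OF inv])
  obtain c where c: "1 \<le> c" "\<And>M. mnorm M \<le> c * op_norm \<nu> M" "\<And>M. op_norm \<nu> M \<le> c * mnorm M"
    using op_norm_equivalent[OF \<nu>] by blast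
  have ln_close: "\<bar>ln (op_norm \<nu> M) - ln (mnorm M)\<bar> \<le> ln c" if m: "0 < mnorm M" for M
  proof -
    have "0 < c * op_norm \<nu> M" using c(2)[of M] m by linarith
    then have o: "0 < op_norm \<nu> M" using c(1) by (simp add: zero_less_mult_iff)
    have "ln (mnorm M) \<le> ln (c * op_norm \<nu> M)" using c(2)[of M] m by simp
    moreover have "ln (op_norm \<nu> M) \<le> ln (c * mnorm M)" using c(3)[of M] o by simp
    ultimately show ?thesis using o m c(1) by (simp add: ln_mult_pos abs_le_iff)
  qed
  define S where "S n \<omega> = (\<Sum>k<n. half_log_det (A (\<omega> k)))" for n :: nat and \<omega> :: "nat \<Rightarrow> 'n"
  have Cn: "cocycle A \<omega> n = exp (S n \<omega>) *\<^sub>R cocycle ?N \<omega> n" for \<omega> n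
    unfolding S_def by (rule cocycle_det_normalized[OF inv])
  have uC: "unimodular (cocycle ?N \<omega> n)" for \<omega> n by (rule cocycle_unimodular[OF uni])
  have pos: "0 < mnorm (cocycle ?N \<omega> n)" for \<omega> n using unimodular_mnorm_ge[OF uC, of \<omega> n] by simp
  have m1: "mnorm (cocycle A \<omega> n) = exp (S n \<omega>) * mnorm (cocycle ?N \<omega> n)" for \<omega> n
    unfolding Cn mnorm_scaleR by simp
  have m2: "mnorm (matrix_inv (cocycle A \<omega> n)) = exp (- S n \<omega>) * mnorm (cocycle ?N \<omega> n)" for \<omega> n
    unfolding Cn
    by (subst matrix_inv_scaleR[OF unimodular_invertible[OF uC]])
      (simp_all add: mnorm_scaleR unimodular_mnorm_inv[OF uC] exp_minus inverse_eq_divide)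
  have fd: "fdep 1 (\<lambda>\<omega>. half_log_det (A (\<omega> 0)))" by (simp add: fdep_def)
  obtain B where B: "\<And>i. \<bar>half_log_det (A i)\<bar> \<le> B" using finite_upper[of "\<lambda>i. \<bar>half_log_det (A i)\<bar>"] by blast
  have hm: "(\<lambda>\<omega>. half_log_det (A (\<omega> 0))) \<in> borel_measurable (stationary_chain P)"
    unfolding measurable_chain[OF P irr] by (rule fdep_borel[OF fd])
  have "(\<integral>\<omega>. half_log_det (A (\<omega> 0)) \<partial>stationary_chain P) = ?d"
  proof -
    have "expect P i (\<lambda>\<omega>. half_log_det (A (\<omega> 0))) = expect P i (\<lambda>_. half_log_det (A i))" for i
      by (rule expect_start_cong[OF P fd]) (auto simp: fdep_def)
    then have "expect P i (\<lambda>\<omega>. half_log_det (A (\<omega> 0))) = half_log_det (A i)" for i by (simp add: expect_const[OF P])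
    then show ?thesis unfolding stationary_chain_def mean_half_log_det_def
      using integral_markov_measure_start[OF P p fdep_borel[OF fd] B] by simp
  qed
  then have Slim: "AE \<omega> in stationary_chain P. (\<lambda>n. S n \<omega> / real n) \<longlonglongrightarrow> ?d"
    using birkhoff[OF hm B] by (simp add: S_def shift_funpow)
  have lim: "(\<lambda>n. f n / real n) \<longlonglongrightarrow> l"
    if "\<And>n. \<bar>f n - h n\<bar> \<le> ln c" "(\<lambda>n. h n / real n) \<longlonglongrightarrow> l" for f h and l :: real
  proof -
    have "(\<lambda>n. f n / real n - h n / real n) \<longlonglongrightarrow> 0"
    proof (rule Lim_null_comparison)
      show "\<forall>\<^sub>F n in sequentially. norm (f n / real n - h n / real n) \<le> ln c / real n"
        using that(1) by (intro always_eventually allI) (simp add: divide_right_mono flip: diff_divide_distrib)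
    qed (rule lim_const_over_n)
    from tendsto_add[OF this that(2)] show ?thesis by simp
  qed
  have plus: "AE \<omega> in stationary_chain P. (\<lambda>n. 1 / real n * ln (op_norm \<nu> (cocycle A \<omega> n))) \<longlonglongrightarrow> ?d + ?g"
    using Slim growth_AE[of P ?N, OF P irr uni]
  proof eventually_elim
    case (elim \<omega>)
    have "(\<lambda>n. ln (op_norm \<nu> (cocycle A \<omega> n)) / real n) \<longlonglongrightarrow> ?d + ?g"
    proof (rule lim)
      show "\<bar>ln (op_norm \<nu> (cocycle A \<omega> n)) - (S n \<omega> + ln (mnorm (cocycle ?N \<omega> n)))\<bar> \<le> ln c" for n
        using ln_close[of "cocycle A \<omega> n"] pos[of \<omega> n] by (simp add: m1 ln_mult_pos)
      show "(\<lambda>n. (S n \<omega> + ln (mnorm (cocycle ?N \<omega> n))) / real n) \<longlonglongrightarrow> ?d + ?g"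
        using tendsto_add[OF elim] by (simp add: add_divide_distrib)
    qed
    then show ?case by simp
  qed
  have minus: "AE \<omega> in stationary_chain P. (\<lambda>n. - (1 / real n * ln (op_norm \<nu> (matrix_inv (cocycle A \<omega> n))))) \<longlonglongrightarrow> ?d - ?g"
    using Slim growth_AE[of P ?N, OF P irr uni]
  proof eventually_elim
    case (elim \<omega>)
    have "(\<lambda>n. ln (op_norm \<nu> (matrix_inv (cocycle A \<omega> n))) / real n) \<longlonglongrightarrow> ?g - ?d"
    proof (rule lim)
      show "\<bar>ln (op_norm \<nu> (matrix_inv (cocycle A \<omega> n))) - (ln (mnorm (cocycle ?N \<omega> n)) - S n \<omega>)\<bar> \<le> ln c" for n
        using ln_close[of "matrix_inv (cocycle A \<omega> n)"] pos[of \<omega> n] by (simp add: m2 ln_mult_pos)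
      show "(\<lambda>n. (ln (mnorm (cocycle ?N \<omega> n)) - S n \<omega>) / real n) \<longlonglongrightarrow> ?g - ?d"
        using tendsto_diff[OF elim(2,1)] by (simp add: diff_divide_distrib)
    qed
    from tendsto_minus[OF this] show ?case by simp
  qed
  \<comment> \<open>On a probability space an almost sure constant limit is unique, so the definite
    descriptions in the exponents denote it.\<close>
  have unique: "(THE l. AE \<omega> in stationary_chain P. (\<lambda>n. f n \<omega>) \<longlonglongrightarrow> l) = l"
    if l: "AE \<omega> in stationary_chain P. (\<lambda>n. f n \<omega>) \<longlonglongrightarrow> l" for f and l :: real
  proof (rule the_equality[of _ l])
    show "AE \<omega> in stationary_chain P. (\<lambda>n. f n \<omega>) \<longlonglongrightarrow> l" by (rule l)
    fix l' assume "AE \<omega> in stationary_chain P. (\<lambda>n. f n \<omega>) \<longlonglongrightarrow> l'"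
    then have "AE \<omega> in stationary_chain P. l' = l"
      using l by eventually_elim (rule LIMSEQ_unique)
    then show "l' = l" by simp
  qed
  show "lyapunov_plus \<nu> A P = ?d + ?g" unfolding lyapunov_plus_def by (rule unique[OF plus])
  show "lyapunov_minus \<nu> A P = ?d - ?g" unfolding lyapunov_minus_def by (rule unique[OF minus])
qed

section \<open>Quantitative estimates in the distance of the pairs\<close>

lemma inverse_sqrt_lipschitz:
  assumes "0 < m" "m \<le> x" "m \<le> y"
  shows "\<bar>1 / sqrt x - 1 / sqrt y\<bar> \<le> \<bar>x - y\<bar> / (m * sqrt m)"
proof -
  have s: "0 < sqrt m" "sqrt m \<le> sqrt x" "sqrt m \<le> sqrt y" using assms by auto
  have "\<bar>1 / sqrt x - 1 / sqrt y\<bar> = \<bar>sqrt y - sqrt x\<bar> / (sqrt x * sqrt y)"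
    using s by (simp add: field_simps abs_divide[symmetric] del: abs_divide) (simp add: abs_divide abs_mult)
  also have "\<bar>sqrt y - sqrt x\<bar> = \<bar>x - y\<bar> / (sqrt x + sqrt y)"
  proof -
    have "(sqrt y - sqrt x) * (sqrt x + sqrt y) = y - x" using assms by (simp add: algebra_simps)
    then have "\<bar>sqrt y - sqrt x\<bar> * (sqrt x + sqrt y) = \<bar>x - y\<bar>"
      using s by (metis abs_minus_commute abs_mult abs_of_nonneg add_nonneg_nonneg less_imp_le order_trans)
    moreover have "0 < sqrt x + sqrt y" using s by linarith
    ultimately show ?thesis by (simp add: field_simps)
  qed
  also have "\<bar>x - y\<bar> / (sqrt x + sqrt y) / (sqrt x * sqrt y) = \<bar>x - y\<bar> / ((sqrt x + sqrt y) * (sqrt x * sqrt y))" by simp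
  also have "\<dots> \<le> \<bar>x - y\<bar> / (m * sqrt m)"
  proof (rule divide_left_mono)
    have s3: "sqrt m \<le> sqrt x + sqrt y" using s by linarith
    have "sqrt m * (sqrt m * sqrt m) \<le> (sqrt x + sqrt y) * (sqrt x * sqrt y)"
      by (rule mult_mono[OF s3 mult_mono[OF s(2,3)]]) (use s in auto)
    then show "m * sqrt m \<le> (sqrt x + sqrt y) * (sqrt x * sqrt y)" using assms by (simp add: mult.commute)
    show "0 < (sqrt x + sqrt y) * (sqrt x * sqrt y) * (m * sqrt m)" using assms s by (simp add: add_pos_pos)
  qed simp
  finally show ?thesis .
qed

lemma ln_lipschitz:
  assumes "0 < m" "m \<le> x" "m \<le> (y :: real)" shows "\<bar>ln x - ln y\<bar> \<le> \<bar>x - y\<bar> / m"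
proof -
  have "ln x - ln y \<le> \<bar>x - y\<bar> / m" if "m \<le> x" "m \<le> y" for x y
  proof -
    have "ln x - ln y \<le> (x - y) / y" using assms(1) that by (intro ln_diff_le) auto
    also have "\<dots> \<le> \<bar>x - y\<bar> / y" using assms(1) that by (intro divide_right_mono) auto
    also have "\<dots> \<le> \<bar>x - y\<bar> / m" using assms(1) that by (intro divide_left_mono) auto
    finally show ?thesis .
  qed
  from this[of x y] this[of y x] show ?thesis using assms by (simp add: abs_minus_commute abs_le_iff)
qed

lemma det_wedge: "det (M :: real ^ 2 ^ 2) = wedge (M *v axis 1 1) (M *v axis 2 1)"
  by (simp add: det_2 wedge_def matrix_vector_mult_def sum_2 axis_def)

text \<open>The determinant is bilinear in the columns; one column is changed at a time.\<close>

lemma det_lipschitz: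
  assumes K: "mnorm M \<le> K" "mnorm N \<le> K"
  shows "\<bar>det M - det N\<bar> \<le> 2 * K * mnorm (M - N)"
proof -
  let ?e = "axis 1 1 :: real ^ 2" and ?f = "axis 2 1 :: real ^ 2"
  have ef: "norm (X *v ?e) \<le> mnorm X" "norm (X *v ?f) \<le> mnorm X" for X
    using mnorm[of X ?e] mnorm[of X ?f] by (simp_all add: norm_axis_1)
  have "det M - det N = wedge ((M - N) *v ?e) (M *v ?f) + wedge (N *v ?e) ((M - N) *v ?f)"
    unfolding det_wedge by (simp add: matrix_vector_mult_diff_rdistrib wedge_linear)
  also have "\<bar>\<dots>\<bar> \<le> \<bar>wedge ((M - N) *v ?e) (M *v ?f)\<bar> + \<bar>wedge (N *v ?e) ((M - N) *v ?f)\<bar>"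
    by (rule abs_triangle_ineq)
  also have "\<dots> \<le> norm ((M - N) *v ?e) * norm (M *v ?f) + norm (N *v ?e) * norm ((M - N) *v ?f)"
    by (intro add_mono wedge_le)
  also have "\<dots> \<le> mnorm (M - N) * K + K * mnorm (M - N)"
    using K ef[of M] ef[of N] ef[of "M - N"] mnorm_nonneg[of M]
    by (intro add_mono mult_mono) (auto intro: order_trans mnorm_nonneg)
  finally show ?thesis by simp
qed

lemma pair_dist_bounds:
  fixes P Q :: "real ^ 'n::finite ^ 'n"
  assumes c: "\<And>M. mnorm M \<le> c * op_norm \<nu> M" "1 \<le> c"
  shows "mnorm (A i - B i) \<le> c * pair_dist \<nu> A P B Q" "(\<Sum>j\<in>UNIV. \<bar>P $ i $ j - Q $ i $ j\<bar>) \<le> pair_dist \<nu> A P B Q"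
proof -
  have op0: "0 \<le> op_norm \<nu> M" for M
  proof -
    have "0 \<le> c * op_norm \<nu> M" using c(1)[of M] mnorm_nonneg[of M] by linarith
    then show ?thesis using c(2) by (simp add: zero_le_mult_iff)
  qed
  let ?f = "\<lambda>i. op_norm \<nu> (A i - B i) + op_norm \<nu> (matrix_inv (A i) - matrix_inv (B i))"
  let ?g = "\<lambda>i. \<Sum>j\<in>UNIV. \<bar>P $ i $ j - Q $ i $ j\<bar>"
  have f: "?f i \<le> (MAX i. ?f i)" and g: "?g i \<le> (MAX i. ?g i)" for i by (rule Max_ge; simp)+
  have f0: "0 \<le> (MAX i. ?f i)" using f[of i] op0[of "A i - B i"] op0[of "matrix_inv (A i) - matrix_inv (B i)"] by linarith
  have "0 \<le> ?g i" by (rule sum_nonneg) simp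
  then have g0: "0 \<le> (MAX i. ?g i)" using g[of i] by linarith
  have "op_norm \<nu> (A i - B i) \<le> pair_dist \<nu> A P B Q"
    unfolding pair_dist_def using f[of i] g0 op0[of "matrix_inv (A i) - matrix_inv (B i)"] by linarith
  then show "mnorm (A i - B i) \<le> c * pair_dist \<nu> A P B Q"
    using c(1)[of "A i - B i"] mult_left_mono[of "op_norm \<nu> (A i - B i)" "pair_dist \<nu> A P B Q" c] c(2) by linarith
  show "?g i \<le> pair_dist \<nu> A P B Q" unfolding pair_dist_def using g[of i] f0 by linarith
qed

lemma finite_lower_pos:
  fixes f :: "'n::finite \<Rightarrow> real"
  assumes "\<And>i. 0 < f i" obtains m where "0 < m" "\<And>i. m \<le> f i"
proof (rule that[of "Min (range f)"])
  show "0 < Min (range f)" using assms by (subst Min_gr_iff) auto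
qed (auto intro: Min_le)

text \<open>The Poisson equation \<open>f - p f = g - P g\<close> makes the mean \<open>q f\<close> for the stationary vector \<open>q\<close> of \<open>Q\<close>
  Lipschitz in \<open>Q\<close>, since \<open>q f - p f = q (Q - P) g\<close>.\<close>

lemma lipschitz_estimates:
  fixes P :: "real ^ 'n::finite ^ 'n" and A :: "'n \<Rightarrow> real ^ 2 ^ 2"
  assumes \<nu>: "is_norm \<nu>" and P: "stochastic P" and irr: "irreducible_chain P" and inv: "\<And>i. invertible (A i)"
  obtains C r where "1 \<le> C" "0 < r"
    "\<And>B Q. (\<And>i. invertible (B i)) \<Longrightarrow> stochastic Q \<Longrightarrow> same_transition_graph P Q \<Longrightarrow>
      pair_dist \<nu> A P B Q < r \<Longrightarrow>
      (\<forall>i. mnorm (det_normalized (A i) - det_normalized (B i)) \<le> C * pair_dist \<nu> A P B Q) \<and>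
      (\<forall>i j. Q $ i $ j \<le> (1 + C * pair_dist \<nu> A P B Q) * P $ i $ j) \<and>
      \<bar>mean_half_log_det Q B - mean_half_log_det P A\<bar> \<le> C * pair_dist \<nu> A P B Q"
proof -
  let ?p = "stationary_vector P" and ?f = "\<lambda>i. half_log_det (A i)"
  have p: "prob_vector ?p" "?p v* P = ?p"
    using prob_vector_stationary[OF P irr] stationary_vector_fixed[OF P irr] .
  have p1: "(\<Sum>i\<in>UNIV. ?p $ i) = 1" using p by (simp add: prob_vector_def)
  obtain c where c: "1 \<le> c" "\<And>M. mnorm M \<le> c * op_norm \<nu> M"
    using op_norm_equivalent[OF \<nu>] by metis
  obtain K where K: "1 \<le> K" "\<And>i. mnorm (A i) \<le> K" using finite_upper[of "\<lambda>i. mnorm (A i)"] by blast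
  have "0 < \<bar>det (A i)\<bar>" for i using inv[of i] by (simp add: invertible_det_nz)
  then obtain m0 where m0: "0 < m0" "\<And>i. m0 \<le> \<bar>det (A i)\<bar>" using finite_lower_pos[of "\<lambda>i. \<bar>det (A i)\<bar>"] by blast
  \<comment> \<open>Determinants of \<open>A\<close> are at least \<open>m0\<close> in absolute
    value; once they move by at most \<open>m\<close>, those of \<open>B\<close> are still at least
    \<open>m\<close>.\<close>
  define m where "m = m0 / 2"
  have m: "0 < m" "m + m = m0" using m0 by (simp_all add: m_def)
  \<comment> \<open>The value 1 off the graph keeps the minimum positive, so \<open>pm\<close>
    bounds the positive entries of \<open>P\<close> from below.\<close>
  have "0 < (if 0 < P $ i $ j then P $ i $ j else 1)" for i j by simp
  then obtain pm where pm: "0 < pm" "\<And>x. pm \<le> (if 0 < P $ fst x $ snd x then P $ fst x $ snd x else 1)"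
    using finite_lower_pos[of "\<lambda>x. if 0 < P $ fst x $ snd x then P $ fst x $ snd x else 1"] by blast
  have "(\<Sum>i\<in>UNIV. ?p $ i * (?f i - mean_half_log_det P A)) = 0"
    by (simp add: right_diff_distrib sum_subtractf mean_half_log_det_def p1 flip: sum_distrib_right)
  then obtain g where g: "\<And>i. ?f i - mean_half_log_det P A = g i - (\<Sum>j\<in>UNIV. P $ i $ j * g j)"
    using poisson[OF P irr p, where f = "\<lambda>i. ?f i - mean_half_log_det P A"] by blast
  obtain Gm where Gm: "1 \<le> Gm" "\<And>i. \<bar>g i\<bar> \<le> Gm" using finite_upper[of "\<lambda>i. \<bar>g i\<bar>"] by blast
  define L where "L = 2 * (K + 1) * c"
  have L: "0 < L" using K c by (simp add: L_def)
  define C1 where "C1 = c / sqrt m + (K + 1) * (L / (m * sqrt m))"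
  define C2 where "C2 = 1 / pm"
  define C3 where "C3 = L / m + Gm"
  have C1: "0 \<le> C1" and C2: "0 \<le> C2" and C3: "0 \<le> C3"
    using c K L m pm Gm by (simp_all add: C1_def C2_def C3_def)
  \<comment> \<open>The bound \<open>1 / c\<close> gives \<open>mnorm (A i - B i) \<le> 1\<close>,
    hence a norm bound for \<open>B\<close>; \<open>m / L\<close> keeps the determinants away from
    0.\<close>
  define r where "r = min (1 / c) (m / L)"
  show ?thesis
  proof (rule that[of "1 + C1 + C2 + C3" r])
    show "1 \<le> 1 + C1 + C2 + C3" using C1 C2 C3 by simp
    show "0 < r" using c L m by (simp add: r_def)
    fix B :: "'n \<Rightarrow> real ^ 2 ^ 2" and Q :: "real ^ 'n ^ 'n"
    assume invB: "\<And>i. invertible (B i)" and Q: "stochastic Q" and graph: "same_transition_graph P Q"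
      and small: "pair_dist \<nu> A P B Q < r"
    let ?D = "pair_dist \<nu> A P B Q" and ?q = "stationary_vector Q"
    have AB: "mnorm (A i - B i) \<le> c * ?D" and PQ: "(\<Sum>j\<in>UNIV. \<bar>P $ i $ j - Q $ i $ j\<bar>) \<le> ?D" for i
      using pair_dist_bounds[OF c(2,1)] by blast+
    have D0: "0 \<le> ?D"
      by (rule order_trans[OF _ PQ[of undefined]]) (simp add: sum_nonneg)
    have "c * ?D \<le> c * (1 / c)" using small c(1) by (intro mult_left_mono) (auto simp: r_def)
    then have cD: "c * ?D \<le> 1" using c(1) by simp
    have "L * ?D \<le> L * (m / L)" using small L by (intro mult_left_mono) (auto simp: r_def)
    then have LD: "L * ?D \<le> m" using L by simp
    have BK: "mnorm (B i) \<le> K + 1" for i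
    proof (rule mnorm_le)
      fix v
      have "norm (B i *v v) \<le> norm (A i *v v) + norm ((A i - B i) *v v)"
        using norm_triangle_ineq4[of "A i *v v" "(A i - B i) *v v"] by (simp add: matrix_vector_mult_diff_rdistrib)
      also have "\<dots> \<le> K * norm v + 1 * norm v"
      proof (rule add_mono)
        show "norm (A i *v v) \<le> K * norm v" using mnorm[of "A i" v] mult_right_mono[OF K(2)[of i], of "norm v"] by simp
        have "mnorm (A i - B i) \<le> 1" using AB[of i] cD by linarith
        then show "norm ((A i - B i) *v v) \<le> 1 * norm v"
          using mnorm[of "A i - B i" v] mult_right_mono[of "mnorm (A i - B i)" 1 "norm v"] by simp
      qed
      finally show "norm (B i *v v) \<le> (K + 1) * norm v" by (simp add: algebra_simps)
    qed (use K in simp)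
    have det_close: "\<bar>\<bar>det (A i)\<bar> - \<bar>det (B i)\<bar>\<bar> \<le> L * ?D" for i
    proof -
      have "\<bar>det (A i) - det (B i)\<bar> \<le> 2 * (K + 1) * mnorm (A i - B i)"
        using K(2)[of i] BK[of i] by (intro det_lipschitz) auto
      also have "\<dots> \<le> 2 * (K + 1) * (c * ?D)" using K AB[of i] by (intro mult_left_mono) auto
      also have "\<dots> = L * ?D" by (simp add: L_def)
      finally show ?thesis using abs_triangle_ineq3[of "det (A i)" "det (B i)"] by linarith
    qed
    have dA: "m \<le> \<bar>det (A i)\<bar>" and dB: "m \<le> \<bar>det (B i)\<bar>" for i
      using m0(2)[of i] m det_close[of i] LD by linarith+
    have e1: "mnorm (det_normalized (A i) - det_normalized (B i)) \<le> C1 * ?D" for i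
    proof -
      let ?a = "1 / sqrt \<bar>det (A i)\<bar>" and ?b = "1 / sqrt \<bar>det (B i)\<bar>"
      have a: "0 \<le> ?a" "?a \<le> 1 / sqrt m" using dA[of i] m by (simp_all add: frac_le)
      have "\<bar>?a - ?b\<bar> \<le> \<bar>\<bar>det (A i)\<bar> - \<bar>det (B i)\<bar>\<bar> / (m * sqrt m)"
        by (rule inverse_sqrt_lipschitz[OF m(1) dA dB])
      also have "\<dots> \<le> L * ?D / (m * sqrt m)" using m det_close[of i] by (intro divide_right_mono) auto
      finally have ab: "\<bar>?a - ?b\<bar> \<le> L / (m * sqrt m) * ?D" by simp
      show ?thesis
      proof (rule mnorm_le)
        show "0 \<le> C1 * ?D" using C1 D0 by simp
        fix v
        have "(det_normalized (A i) - det_normalized (B i)) *v v = ?a *\<^sub>R ((A i - B i) *v v) + (?a - ?b) *\<^sub>R (B i *v v)"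
          unfolding det_normalized_eq[OF inv] det_normalized_eq[OF invB]
          by (simp add: matrix_vector_mult_diff_rdistrib scaleR_diff_right scaleR_diff_left flip: scaleR_matrix_vector_assoc)
        then have "norm ((det_normalized (A i) - det_normalized (B i)) *v v)
            \<le> norm (?a *\<^sub>R ((A i - B i) *v v)) + norm ((?a - ?b) *\<^sub>R (B i *v v))"
          by (simp only: norm_triangle_ineq)
        also have "\<dots> = ?a * norm ((A i - B i) *v v) + \<bar>?a - ?b\<bar> * norm (B i *v v)" using a by simp
        also have "\<dots> \<le> 1 / sqrt m * (c * ?D * norm v) + L / (m * sqrt m) * ?D * ((K + 1) * norm v)"
        proof (intro add_mono mult_mono a ab)
          show "norm ((A i - B i) *v v) \<le> c * ?D * norm v"
            using mnorm[of "A i - B i" v] mult_right_mono[OF AB[of i], of "norm v"] by simp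
          show "norm (B i *v v) \<le> (K + 1) * norm v"
            using mnorm[of "B i" v] mult_right_mono[OF BK[of i], of "norm v"] by simp
        qed (use m L D0 in auto)
        also have "\<dots> = C1 * ?D * norm v" by (simp add: C1_def algebra_simps)
        finally show "norm ((det_normalized (A i) - det_normalized (B i)) *v v) \<le> C1 * ?D * norm v" .
      qed
    qed
    \<comment> \<open>On edges the additive error becomes a relative one because
      \<open>P $ i $ j \<ge> pm\<close>; off the graph both entries vanish, since the graphs
      agree.\<close>
    have e2: "Q $ i $ j \<le> (1 + C2 * ?D) * P $ i $ j" for i j
    proof (cases "0 < P $ i $ j")
      case True
      have pmP: "pm \<le> P $ i $ j" using pm(2)[of "(i, j)"] True by simp
      have "\<bar>P $ i $ j - Q $ i $ j\<bar> \<le> (\<Sum>j\<in>UNIV. \<bar>P $ i $ j - Q $ i $ j\<bar>)" by (rule member_le_sum) auto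
      then have "Q $ i $ j \<le> P $ i $ j + ?D" using PQ[of i] by linarith
      also have "?D \<le> C2 * ?D * P $ i $ j"
      proof -
        have "1 \<le> C2 * P $ i $ j" using pmP pm(1) by (simp add: C2_def)
        then have "1 * ?D \<le> (C2 * P $ i $ j) * ?D" using D0 by (rule mult_right_mono)
        then show ?thesis by (simp add: mult_ac)
      qed
      finally show ?thesis by (simp add: algebra_simps)
    next
      case False
      then have "\<not> 0 < Q $ i $ j" using graph by (simp add: same_transition_graph_def)
      then show ?thesis using False stochastic_nonneg[OF P, of i j] by (simp add: not_less)
    qed
    have irrQ: "irreducible_chain Q" by (rule irreducible_same_graph[OF irr graph])
    have q: "prob_vector ?q" "?q v* Q = ?q"
      using prob_vector_stationary[OF Q irrQ] stationary_vector_fixed[OF Q irrQ] .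
    have qn: "0 \<le> ?q $ i" and q1: "(\<Sum>i\<in>UNIV. ?q $ i) = 1" for i using q by (auto simp: prob_vector_def)
    have mean_abs: "\<bar>\<Sum>i\<in>UNIV. ?q $ i * h i\<bar> \<le> b" if "\<And>i. \<bar>h i\<bar> \<le> b" for h b
    proof -
      have "\<bar>\<Sum>i\<in>UNIV. ?q $ i * h i\<bar> \<le> (\<Sum>i\<in>UNIV. ?q $ i * b)"
        using qn that by (intro sum_abs[THEN order_trans] sum_mono) (simp add: abs_mult mult_left_mono)
      then show ?thesis by (simp add: q1 flip: sum_distrib_right)
    qed
    have e3: "\<bar>mean_half_log_det Q B - mean_half_log_det P A\<bar> \<le> C3 * ?D"
    proof -
      have s1: "\<bar>\<Sum>i\<in>UNIV. ?q $ i * (half_log_det (B i) - ?f i)\<bar> \<le> L / m * ?D"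
      proof (rule mean_abs)
        fix i
        have "\<bar>ln \<bar>det (B i)\<bar> - ln \<bar>det (A i)\<bar>\<bar> \<le> \<bar>\<bar>det (B i)\<bar> - \<bar>det (A i)\<bar>\<bar> / m"
          by (rule ln_lipschitz[OF m(1) dB dA])
        also have "\<dots> \<le> L * ?D / m" using det_close[of i] m by (intro divide_right_mono) (auto simp: abs_minus_commute)
        finally show "\<bar>half_log_det (B i) - ?f i\<bar> \<le> L / m * ?D"
          by (simp add: half_log_det_def abs_le_iff flip: diff_divide_distrib)
      qed
      have "(\<Sum>i\<in>UNIV. ?q $ i * (?f i - mean_half_log_det P A))
          = (\<Sum>i\<in>UNIV. ?q $ i * g i) - (\<Sum>i\<in>UNIV. ?q $ i * (\<Sum>j\<in>UNIV. P $ i $ j * g j))"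
        by (simp add: g right_diff_distrib sum_subtractf)
      also have "(\<Sum>i\<in>UNIV. ?q $ i * g i) = (\<Sum>i\<in>UNIV. ?q $ i * (\<Sum>j\<in>UNIV. Q $ i $ j * g j))"
        by (rule stationary_sum[OF q(2), symmetric])
      also have "\<dots> - (\<Sum>i\<in>UNIV. ?q $ i * (\<Sum>j\<in>UNIV. P $ i $ j * g j))
          = (\<Sum>i\<in>UNIV. ?q $ i * (\<Sum>j\<in>UNIV. (Q $ i $ j - P $ i $ j) * g j))"
        by (simp add: left_diff_distrib right_diff_distrib sum_subtractf)
      finally have s2: "(\<Sum>i\<in>UNIV. ?q $ i * (?f i - mean_half_log_det P A))
          = (\<Sum>i\<in>UNIV. ?q $ i * (\<Sum>j\<in>UNIV. (Q $ i $ j - P $ i $ j) * g j))" .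
      have s3: "\<bar>\<Sum>i\<in>UNIV. ?q $ i * (\<Sum>j\<in>UNIV. (Q $ i $ j - P $ i $ j) * g j)\<bar> \<le> Gm * ?D"
      proof (rule mean_abs)
        fix i
        have "\<bar>\<Sum>j\<in>UNIV. (Q $ i $ j - P $ i $ j) * g j\<bar> \<le> (\<Sum>j\<in>UNIV. \<bar>P $ i $ j - Q $ i $ j\<bar> * Gm)"
          using Gm by (intro sum_abs[THEN order_trans] sum_mono) (simp add: abs_mult abs_minus_commute mult_left_mono)
        also have "\<dots> = Gm * (\<Sum>j\<in>UNIV. \<bar>P $ i $ j - Q $ i $ j\<bar>)" by (simp add: sum_distrib_left mult.commute)
        also have "\<dots> \<le> Gm * ?D" using Gm(1) by (intro mult_left_mono PQ) auto
        finally show "\<bar>\<Sum>j\<in>UNIV. (Q $ i $ j - P $ i $ j) * g j\<bar> \<le> Gm * ?D" .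
      qed
      have "mean_half_log_det Q B - mean_half_log_det P A
          = (\<Sum>i\<in>UNIV. ?q $ i * (half_log_det (B i) - ?f i)) + (\<Sum>i\<in>UNIV. ?q $ i * (?f i - mean_half_log_det P A))"
        by (simp add: mean_half_log_det_def[of Q B] right_diff_distrib sum_subtractf q1 flip: sum_distrib_right)
      then show ?thesis using s1 s3 unfolding s2 C3_def by (simp add: algebra_simps abs_le_iff)
    qed
    have mono: "C1 * ?D \<le> (1 + C1 + C2 + C3) * ?D" "C2 * ?D \<le> (1 + C1 + C2 + C3) * ?D"
      "C3 * ?D \<le> (1 + C1 + C2 + C3) * ?D"
      using C1 C2 C3 D0 by (intro mult_right_mono; simp)+
    show "(\<forall>i. mnorm (det_normalized (A i) - det_normalized (B i)) \<le> (1 + C1 + C2 + C3) * ?D) \<and>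
      (\<forall>i j. Q $ i $ j \<le> (1 + (1 + C1 + C2 + C3) * ?D) * P $ i $ j) \<and>
      \<bar>mean_half_log_det Q B - mean_half_log_det P A\<bar> \<le> (1 + C1 + C2 + C3) * ?D"
    proof (intro conjI allI)
      show "mnorm (det_normalized (A i) - det_normalized (B i)) \<le> (1 + C1 + C2 + C3) * ?D" for i
        using e1[of i] mono(1) by linarith
      show "\<bar>mean_half_log_det Q B - mean_half_log_det P A\<bar> \<le> (1 + C1 + C2 + C3) * ?D"
        using e3 mono(3) by linarith
      fix i j
      have "(1 + C2 * ?D) * P $ i $ j \<le> (1 + (1 + C1 + C2 + C3) * ?D) * P $ i $ j"
        using mono(2) stochastic_nonneg[OF P] by (intro mult_right_mono) auto
      then show "Q $ i $ j \<le> (1 + (1 + C1 + C2 + C3) * ?D) * P $ i $ j" using e2[of i j] by linarith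
    qed
  qed
qed

text \<open>The block length \<open>n\<close> is a small multiple of \<open>ln (1 / \<Delta>)\<close>, so that the perturbation error \<open>\<kappa> ^ n * \<Delta>\<close>
  stays bounded.\<close>

lemma controlled_modulus:
  fixes P :: "real ^ 'n::finite ^ 'n" and A :: "'n \<Rightarrow> real ^ 2 ^ 2"
  assumes \<nu>: "is_norm \<nu>" and P: "stochastic P" and irr: "irreducible_chain P" and inv: "\<And>i. invertible (A i)"
    and c: "0 < c" and s: "0 < s" "s \<le> 1"
    and ctrl: "controlled P (\<lambda>i. det_normalized (A i)) (\<lambda>n. c * real n powr (1 - s))"
    and l0: "mean_half_log_det P A = l0"
  shows "\<exists>C \<delta>. 0 < C \<and> 0 < \<delta> \<and> \<delta> < 1 \<and>
    (\<forall>B Q. (\<forall>i. invertible (B i)) \<longrightarrow> stochastic Q \<longrightarrow> same_transition_graph P Q \<longrightarrow>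
      0 < pair_dist \<nu> A P B Q \<longrightarrow> pair_dist \<nu> A P B Q < \<delta> \<longrightarrow>
      \<bar>lyapunov_plus \<nu> B Q - l0\<bar> \<le> C * ln (1 / pair_dist \<nu> A P B Q) powr (- s) \<and>
      \<bar>lyapunov_minus \<nu> B Q - l0\<bar> \<le> C * ln (1 / pair_dist \<nu> A P B Q) powr (- s))"
proof -
  obtain C1 r where C1: "1 \<le> C1" and r: "0 < r"
    and est: "\<And>B Q. (\<And>i. invertible (B i)) \<Longrightarrow> stochastic Q \<Longrightarrow> same_transition_graph P Q \<Longrightarrow>
      pair_dist \<nu> A P B Q < r \<Longrightarrow>
      (\<forall>i. mnorm (det_normalized (A i) - det_normalized (B i)) \<le> C1 * pair_dist \<nu> A P B Q) \<and>
      (\<forall>i j. Q $ i $ j \<le> (1 + C1 * pair_dist \<nu> A P B Q) * P $ i $ j) \<and>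
      \<bar>mean_half_log_det Q B - mean_half_log_det P A\<bar> \<le> C1 * pair_dist \<nu> A P B Q"
    using lipschitz_estimates[where \<nu> = \<nu> and P = P and A = A, OF \<nu> P irr inv] by blast
  obtain \<kappa> where \<kappa>: "2 \<le> \<kappa>"
    and pert: "\<And>n B Q d. 1 \<le> n \<Longrightarrow> (\<And>i. unimodular (B i)) \<Longrightarrow> stochastic Q \<Longrightarrow> same_transition_graph P Q \<Longrightarrow>
      0 \<le> d \<Longrightarrow> (\<And>i. mnorm (det_normalized (A i) - B i) \<le> d) \<Longrightarrow> (\<And>i j. Q $ i $ j \<le> (1 + d) * P $ i $ j) \<Longrightarrow>
      \<kappa> ^ n * d \<le> 1 \<Longrightarrow> growth Q B \<le> (ln 2 + 3 * (c * real n powr (1 - s))) / real n"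
    using growth_perturbation[OF P irr ctrl] by metis
  have lk: "0 < ln \<kappa>" using \<kappa> by simp
  \<comment> \<open>Chosen such that the block length \<open>n\<close> below satisfies
    \<open>l / a \<le> n\<close>.\<close>
  define a where "a = 4 * ln \<kappa>"
  have a: "0 < a" using lk by (simp add: a_def)
  define C where "C = C1 + (ln 2 + 3 * c) * a powr s"
  \<comment> \<open>\<open>r\<close> gives access to the Lipschitz estimates,
    \<open>1 / C1\<^sup>2\<close> to \<open>\<kappa> ^ n * (C1 * \<Delta>) \<le> 1\<close>, and the
    exponentials to \<open>l \<ge> 1\<close> and \<open>n \<ge> 1\<close>. Halving makes the
    inequalities strict.\<close>
  define \<delta> where "\<delta> = Min {r, 1 / C1\<^sup>2, exp (- 1), exp (- (2 * ln \<kappa>))} / 2"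
  have fin: "finite {r, 1 / C1\<^sup>2, exp (- 1), exp (- (2 * ln \<kappa>))}" by simp
  have \<delta>0: "0 < \<delta>" unfolding \<delta>_def using r C1 by simp
  have \<delta>le: "\<delta> < r" "\<delta> < 1 / C1\<^sup>2" "\<delta> < exp (- 1)" "\<delta> < exp (- (2 * ln \<kappa>))"
  proof -
    have "\<delta> < x" if "x \<in> {r, 1 / C1\<^sup>2, exp (- 1), exp (- (2 * ln \<kappa>))}" for x
    proof -
      have "2 * \<delta> \<le> x" unfolding \<delta>_def using Min_le[OF fin that] by simp
      then show ?thesis using \<delta>0 by simp
    qed
    then show "\<delta> < r" "\<delta> < 1 / C1\<^sup>2" "\<delta> < exp (- 1)" "\<delta> < exp (- (2 * ln \<kappa>))" by auto
  qed
  \<comment> \<open>The exponents of \<open>(B, Q)\<close> are the determinant mean plus and minus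
    the growth, so this sum bounds the deviation of both.\<close>
  have main: "\<bar>mean_half_log_det Q B - l0\<bar> + growth Q (\<lambda>i. det_normalized (B i))
      \<le> C * ln (1 / pair_dist \<nu> A P B Q) powr (- s)"
    if invB: "\<And>i. invertible (B i)" and Q: "stochastic Q" and graph: "same_transition_graph P Q"
      and D0: "0 < pair_dist \<nu> A P B Q" and D1: "pair_dist \<nu> A P B Q < \<delta>" for B Q
  proof -
    let ?D = "pair_dist \<nu> A P B Q"
    define l where "l = ln (1 / ?D)"
    have lD: "l = - ln ?D" unfolding l_def using D0 by (simp add: ln_divide_pos)
    have Dl: "?D = exp (- l)" using D0 by (simp add: lD)
    have l1: "1 \<le> l"
    proof -
      have "exp (- l) < exp (- 1)" using D1 \<delta>le(3) Dl by linarith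
      then show ?thesis by simp
    qed
    have lk2: "2 * ln \<kappa> \<le> l"
    proof -
      have "exp (- l) < exp (- (2 * ln \<kappa>))" using D1 \<delta>le(4) Dl by linarith
      then show ?thesis by simp
    qed
    \<comment> \<open>With \<open>n\<close> at most \<open>x\<close>, \<open>\<kappa> ^ n\<close> is
      at most \<open>\<Delta>\<close> to the power -1/2; the remaining square root of
      \<open>\<Delta>\<close> outweighs \<open>C1\<close>. As \<open>x \<ge> 1\<close>, rounding
      down loses at most half.\<close>
    define x where "x = l / (2 * ln \<kappa>)"
    have x1: "1 \<le> x" using lk2 lk by (simp add: x_def)
    define n where "n = nat \<lfloor>x\<rfloor>"
    have n: "1 \<le> n" "real n \<le> x" "x / 2 \<le> real n"
    proof -
      have "1 \<le> \<lfloor>x\<rfloor>" using x1 by (simp add: le_floor_iff)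
      then have rn: "real n = of_int \<lfloor>x\<rfloor>" and n1: "1 \<le> n" by (simp_all add: n_def nat_le_iff le_nat_iff)
      show "1 \<le> n" by (rule n1)
      show "real n \<le> x" unfolding rn by (rule of_int_floor_le)
      have "x < real n + 1" unfolding rn by linarith
      then show "x / 2 \<le> real n" using n1 by linarith
    qed
    have est': "(\<forall>i. mnorm (det_normalized (A i) - det_normalized (B i)) \<le> C1 * ?D) \<and>
      (\<forall>i j. Q $ i $ j \<le> (1 + C1 * ?D) * P $ i $ j) \<and>
      \<bar>mean_half_log_det Q B - mean_half_log_det P A\<bar> \<le> C1 * ?D"
      by (rule est) (use invB Q graph D1 \<delta>le in auto)
    have small: "\<kappa> ^ n * (C1 * ?D) \<le> 1"
    proof -
      have "\<kappa> ^ n = exp (real n * ln \<kappa>)" using \<kappa> by (simp add: exp_of_nat_mult)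
      also have "\<dots> \<le> exp (l / 2)"
      proof -
        have "real n * ln \<kappa> \<le> x * ln \<kappa>" using n lk by (intro mult_right_mono) auto
        then show ?thesis using lk by (simp add: x_def)
      qed
      finally have 1: "\<kappa> ^ n \<le> exp (l / 2)" .
      have "exp (- l) \<le> 1 / C1\<^sup>2" using D1 \<delta>le(2) Dl by linarith
      then have "(C1 * exp (- (l / 2)))\<^sup>2 \<le> 1\<^sup>2"
        using C1 by (simp add: power_mult_distrib field_simps exp_minus power2_eq_square flip: exp_add)
      then have 2: "C1 * exp (- (l / 2)) \<le> 1" by (rule power2_le_imp_le) simp
      have "\<kappa> ^ n * (C1 * ?D) \<le> exp (l / 2) * (C1 * ?D)" using 1 C1 D0 by (intro mult_right_mono) auto
      also have "\<dots> = C1 * (exp (l / 2) * exp (- l))" by (simp add: Dl)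
      also have "exp (l / 2) * exp (- l) = exp (- (l / 2))" by (simp flip: exp_add)
      finally show ?thesis using 2 by simp
    qed
    have "growth Q (\<lambda>i. det_normalized (B i)) \<le> (ln 2 + 3 * (c * real n powr (1 - s))) / real n"
      by (rule pert[OF n(1) unimodular_det_normalized[OF invB] Q graph _ _ _ small]) (use est' C1 D0 in auto)
    also have "\<dots> \<le> ((ln 2 + 3 * c) * real n powr (1 - s)) / real n"
    proof (rule divide_right_mono)
      have "1 \<le> real n powr (1 - s)" using n(1) s by (intro ge_one_powr_ge_zero) auto
      then have "ln 2 * 1 \<le> ln 2 * real n powr (1 - s)" by (intro mult_left_mono) auto
      then show "ln 2 + 3 * (c * real n powr (1 - s)) \<le> (ln 2 + 3 * c) * real n powr (1 - s)"
        by (simp add: algebra_simps)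
    qed simp
    also have "\<dots> = (ln 2 + 3 * c) * real n powr (- s)"
      using n(1) by (simp add: powr_diff powr_minus field_simps)
    also have "\<dots> \<le> (ln 2 + 3 * c) * (l / a) powr (- s)"
    proof (intro mult_left_mono)
      have e: "l / a = x / 2" using lk by (simp add: a_def x_def)
      show "real n powr (- s) \<le> (l / a) powr (- s)"
        unfolding e by (rule powr_mono2') (use n x1 s in linarith)+
    qed (use c in simp)
    also have "(l / a) powr (- s) = a powr s * l powr (- s)"
      using l1 a by (simp add: powr_divide powr_minus field_simps)
    finally have gr: "growth Q (\<lambda>i. det_normalized (B i)) \<le> (ln 2 + 3 * c) * a powr s * l powr (- s)" by simp
    \<comment> \<open>The Lipschitz error is exponentially small in \<open>l\<close>, hence
      dominated by the modulus.\<close>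
    have "?D \<le> l powr (- s)"
    proof -
      have "l \<le> exp l" using exp_ge_add_one_self[of l] by linarith
      then have "?D \<le> 1 / l" using l1 unfolding Dl exp_minus by (simp add: field_simps)
      also have "\<dots> = l powr (- 1)" using l1 by (simp add: powr_minus_divide)
      also have "\<dots> \<le> l powr (- s)" using l1 s by (intro powr_mono) auto
      finally show ?thesis .
    qed
    then have "C1 * ?D \<le> C1 * l powr (- s)" using C1 by (intro mult_left_mono) auto
    then show ?thesis using est' gr unfolding l0 C_def l_def[symmetric] by (simp add: algebra_simps)
  qed
  have C: "0 < C" unfolding C_def using C1 c by (intro add_pos_nonneg) auto
  have "\<delta> < 1" using \<delta>le(3) by (meson exp_less_one_iff less_trans neg_less_0_iff_less zero_less_one)
  moreover have "\<bar>lyapunov_plus \<nu> B Q - l0\<bar> \<le> C * ln (1 / pair_dist \<nu> A P B Q) powr (- s) \<and>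
      \<bar>lyapunov_minus \<nu> B Q - l0\<bar> \<le> C * ln (1 / pair_dist \<nu> A P B Q) powr (- s)"
    if invB: "\<forall>i. invertible (B i)" and Q: "stochastic Q" and graph: "same_transition_graph P Q"
      and D: "0 < pair_dist \<nu> A P B Q" "pair_dist \<nu> A P B Q < \<delta>" for B Q
  proof -
    have irrQ: "irreducible_chain Q" by (rule irreducible_same_graph[OF irr graph])
    have invB': "\<And>i. invertible (B i)" using invB by simp
    have "0 \<le> growth Q (\<lambda>i. det_normalized (B i))"
      by (rule growth_nonneg[OF Q irrQ]) (rule unimodular_det_normalized[OF invB'])
    then show ?thesis
      using main[OF invB' Q graph D]
      unfolding lyapunov_plus_eq[OF \<nu> Q irrQ invB'] lyapunov_minus_eq[OF \<nu> Q irrQ invB'] by linarith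
  qed
  ultimately show ?thesis using C \<delta>0 by blast
qed

theorem mainTheorem1:
  fixes P :: "real ^ 'n::finite ^ 'n" and A :: "'n \<Rightarrow> real ^ 2 ^ 2"
    and \<nu> :: "real ^ 2 \<Rightarrow> real" and l\<^sub>0 :: real
  assumes norm: "is_norm \<nu>"
    and prim: "primitive P"
    and inv: "\<And>i. invertible (A i)"
    and lplus: "lyapunov_plus \<nu> A P = l\<^sub>0"
    and lminus: "lyapunov_minus \<nu> A P = l\<^sub>0"
  shows "(\<exists>C \<delta>\<^sub>0. 0 < C \<and> 0 < \<delta>\<^sub>0 \<and> \<delta>\<^sub>0 < 1 \<and>
            (\<forall>B Q. (\<forall>i. invertible (B i)) \<longrightarrow> stochastic Q \<longrightarrow> same_transition_graph P Q \<longrightarrow>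
               0 < pair_dist \<nu> A P B Q \<longrightarrow> pair_dist \<nu> A P B Q < \<delta>\<^sub>0 \<longrightarrow>
               \<bar>lyapunov_plus \<nu> B Q - l\<^sub>0\<bar> \<le> C * ln (1 / pair_dist \<nu> A P B Q) powr (-1/2) \<and>
               \<bar>lyapunov_minus \<nu> B Q - l\<^sub>0\<bar> \<le> C * ln (1 / pair_dist \<nu> A P B Q) powr (-1/2)))
       \<and> (compact_normal_form A P \<longrightarrow>
          (\<exists>C \<delta>\<^sub>0. 0 < C \<and> 0 < \<delta>\<^sub>0 \<and> \<delta>\<^sub>0 < 1 \<and>
            (\<forall>B Q. (\<forall>i. invertible (B i)) \<longrightarrow> stochastic Q \<longrightarrow> same_transition_graph P Q \<longrightarrow>
               0 < pair_dist \<nu> A P B Q \<longrightarrow> pair_dist \<nu> A P B Q < \<delta>\<^sub>0 \<longrightarrow>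
               \<bar>lyapunov_plus \<nu> B Q - l\<^sub>0\<bar> \<le> C * ln (1 / pair_dist \<nu> A P B Q) powr (-1) \<and>
               \<bar>lyapunov_minus \<nu> B Q - l\<^sub>0\<bar> \<le> C * ln (1 / pair_dist \<nu> A P B Q) powr (-1))))"
proof -
  have P: "stochastic P" using prim by (simp add: primitive_def)
  have irr: "irreducible_chain P" by (rule primitive_irreducible[OF prim])
  let ?N = "\<lambda>i. det_normalized (A i)"
  have uni: "unimodular (?N i)" for i by (rule unimodular_det_normalized[OF inv])
  \<comment> \<open>Half the difference and half the sum of the two equal exponents.\<close>
  have zero: "growth P ?N = 0" and mean: "mean_half_log_det P A = l\<^sub>0"
    using lplus lminus unfolding lyapunov_plus_eq[OF norm P irr inv] lyapunov_minus_eq[OF norm P irr inv] by linarith+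
  interpret zero_growth P ?N by unfold_locales (use P irr uni zero in auto)
  obtain c where c: "0 < c" "controlled P ?N (\<lambda>n. c * sqrt (real n))" using controlled_sqrt by blast
  have "controlled P ?N (\<lambda>n. c * real n powr (1 - 1 / 2))"
    using controlled_mono[OF c(2)] by (simp add: powr_half_sqrt)
  from controlled_modulus[OF norm P irr inv c(1) _ _ this mean]
  have half: "\<exists>C \<delta>\<^sub>0. 0 < C \<and> 0 < \<delta>\<^sub>0 \<and> \<delta>\<^sub>0 < 1 \<and>
            (\<forall>B Q. (\<forall>i. invertible (B i)) \<longrightarrow> stochastic Q \<longrightarrow> same_transition_graph P Q \<longrightarrow>
               0 < pair_dist \<nu> A P B Q \<longrightarrow> pair_dist \<nu> A P B Q < \<delta>\<^sub>0 \<longrightarrow>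
               \<bar>lyapunov_plus \<nu> B Q - l\<^sub>0\<bar> \<le> C * ln (1 / pair_dist \<nu> A P B Q) powr (- (1 / 2)) \<and>
               \<bar>lyapunov_minus \<nu> B Q - l\<^sub>0\<bar> \<le> C * ln (1 / pair_dist \<nu> A P B Q) powr (- (1 / 2)))"
    by simp
  moreover have "\<exists>C \<delta>\<^sub>0. 0 < C \<and> 0 < \<delta>\<^sub>0 \<and> \<delta>\<^sub>0 < 1 \<and>
            (\<forall>B Q. (\<forall>i. invertible (B i)) \<longrightarrow> stochastic Q \<longrightarrow> same_transition_graph P Q \<longrightarrow>
               0 < pair_dist \<nu> A P B Q \<longrightarrow> pair_dist \<nu> A P B Q < \<delta>\<^sub>0 \<longrightarrow>
               \<bar>lyapunov_plus \<nu> B Q - l\<^sub>0\<bar> \<le> C * ln (1 / pair_dist \<nu> A P B Q) powr (-1) \<and>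
               \<bar>lyapunov_minus \<nu> B Q - l\<^sub>0\<bar> \<le> C * ln (1 / pair_dist \<nu> A P B Q) powr (-1))"
    if cnf: "compact_normal_form A P"
  proof -
    obtain d where d: "0 < d" "controlled P ?N (\<lambda>_. d)" using controlled_compact[OF P cnf] by blast
    \<comment> \<open>Bounded control is the case \<open>s = 1\<close>, as
      \<open>real n powr 0 = 1\<close> for \<open>n \<ge> 1\<close>.\<close>
    have "controlled P ?N (\<lambda>n. d * real n powr (1 - 1))"
      by (rule controlled_mono[OF d(2)]) simp
    from controlled_modulus[OF norm P irr inv d(1) _ _ this mean] show ?thesis by simp
  qed
  moreover have "(-1 / 2 :: real) = - (1 / 2)" by simp
  ultimately show ?thesis by (simp only:) blast
qed

end
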